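(* Let $n\ge3$, let $\lambda>0$, and let $\ell$, $m_-$, $m_+$ be the number of distinct principal curvatures and the multiplicities associated with an isoparametric family of hypersurfaces in the round sphere $\mathbb{S}^n$. Put $n_\pm=(n-1)-m_\pm$, with $n_-\le n_+$, and $$h(r)=\frac{n-1}{\ell}\cos r-\frac{m_+-m_-}{2}.$$ Then for any $p\in\left(1,\frac{n-n_-+2}{n-n_--2}\right)$ and any $k\in\mathbb{N}$, the equation $$w''+\frac{h(r)}{\sin r}w'+\frac{\lambda}{\ell^2}\left(|w|^{p-1}w-w\right)=0\quad\text{on }[0,\pi]$$ with boundary conditions $w'(0)=w'(\pi)=0$ admits a sign-changing solution $w_k$ having at least $k$ isolated zeroes in $[0,\pi]$ and at least $k+1$ isolated critical points.
   Context: For an isoparametric family on $\mathbb{S}^n$ (the regular level sets of the restriction to $\mathbb{S}^n$ of a Cartan–Münzner polynomial), $\ell\in\{1,2,3,4,6\}$ denotes the number of distinct (constant) principal curvatures of the hypersurfaces. By Münzner, the principal curvatures have at most two distinct multiplicities $m_-,m_+$ (equal if $\ell$ is odd), with $1\le m_-,m_+\le n-1$ and $\frac{n-1}{\ell}=\frac{m_-+m_+}{2}$. The numbers $n_\pm=(n-1)-m_\pm$ are the dimensions of the two focal submanifolds. The equation is singular at $r=0,\pi$: a solution is a function that is $C^2$ on $[0,\pi]$, satisfies the equation on $(0,\pi)$, and satisfies the boundary conditions at the endpoints. The fraction $\frac{n-n_-+2}{n-n_--2}$ is understood as $+\infty$ when $n-n_--2=0$. *)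

theory Defs
  imports "HOL-Analysis.Analysis"
begin

section \<open>Cartan--Muenzner polynomials\<close>

definition grad :: "('a::euclidean_space \<Rightarrow> real) \<Rightarrow> 'a \<Rightarrow> 'a" where
  "grad F x = (THE D. GDERIV F x :> D)"

definition laplacian :: "('a::euclidean_space \<Rightarrow> real) \<Rightarrow> 'a \<Rightarrow> real" where
  "laplacian F x = (\<Sum>b\<in>Basis. frechet_derivative (grad F) (at x) b \<bullet> b)"

text \<open>The exponent \<open>int g - 2\<close> is negative for \<open>g = 1\<close>, so the second equation is imposed
  away from the origin only.\<close>

definition cartan_muenzner_polynomial :: "('a::euclidean_space \<Rightarrow> real) \<Rightarrow> bool" where
  "cartan_muenzner_polynomial F \<longleftrightarrow>
     real_polynomial_function F \<and>
     (\<exists>(g::nat) (c::real).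
        g \<ge> 1 \<and>
        (\<forall>a x. F (a *\<^sub>R x) = a ^ g * F x) \<and>
        (\<forall>x. (norm (grad F x))\<^sup>2 = (real g)\<^sup>2 * norm x ^ (2 * g - 2)) \<and>
        (\<forall>x. x \<noteq> 0 \<longrightarrow> laplacian F x = c * norm x powi (int g - 2)))"


section \<open>Principal curvatures of the regular level sets in the unit sphere\<close>

text \<open>At a point of the unit sphere, \<open>sphere_grad F\<close> is the gradient of the restriction of \<open>F\<close> to
  the sphere.  The same formula extends it to the ambient space, which lets us differentiate it
  below; derivatives in directions tangent to the sphere do not depend on the extension.\<close>

definition sphere_grad :: "('a::euclidean_space \<Rightarrow> real) \<Rightarrow> 'a \<Rightarrow> 'a" where
  "sphere_grad F x = grad F x - (grad F x \<bullet> x) *\<^sub>R x"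

definition regular_point :: "('a::euclidean_space \<Rightarrow> real) \<Rightarrow> 'a \<Rightarrow> bool" where
  "regular_point F x \<longleftrightarrow> x \<in> sphere 0 1 \<and> sphere_grad F x \<noteq> 0"

definition unit_normal :: "('a::euclidean_space \<Rightarrow> real) \<Rightarrow> 'a \<Rightarrow> 'a" where
  "unit_normal F x = sgn (sphere_grad F x)"

definition level_tangent_space :: "('a::euclidean_space \<Rightarrow> real) \<Rightarrow> 'a \<Rightarrow> 'a set" where
  "level_tangent_space F x = {v. v \<bullet> x = 0 \<and> v \<bullet> unit_normal F x = 0}"

text \<open>The covariant derivative of the unit normal along the level set is its ambient derivative:
  the latter is already orthogonal to the position vector and to the normal.\<close>

definition shape_operator :: "('a::euclidean_space \<Rightarrow> real) \<Rightarrow> 'a \<Rightarrow> 'a \<Rightarrow> 'a" where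
  "shape_operator F x v = - frechet_derivative (unit_normal F) (at x) v"

definition curvature_space :: "('a::euclidean_space \<Rightarrow> real) \<Rightarrow> 'a \<Rightarrow> real \<Rightarrow> 'a set" where
  "curvature_space F x \<kappa> = {v \<in> level_tangent_space F x. shape_operator F x v = \<kappa> *\<^sub>R v}"

definition principal_curvatures :: "('a::euclidean_space \<Rightarrow> real) \<Rightarrow> 'a \<Rightarrow> real set" where
  "principal_curvatures F x = {\<kappa>. \<exists>v\<in>curvature_space F x \<kappa>. v \<noteq> 0}"

definition curvature_multiplicity :: "('a::euclidean_space \<Rightarrow> real) \<Rightarrow> 'a \<Rightarrow> real \<Rightarrow> nat" where
  "curvature_multiplicity F x \<kappa> = dim (curvature_space F x \<kappa>)"

text \<open>\<open>l\<close> is the number of distinct principal curvatures of the regular level sets of the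
  Cartan--Muenzner polynomial \<open>F\<close> in the unit sphere.  By Muenzner, the multiplicities of the
  principal curvatures \<open>\<kappa> 0 > \<dots> > \<kappa> (l - 1)\<close> alternate between two values, which agree if \<open>l\<close> is
  odd.  With respect to the normal in the direction of the gradient, \<open>m_minus\<close> is the multiplicity
  of the largest one, so the focal submanifold where \<open>F = 1\<close> has codimension \<open>m_minus + 1\<close> in the
  sphere.  The first conjunct excludes polynomials that are constant on the sphere, such as the
  squared norm, which have no regular level sets.\<close>

definition isoparametric_family ::
    "('a::euclidean_space \<Rightarrow> real) \<Rightarrow> nat \<Rightarrow> nat \<Rightarrow> nat \<Rightarrow> bool" where
  "isoparametric_family F l m_minus m_plus \<longleftrightarrow>
     cartan_muenzner_polynomial F \<and>
     (\<exists>x. regular_point F x) \<and>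
     (\<forall>x. regular_point F x \<longrightarrow>
        (\<exists>\<kappa> :: nat \<Rightarrow> real.
           (\<forall>i j. i < j \<and> j < l \<longrightarrow> \<kappa> j < \<kappa> i) \<and>
           principal_curvatures F x = \<kappa> ` {..<l} \<and>
           (\<forall>i<l. curvature_multiplicity F x (\<kappa> i) = (if even i then m_minus else m_plus)))) \<and>
     (odd l \<longrightarrow> m_minus = m_plus)"


section \<open>The singular Neumann problem\<close>

definition h_fun :: "nat \<Rightarrow> nat \<Rightarrow> nat \<Rightarrow> nat \<Rightarrow> real \<Rightarrow> real" where
  "h_fun n l m_minus m_plus r =
     (real n - 1) / real l * cos r - (real m_plus - real m_minus) / 2"

definition C2_with_derivs ::
    "real set \<Rightarrow> (real \<Rightarrow> real) \<Rightarrow> (real \<Rightarrow> real) \<Rightarrow> (real \<Rightarrow> real) \<Rightarrow> bool" where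
  "C2_with_derivs S w w' w'' \<longleftrightarrow>
     (\<forall>r\<in>S. (w has_real_derivative w' r) (at r within S)) \<and>
     (\<forall>r\<in>S. (w' has_real_derivative w'' r) (at r within S)) \<and>
     continuous_on S w''"

definition neumann_solution ::
    "nat \<Rightarrow> nat \<Rightarrow> nat \<Rightarrow> nat \<Rightarrow> real \<Rightarrow> real \<Rightarrow>
     (real \<Rightarrow> real) \<Rightarrow> (real \<Rightarrow> real) \<Rightarrow> (real \<Rightarrow> real) \<Rightarrow> bool" where
  "neumann_solution n l m_minus m_plus lam p w w' w'' \<longleftrightarrow>
     C2_with_derivs {0..pi} w w' w'' \<and>
     (\<forall>r\<in>{0<..<pi}.
        w'' r + h_fun n l m_minus m_plus r / sin r * w' r
          + lam / (real l)\<^sup>2 * (\<bar>w r\<bar> powr (p - 1) * w r - w r) = 0) \<and>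
     w' 0 = 0 \<and> w' pi = 0"

text \<open>The set is allowed to be infinite, hence no direct use of \<open>card\<close>.\<close>

definition has_at_least :: "nat \<Rightarrow> 'b set \<Rightarrow> bool" where
  "has_at_least k S \<longleftrightarrow> (\<exists>Z\<subseteq>S. finite Z \<and> card Z = k)"

end

theory Submission
  imports Defs
begin

text \<open>
  Write \<open>a = m_minus\<close> and \<open>b = m_plus\<close>.  The shape operator of a regular level set is self-adjoint on
  a tangent space of dimension \<open>n - 1\<close>, so the multiplicities add up: \<open>2 (n - 1) = l (a + b)\<close>.  Hence
  the coefficient \<open>h / sin\<close> is \<open>(a / 2) cot (r / 2) - (b / 2) tan (r / 2)\<close>.  Near \<open>0\<close> the equation
  looks like the radial equation in dimension \<open>a + 1\<close>, near \<open>\<pi>\<close> like the one in dimension \<open>b + 1\<close>, and the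
  reflection \<open>r \<mapsto> \<pi> - r\<close> exchanges \<open>a\<close> and \<open>b\<close>.  The function \<open>h\<close> has exactly one zero \<open>c\<close> in
  \<open>(0, \<pi>)\<close>; the friction term is nonnegative on \<open>[0, c]\<close>, and after reflection also on the other half.
  So each half can be treated by the same analysis, in which the energy decreases from the pole to \<open>c\<close>.

  The solution is found by shooting from both poles and matching at \<open>c\<close>.  The solution \<open>w\<close> with
  \<open>w(0) = d\<close> has a phase angle, the lifted angle of \<open>(A w, w')\<close> starting from \<open>0\<close>, where \<open>A > 0\<close> is a
  fixed large constant.  The normalised solution \<open>w / d\<close> still makes sense for \<open>d = 0\<close>, where it solves
  the linearised equation; its angle at \<open>c\<close> then exceeds \<open>-\<pi> / 2\<close>.  For large \<open>d\<close> the angle at \<open>c\<close>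
  is below \<open>\<pi> / 2 - A c / 8\<close>, which is as negative as desired.  Given shooting values \<open>d\<close> and \<open>e\<close> from the
  two poles, the two halves match as soon as the angles at \<open>c\<close> add up to \<open>-2 (k + 1) \<pi>\<close> and the
  distances of \<open>(A w, w')\<close> from the origin agree (\<open>half_problem.radius\<close>).  On the boundary of a large
  rectangle of values \<open>(d, e)\<close> these two quantities have a sign pattern which, by the Brouwer fixed
  point theorem, forces a common zero (\<open>common_zero_on_rectangle\<close>).  At that zero one of the two halves
  turns by at least \<open>(k + 1) \<pi>\<close>, and the intermediate value theorem for its angle produces the zeros and
  the critical points.  They are isolated because a nonconstant solution never meets a rest point.

  Subcriticality of \<open>p\<close> enters in one place, \<open>half_problem.energy_large\<close>: for \<open>d \<rightarrow> \<infinity>\<close> the energy at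
  \<open>c\<close> tends to infinity.  A Pohozaev identity with multiplier \<open>r\<close> bounds the energy from below by the
  contribution of the interval, of length about \<open>d powr ((1 - p) / 2)\<close>, on which \<open>w\<close> is still at least
  \<open>d / 2\<close>.  This contribution is of order \<open>d powr (p + 1 - (p - 1) (a + 1) / 2)\<close>, and the exponent is
  positive exactly when \<open>p (a - 1) < a + 3\<close>.  Large energy in turn means fast rotation
  (\<open>half_problem.angle_large\<close>).
\<close>

section \<open>Multiplicities of the principal curvatures\<close>

text \<open>The gradient and the Hessian are produced together by induction over the polynomial.  Symmetry of
  the Hessian is preserved by sums and products.\<close>

lemma polynomial_gradient_symmetric_hessian:
  fixes F :: "'a::euclidean_space \<Rightarrow> real"
  assumes "real_polynomial_function F"
  shows "\<exists>G H. (\<forall>x. GDERIV F x :> G x) \<and> (\<forall>x. (G has_derivative H x) (at x)) \<and>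
           (\<forall>x u v. H x u \<bullet> v = u \<bullet> H x v)"
  using assms
proof (induction F rule: real_polynomial_function.induct)
  case (linear f)
  have "\<forall>x. GDERIV f x :> adjoint f 1"
    unfolding gderiv_def
  proof
    fix x
    have l: "linear f" using linear bounded_linear.linear by blast
    have "(\<lambda>h. h \<bullet> adjoint f 1) = f"
      using adjoint_works[OF l, of _ 1] by (auto simp: fun_eq_iff inner_commute)
    then show "(f has_derivative (\<lambda>h. h \<bullet> adjoint f 1)) (at x)"
      using bounded_linear_imp_has_derivative[OF linear] by simp
  qed
  then show ?case
    by (intro exI[of _ "\<lambda>_. adjoint f 1"] exI[of _ "\<lambda>_ _. 0"]) auto
next
  case (const c)
  show ?case
    by (intro exI[of _ "\<lambda>_. 0"] exI[of _ "\<lambda>_ _. 0"]) (auto simp: gderiv_def)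
next
  case (add f g)
  then obtain Gf Hf Gg Hg where
    f: "\<And>x. GDERIV f x :> Gf x" "\<And>x. (Gf has_derivative Hf x) (at x)" "\<And>x u v. Hf x u \<bullet> v = u \<bullet> Hf x v" and
    g: "\<And>x. GDERIV g x :> Gg x" "\<And>x. (Gg has_derivative Hg x) (at x)" "\<And>x u v. Hg x u \<bullet> v = u \<bullet> Hg x v"
    by metis
  show ?case
    by (intro exI[of _ "\<lambda>x. Gf x + Gg x"] exI[of _ "\<lambda>x v. Hf x v + Hg x v"])
       (auto intro: GDERIV_add f g has_derivative_add simp: inner_simps f(3) g(3))
next
  case (mult f g)
  then obtain Gf Hf Gg Hg where
    f: "\<And>x. GDERIV f x :> Gf x" "\<And>x. (Gf has_derivative Hf x) (at x)" "\<And>x u v. Hf x u \<bullet> v = u \<bullet> Hf x v" and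
    g: "\<And>x. GDERIV g x :> Gg x" "\<And>x. (Gg has_derivative Hg x) (at x)" "\<And>x u v. Hg x u \<bullet> v = u \<bullet> Hg x v"
    by metis
  have df: "(f has_derivative (\<lambda>h. h \<bullet> Gf x)) (at x)" "(g has_derivative (\<lambda>h. h \<bullet> Gg x)) (at x)" for x
    using f(1) g(1) by (auto simp: gderiv_def)
  let ?G = "\<lambda>x. f x *\<^sub>R Gg x + g x *\<^sub>R Gf x"
  let ?H = "\<lambda>x v. (f x *\<^sub>R Hg x v + (v \<bullet> Gf x) *\<^sub>R Gg x) + (g x *\<^sub>R Hf x v + (v \<bullet> Gg x) *\<^sub>R Gf x)"
  have 1: "GDERIV (\<lambda>x. f x * g x) x :> ?G x" for x
    using GDERIV_mult[OF f(1) g(1), of x] by (simp add: add.commute)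
  have 2: "(?G has_derivative ?H x) (at x)" for x
    by (intro derivative_intros df f g)
  have 3: "?H x u \<bullet> v = u \<bullet> ?H x v" for x u v
    by (simp add: inner_simps f(3)[of x u v] g(3)[of x u v] inner_commute[of "Gg x"] inner_commute[of "Gf x"])
  show ?case
    using 1 2 3 by (intro exI[of _ ?G] exI[of _ ?H]) blast
qed

text \<open>A maximum point of the quadratic form on the unit sphere of \<open>U\<close> is an eigenvector.  With \<open>\<kappa>\<close> the
  maximal value, the form \<open>\<kappa> (w \<bullet> w) - A w \<bullet> w\<close> is nonnegative on \<open>U\<close> and vanishes at \<open>v\<close>, hence its first
  variation at \<open>v\<close> vanishes.\<close>

lemma symmetric_operator_eigenvector:
  fixes A :: "'a::euclidean_space \<Rightarrow> 'a"
  assumes "linear A" "subspace U" "U \<noteq> {0}"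
    and inv: "\<And>v. v \<in> U \<Longrightarrow> A v \<in> U"
    and sym: "\<And>u v. u \<in> U \<Longrightarrow> v \<in> U \<Longrightarrow> A u \<bullet> v = u \<bullet> A v"
  shows "\<exists>\<kappa> v. v \<in> U \<and> v \<noteq> 0 \<and> A v = \<kappa> *\<^sub>R v"
proof -
  interpret A: linear A by fact
  let ?S = "U \<inter> sphere 0 1"
  have cpt: "compact ?S"
    by (rule closed_Int_compact) (auto intro: closed_subspace assms)
  obtain u0 where u0: "u0 \<in> U" "u0 \<noteq> 0"
    using assms(2,3) subspace_0 by blast
  have "u0 /\<^sub>R norm u0 \<in> ?S"
    using u0 \<open>subspace U\<close> by (auto simp: subspace_scale)
  then have ne: "?S \<noteq> {}" by blast
  have "continuous_on ?S (\<lambda>v. A v \<bullet> v)"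
    by (intro continuous_intros linear_continuous_on linear_conv_bounded_linear[THEN iffD1] assms)
  then obtain v where v: "v \<in> ?S" "\<And>w. w \<in> ?S \<Longrightarrow> A w \<bullet> w \<le> A v \<bullet> v"
    using continuous_attains_sup[OF cpt ne] by blast
  define \<kappa> where "\<kappa> = A v \<bullet> v"
  have vU: "v \<in> U" "norm v = 1" using v by auto
  have quad: "A w \<bullet> w \<le> \<kappa> * (w \<bullet> w)" if "w \<in> U" for w
  proof (cases "w = 0")
    case False
    have "w /\<^sub>R norm w \<in> ?S"
      using that False \<open>subspace U\<close> by (auto simp: subspace_scale)
    from v(2)[OF this] have "(A w \<bullet> w) / (norm w)\<^sup>2 \<le> \<kappa>"
      by (simp add: A.scaleR \<kappa>_def power2_eq_square divide_simps)
    then show ?thesis using False by (simp add: divide_simps dot_square_norm)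
  qed (simp add: A.zero)
  have orth: "(\<kappa> *\<^sub>R v - A v) \<bullet> w = 0" if w: "w \<in> U" for w
  proof (rule ccontr)
    define B where "B = (\<kappa> *\<^sub>R v - A v) \<bullet> w"
    define q where "q = \<kappa> * (w \<bullet> w) - A w \<bullet> w"
    assume "(\<kappa> *\<^sub>R v - A v) \<bullet> w \<noteq> 0"
    then have B: "B \<noteq> 0" by (simp add: B_def)
    have q: "q \<ge> 0" using quad[OF w] by (simp add: q_def)
    have main: "0 \<le> 2 * t * B + t\<^sup>2 * q" for t
    proof -
      have "v + t *\<^sub>R w \<in> U" using vU w \<open>subspace U\<close> by (simp add: subspace_add subspace_scale)
      from quad[OF this]
      have "A v \<bullet> v + t * (A v \<bullet> w) + t * (A w \<bullet> v) + t\<^sup>2 * (A w \<bullet> w)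
        \<le> \<kappa> * (v \<bullet> v + 2 * t * (v \<bullet> w) + t\<^sup>2 * (w \<bullet> w))"
        by (simp add: A.add A.scaleR inner_simps power2_eq_square inner_commute algebra_simps)
      moreover have "A w \<bullet> v = A v \<bullet> w" using sym[OF w vU(1)] by (simp add: inner_commute)
      moreover have "A v \<bullet> v = \<kappa> * (v \<bullet> v)" using vU by (simp add: \<kappa>_def dot_square_norm)
      ultimately show ?thesis
        by (simp add: B_def q_def inner_simps algebra_simps)
    qed
    \<comment> \<open>A small step against the nonzero slope \<open>B\<close>; dividing by \<open>q + 1\<close> lets the linear term win.\<close>
    define t where "t = - B / (q + 1)"
    have tq: "t * q = - B - t" using q by (simp add: t_def field_simps)
    have "t * B = - (B\<^sup>2 / (q + 1))" by (simp add: t_def power2_eq_square)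
    then have tB: "t * B < 0" using q B by simp
    have "0 \<le> 2 * t * B + t * (t * q)" using main[of t] by (simp add: power2_eq_square algebra_simps)
    also have "\<dots> = t * B - t * t" unfolding tq by (simp add: algebra_simps)
    also have "\<dots> < 0" using tB by (smt (verit) zero_le_square)
    finally show False by simp
  qed
  have "\<kappa> *\<^sub>R v - A v \<in> U" using vU inv \<open>subspace U\<close> by (simp add: subspace_diff subspace_scale)
  from orth[OF this] have "A v = \<kappa> *\<^sub>R v" by simp
  then show ?thesis using vU by (intro exI[of _ \<kappa>] exI[of _ v]) auto
qed

text \<open>The eigenspaces are pairwise orthogonal, and they exhaust \<open>V\<close>: their orthogonal complement in \<open>V\<close> is
  invariant, so if it were nonzero it would contain a further eigenvector.\<close>

lemma symmetric_operator_eigenspace_dims: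
  fixes A :: "'a::euclidean_space \<Rightarrow> 'a" and \<kappa> :: "nat \<Rightarrow> real"
  assumes lin: "linear A" and V: "subspace V"
    and inv: "\<And>v. v \<in> V \<Longrightarrow> A v \<in> V"
    and sym: "\<And>u v. u \<in> V \<Longrightarrow> v \<in> V \<Longrightarrow> A u \<bullet> v = u \<bullet> A v"
    and inj: "inj_on \<kappa> {..<l}"
    and all: "\<And>\<nu> v. v \<in> V \<Longrightarrow> v \<noteq> 0 \<Longrightarrow> A v = \<nu> *\<^sub>R v \<Longrightarrow> \<nu> \<in> \<kappa> ` {..<l}"
  shows "dim V = (\<Sum>i<l. dim {v \<in> V. A v = \<kappa> i *\<^sub>R v})"
proof -
  interpret A: linear A by fact
  define S where "S = (\<lambda>i. {v \<in> V. A v = \<kappa> i *\<^sub>R v})"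
  have orthS: "x \<bullet> y = 0" if "x \<in> S i" "y \<in> S j" "i < l" "j < l" "i \<noteq> j" for x y i j
  proof -
    have "\<kappa> i * (x \<bullet> y) = \<kappa> j * (x \<bullet> y)"
      using that sym[of x y] by (auto simp: S_def)
    moreover have "\<kappa> i \<noteq> \<kappa> j" using that inj by (auto simp: inj_on_def)
    ultimately show ?thesis by simp
  qed
  have dims: "dim (\<Union>i<k. S i) = (\<Sum>i<k. dim (S i))" if "k \<le> l" for k
    using that
  proof (induction k)
    case (Suc k)
    have "dim ((\<Union>i<k. S i) \<union> S k) = dim (\<Union>i<k. S i) + dim (S k)"
    proof (rule dim_orthogonal_sum)
      fix x y assume "x \<in> (\<Union>i<k. S i)" "y \<in> S k"
      then show "x \<bullet> y = 0" using orthS Suc.prems by auto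
    qed
    moreover have "(\<Union>i<Suc k. S i) = (\<Union>i<k. S i) \<union> S k" by (auto simp: less_Suc_eq)
    ultimately show ?case using Suc by simp
  qed simp
  let ?W = "\<Union>i<l. S i"
  have WV: "span ?W \<subseteq> V" by (rule span_minimal) (auto simp: S_def V)
  define U where "U = {v \<in> V. \<forall>w\<in>?W. w \<bullet> v = 0}"
  have subU: "subspace U"
    using V by (auto simp: U_def subspace_def inner_simps)
  have U0: "U = {0}"
  proof (rule ccontr)
    assume "U \<noteq> {0}"
    then obtain \<nu> v where v: "v \<in> U" "v \<noteq> 0" "A v = \<nu> *\<^sub>R v"
    proof (rule symmetric_operator_eigenvector[OF lin subU, THEN exE])
      fix v assume v: "v \<in> U"
      have "w \<bullet> A v = 0" if w: "w \<in> S i" "i < l" for w i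
      proof -
        have "w \<bullet> A v = A w \<bullet> v" using sym[of w v] w v by (auto simp: S_def U_def)
        also have "\<dots> = \<kappa> i * (w \<bullet> v)" using w by (auto simp: S_def)
        also have "\<dots> = 0" using w v by (auto simp: U_def)
        finally show ?thesis .
      qed
      then show "A v \<in> U" using v inv by (auto simp: U_def)
    next
      fix u v assume "u \<in> U" "v \<in> U"
      then show "A u \<bullet> v = u \<bullet> A v" using sym by (auto simp: U_def)
    qed blast
    obtain i where "i < l" "\<nu> = \<kappa> i" using all[of v \<nu>] v by (auto simp: U_def)
    then have "v \<in> ?W" using v by (auto simp: S_def U_def)
    then have "v \<bullet> v = 0" using v(1) unfolding U_def by blast
    then show False using v by simp
  qed
  have "V \<subseteq> span ?W"
  proof
    fix v assume v: "v \<in> V"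
    obtain y z where yz: "y \<in> span ?W" "\<And>w. w \<in> span ?W \<Longrightarrow> orthogonal z w" "v = y + z"
      by (rule orthogonal_subspace_decomp_exists[of ?W v]) blast
    have "z \<in> V" using v yz WV V by (metis add_diff_cancel_left' subsetD subspace_diff)
    moreover have "w \<bullet> z = 0" if "w \<in> ?W" for w
      using yz(2)[OF span_base[OF that]] by (simp add: orthogonal_def inner_commute)
    ultimately have "z \<in> U" by (auto simp: U_def)
    then show "v \<in> span ?W" using U0 yz by simp
  qed
  then have "dim V = dim ?W" using WV by (metis dim_span subset_antisym)
  then show ?thesis using dims[of l] by (simp add: S_def)
qed

lemma has_derivative_sgn:
  fixes f :: "'b::real_normed_vector \<Rightarrow> 'a::real_inner"
  assumes f: "(f has_derivative f') (at x)" and nz: "f x \<noteq> 0"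
  shows "((\<lambda>y. sgn (f y)) has_derivative
           (\<lambda>h. f' h /\<^sub>R norm (f x) - ((sgn (f x) \<bullet> f' h) / (norm (f x))\<^sup>2) *\<^sub>R f x)) (at x)"
proof -
  have n: "((\<lambda>y. norm (f y)) has_derivative (\<lambda>h. f' h \<bullet> sgn (f x))) (at x)"
    using has_derivative_compose[OF f has_derivative_norm[OF nz]] by simp
  have "((\<lambda>y. inverse (norm (f y)) *\<^sub>R f y) has_derivative
     (\<lambda>h. inverse (norm (f x)) *\<^sub>R f' h + (- (inverse (norm (f x)) * (f' h \<bullet> sgn (f x)) * inverse (norm (f x)))) *\<^sub>R f x)) (at x)"
    using nz by (auto intro!: derivative_eq_intros n f)
  then show ?thesis
    by (simp add: sgn_div_norm inner_commute power2_eq_square field_simps)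
qed

text \<open>Up to a scalar factor and a multiple of the identity, the shape operator is the compression of the
  Hessian of \<open>F\<close> to the tangent space of the level set.  Hence it is self-adjoint, and the multiplicities
  of its eigenvalues add up to the dimension \<open>n - 1\<close> of that space.\<close>

lemma isoparametric_multiplicities:
  fixes F :: "'a::euclidean_space \<Rightarrow> real"
  assumes dim: "DIM('a) = n + 1" and n: "n \<ge> 3"
    and iso: "isoparametric_family F l m_minus m_plus"
  shows "l \<ge> 1" "m_minus \<ge> 1" "m_plus \<ge> 1"
    "2 * (n - 1) = l * (m_minus + m_plus)"
proof -
  have poly: "real_polynomial_function F"
    using iso by (simp add: isoparametric_family_def cartan_muenzner_polynomial_def)
  obtain x where x: "regular_point F x" using iso by (auto simp: isoparametric_family_def)
  obtain \<kappa> :: "nat \<Rightarrow> real" where \<kappa>: "\<And>i j. i < j \<Longrightarrow> j < l \<Longrightarrow> \<kappa> j < \<kappa> i"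
     "principal_curvatures F x = \<kappa> ` {..<l}"
     "\<And>i. i < l \<Longrightarrow> curvature_multiplicity F x (\<kappa> i) = (if even i then m_minus else m_plus)"
    using iso x unfolding isoparametric_family_def by meson
  have odd: "odd l \<Longrightarrow> m_minus = m_plus" using iso by (simp add: isoparametric_family_def)
  obtain G H where G: "\<And>x. GDERIV F x :> G x" and dG: "\<And>x. (G has_derivative H x) (at x)"
    and Hsym: "\<And>x u v. H x u \<bullet> v = u \<bullet> H x v"
    using polynomial_gradient_symmetric_hessian[OF poly] by metis
  have grad: "grad F = G"
  proof (rule ext)
    fix y
    have "D = G y" if "GDERIV F y :> D" for D
    proof -
      have "(\<lambda>h. h \<bullet> D) = (\<lambda>h. h \<bullet> G y)"
        using that G[of y] has_derivative_unique unfolding gderiv_def by blast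
      then have "\<forall>h. h \<bullet> D = h \<bullet> G y" by (simp add: fun_eq_iff)
      then show ?thesis using vector_eq_ldot by blast
    qed
    then show "grad F y = G y" unfolding grad_def using G by blast
  qed
  define s where "s = norm (sphere_grad F x)"
  define \<nu> where "\<nu> = unit_normal F x"
  have x1: "norm x = 1" and s0: "s > 0" using x by (auto simp: regular_point_def s_def)
  have xx: "x \<bullet> x = 1" using x1 by (simp add: dot_square_norm)
  have Sg: "sphere_grad F = (\<lambda>y. G y - (G y \<bullet> y) *\<^sub>R y)"
    by (simp add: sphere_grad_def grad fun_eq_iff)
  have \<nu>s: "s *\<^sub>R \<nu> = sphere_grad F x" using s0 by (simp add: \<nu>_def s_def unit_normal_def sgn_div_norm)
  have \<nu>1: "\<nu> \<bullet> \<nu> = 1"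
    using x by (simp add: \<nu>_def unit_normal_def dot_square_norm norm_sgn regular_point_def)
  have "sphere_grad F x \<bullet> x = 0" by (simp add: Sg inner_simps xx)
  then have \<nu>x: "\<nu> \<bullet> x = 0" using s0 by (metis \<nu>s inner_scaleR_left mult_eq_0_iff less_irrefl)
  define S' where "S' = (\<lambda>v. H x v - ((G x \<bullet> x) *\<^sub>R v + (G x \<bullet> v + H x v \<bullet> x) *\<^sub>R x))"
  have dS: "(sphere_grad F has_derivative S') (at x)"
    unfolding Sg S'_def by (auto intro!: derivative_eq_intros dG)
  have d\<nu>: "(unit_normal F has_derivative (\<lambda>h. S' h /\<^sub>R s - ((\<nu> \<bullet> S' h) / s) *\<^sub>R \<nu>)) (at x)"
  proof -
    have "((\<nu> \<bullet> S' h) / s\<^sup>2) *\<^sub>R sphere_grad F x = ((\<nu> \<bullet> S' h) / s) *\<^sub>R \<nu>" for h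
      using s0 by (simp flip: \<nu>s add: power2_eq_square)
    moreover have "unit_normal F = (\<lambda>y. sgn (sphere_grad F y))"
      by (simp add: unit_normal_def fun_eq_iff)
    ultimately show ?thesis
      using has_derivative_sgn[OF dS] s0 by (simp add: s_def \<nu>_def unit_normal_def)
  qed
  define A where "A = shape_operator F x"
  have A: "A v = ((\<nu> \<bullet> S' v) / s) *\<^sub>R \<nu> - S' v /\<^sub>R s" for v
    using fun_cong[OF frechet_derivative_at[OF d\<nu>], of v, symmetric] by (simp add: A_def shape_operator_def)
  have linA: "linear A"
    unfolding A_def shape_operator_def
    using linear_frechet_derivative[of "unit_normal F" "at x"] d\<nu>
    by (auto intro!: linear_compose_neg simp: differentiable_def)
  define V where "V = level_tangent_space F x"
  have Viff: "v \<in> V \<longleftrightarrow> v \<bullet> x = 0 \<and> v \<bullet> \<nu> = 0" for v by (simp add: V_def level_tangent_space_def \<nu>_def)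
  have subV: "subspace V" unfolding subspace_def by (auto simp: Viff inner_simps)
  have Gv: "G x \<bullet> v = 0" if "v \<in> V" for v
  proof -
    have "G x = s *\<^sub>R \<nu> + (G x \<bullet> x) *\<^sub>R x" by (simp add: \<nu>s Sg)
    then show ?thesis using that by (metis Viff add.right_neutral inner_add_left inner_commute inner_scaleR_left mult_zero_right)
  qed
  have inv: "A v \<in> V" if "v \<in> V" for v
  proof -
    have "S' v \<bullet> x = 0" using Gv[OF that] that by (simp add: S'_def inner_simps xx Viff)
    then show ?thesis using s0
      by (simp add: A Viff inner_diff_left \<nu>x \<nu>1 inner_commute[of "S' v" \<nu>] divide_inverse)
  qed
  have sym: "A u \<bullet> v = u \<bullet> A v" if "u \<in> V" "v \<in> V" for u v
  proof -
    have 0: "\<nu> \<bullet> v = 0" "u \<bullet> \<nu> = 0" "x \<bullet> v = 0" "u \<bullet> x = 0"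
      using that by (auto simp: Viff inner_commute)
    have "A u \<bullet> v = - (S' u \<bullet> v / s)" "u \<bullet> A v = - (u \<bullet> S' v / s)"
      by (auto simp: A inner_diff_left inner_diff_right 0 divide_inverse_commute)
    moreover have "S' u \<bullet> v = u \<bullet> S' v"
      by (simp add: S'_def inner_diff_left inner_diff_right inner_add_left inner_add_right 0 Hsym)
    ultimately show ?thesis by simp
  qed
  have cs: "curvature_space F x k = {v \<in> V. A v = k *\<^sub>R v}" for k
    by (simp add: curvature_space_def V_def A_def)
  have "dim V = (\<Sum>i<l. dim {v \<in> V. A v = \<kappa> i *\<^sub>R v})"
  proof (rule symmetric_operator_eigenspace_dims[OF linA subV inv sym])
    show "inj_on \<kappa> {..<l}"
      using \<kappa>(1) by (metis (no_types, lifting) inj_onI lessThan_iff less_irrefl linorder_neqE_nat)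
    show "\<mu> \<in> \<kappa> ` {..<l}" if "v \<in> V" "v \<noteq> 0" "A v = \<mu> *\<^sub>R v" for \<mu> v
      unfolding \<kappa>(2)[symmetric] principal_curvatures_def cs using that by blast
  qed
  also have "\<dots> = (\<Sum>i<l. if even i then m_minus else m_plus)"
    using \<kappa>(3) by (intro sum.cong) (auto simp: cs[symmetric] curvature_multiplicity_def)
  finally have dimV: "dim V = (\<Sum>i<l. if even i then m_minus else m_plus)" .
  have dimV': "dim V = n - 1"
  proof -
    have V_eq: "V = {y \<in> UNIV. \<forall>z \<in> span {x, \<nu>}. orthogonal z y}"
    proof (intro set_eqI iffI)
      fix v assume "v \<in> V"
      then have "orthogonal v z" if "z \<in> span {x, \<nu>}" for z
        using that by (intro orthogonal_to_span[of z "{x, \<nu>}"]) (auto simp: Viff orthogonal_def)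
      then show "v \<in> {y \<in> UNIV. \<forall>z \<in> span {x, \<nu>}. orthogonal z y}" by (auto simp: orthogonal_commute)
    next
      fix v assume "v \<in> {y \<in> UNIV. \<forall>z \<in> span {x, \<nu>}. orthogonal z y}"
      then show "v \<in> V" by (auto simp: Viff orthogonal_def inner_commute span_base)
    qed
    have "dim (span {x, \<nu>}) = 2"
    proof -
      have "x \<noteq> \<nu>" using \<nu>x xx by auto
      moreover have "independent {x, \<nu>}"
        using \<nu>x xx \<nu>1 by (intro pairwise_orthogonal_independent) (auto simp: pairwise_def orthogonal_def inner_commute)
      ultimately show ?thesis by (simp add: dim_eq_card_independent)
    qed
    moreover have "dim V + dim (span {x, \<nu>}) = dim (UNIV :: 'a set)"
      unfolding V_eq by (intro dim_subspace_orthogonal_to_vectors) auto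
    ultimately show ?thesis using dim n by simp
  qed
  have pos: "curvature_multiplicity F x (\<kappa> i) \<ge> 1" if "i < l" for i
  proof -
    have "\<kappa> i \<in> principal_curvatures F x" using that \<kappa>(2) by auto
    then obtain v where "v \<in> curvature_space F x (\<kappa> i)" "v \<noteq> 0" by (auto simp: principal_curvatures_def)
    then have "\<not> curvature_space F x (\<kappa> i) \<subseteq> {0}" by auto
    then show ?thesis by (metis One_nat_def Suc_leI curvature_multiplicity_def dim_eq_0 gr0I)
  qed
  show l: "l \<ge> 1" using dimV dimV' n by (cases l) auto
  show mm: "m_minus \<ge> 1" using pos[of 0] \<kappa>(3)[of 0] l by auto
  show "m_plus \<ge> 1"
    using pos[of 1] \<kappa>(3)[of 1] l mm odd by (cases "l = 1") auto
  have sums: "2 * (\<Sum>i<2 * j. if even i then m_minus else m_plus) = 2 * j * (m_minus + m_plus)" for j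
    by (induction j) (auto simp: algebra_simps)
  show "2 * (n - 1) = l * (m_minus + m_plus)"
  proof (cases "even l")
    case True
    then show ?thesis using sums[of "l div 2"] dimV dimV' by simp
  next
    case False
    then have "(\<Sum>i<l. if even i then m_minus else m_plus) = (\<Sum>i<l. m_minus)" using odd by (intro sum.cong) auto
    then show ?thesis using dimV dimV' odd False by simp
  qed
qed

section \<open>The odd power nonlinearity\<close>

text \<open>The odd extension of \<open>t \<mapsto> t powr p\<close> from the positive half-line.\<close>

definition odd_power :: "real \<Rightarrow> real \<Rightarrow> real" where
  "odd_power p t = \<bar>t\<bar> powr (p - 1) * t"

lemma odd_power_0 [simp]: "odd_power p 0 = 0" by (simp add: odd_power_def)

lemma odd_power_1 [simp]: "odd_power p 1 = 1" by (simp add: odd_power_def)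

lemma odd_power_minus [simp]: "odd_power p (- t) = - odd_power p t" by (simp add: odd_power_def)

lemma odd_power_pos: "t > 0 \<Longrightarrow> odd_power p t = t powr p"
  by (simp add: odd_power_def powr_mult_base[symmetric] mult.commute) (metis add.commute diff_add_cancel less_eq_real_def powr_mult_base)

lemma odd_power_scale: "k \<ge> 0 \<Longrightarrow> odd_power p (k * t) = k * (k powr (p - 1) * odd_power p t)"
  by (simp add: odd_power_def abs_mult powr_mult)

lemma odd_power_deriv:
  assumes "p > 1"
  shows "(odd_power p has_real_derivative p * \<bar>t\<bar> powr (p - 1)) (at t)"
proof -
  consider "t > 0" | "t < 0" | "t = 0" by linarith
  then show ?thesis
  proof cases
    case 1
    have "((\<lambda>s. s powr p) has_real_derivative p * t powr (p - 1)) (at t)"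
      using 1 by (rule has_real_derivative_powr)
    then show ?thesis using 1
      by (auto intro!: has_field_derivative_transform_within_open[of "\<lambda>s. s powr p" _ t "{0<..}"] simp: odd_power_pos)
  next
    case 2
    have "((\<lambda>s. - ((- s) powr p)) has_real_derivative p * (- t) powr (p - 1)) (at t)"
      using 2 by (auto intro!: derivative_eq_intros)
    moreover have "- ((- s) powr p) = odd_power p s" if "s < 0" for s
      using that odd_power_pos[of "- s" p] by simp
    ultimately show ?thesis using 2
      by (auto intro!: has_field_derivative_transform_within_open[of "\<lambda>s. - ((- s) powr p)" _ t "{..<0}"])
  next
    case 3
    have "((\<lambda>s. \<bar>s\<bar> powr (p - 1)) \<longlongrightarrow> 0) (at (0::real))"
    proof -
      have "((\<lambda>s::real. \<bar>s\<bar>) \<longlongrightarrow> 0) (at 0)" by (rule tendsto_eq_intros | simp)+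
      then show ?thesis using assms by (intro tendsto_zero_powrI[where b="p - 1"]) auto
    qed
    then have "((\<lambda>s. (odd_power p (0 + s) - odd_power p 0) / s) \<longlongrightarrow> 0) (at 0)"
      by (rule tendsto_cong[THEN iffD1, rotated]) (auto simp: eventually_at_filter odd_power_def)
    then show ?thesis using 3 assms by (simp add: DERIV_def)
  qed
qed

lemma continuous_odd_power [continuous_intros]:
  assumes "p > 1" "continuous_on S f"
  shows "continuous_on S (\<lambda>x. odd_power p (f x))"
proof -
  have "continuous_on UNIV (odd_power p)"
    using odd_power_deriv[OF assms(1)] by (intro DERIV_continuous_on) blast
  then show ?thesis using assms(2) by (metis continuous_on_compose2 subset_UNIV)
qed

lemma odd_power_mult_self: "t * odd_power p t = \<bar>t\<bar> powr (p - 1) * t\<^sup>2"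
  by (simp add: odd_power_def power2_eq_square)

lemma odd_power_mult_self_nonneg: "t * odd_power p t \<ge> 0"
  by (simp add: odd_power_mult_self)

lemma odd_power_primitive:
  assumes "p > 1"
  shows "((\<lambda>t. t * odd_power p t / (p + 1)) has_real_derivative odd_power p t) (at t)"
proof -
  have "((\<lambda>t. t * odd_power p t / (p + 1)) has_real_derivative
      (1 * odd_power p t + p * \<bar>t\<bar> powr (p - 1) * t) / (p + 1)) (at t)"
    by (intro DERIV_cdivide DERIV_mult DERIV_ident odd_power_deriv assms)
  moreover have "(1 * odd_power p t + p * \<bar>t\<bar> powr (p - 1) * t) / (p + 1) = odd_power p t"
    using assms by (simp add: odd_power_def field_simps)
  ultimately show ?thesis by simp
qed

lemma odd_power_bound:
  assumes "p > 1" "\<bar>t\<bar> \<le> T"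
  shows "\<bar>odd_power p t\<bar> \<le> T powr (p - 1) * T"
  using assms by (auto simp: odd_power_def abs_mult intro!: mult_mono powr_mono2)

lemma nonlinearity_bound:
  assumes "p > 1" "\<bar>t\<bar> \<le> d" "d \<ge> 1"
  shows "\<bar>odd_power p t - t\<bar> \<le> d powr p"
proof -
  have "d powr p \<ge> d" using powr_mono[of 1 p d] assms by simp
  moreover have "\<bar>odd_power p t\<bar> \<le> d powr p"
    using odd_power_bound[OF assms(1,2)] odd_power_pos[of d p] assms by (simp add: odd_power_def)
  moreover have "odd_power p t \<ge> 0" if "t \<ge> 0" using that by (simp add: odd_power_def)
  moreover have "odd_power p t \<le> 0" if "t \<le> 0" using that by (simp add: odd_power_def mult_nonneg_nonpos)
  ultimately show ?thesis using assms(2) by (cases "t \<ge> 0") auto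
qed

text \<open>Superlinearity: as \<open>p > 1\<close>, the potential absorbs every quadratic term up to a constant.\<close>

lemma odd_power_superquadratic:
  assumes "p > 1" "\<alpha> > 0" "B \<ge> 0"
  shows "\<exists>C\<ge>0. \<forall>t. B * t\<^sup>2 \<le> \<alpha> * (t * odd_power p t) + C"
proof -
  define T where "T = (B / \<alpha>) powr (1 / (p - 1))"
  have T: "T \<ge> 0" "T powr (p - 1) = B / \<alpha>"
    using assms by (auto simp: T_def powr_powr)
  have "B * t\<^sup>2 \<le> \<alpha> * (t * odd_power p t) + B * T\<^sup>2" for t
  proof (cases "\<bar>t\<bar> \<le> T")
    case True
    then have "t\<^sup>2 \<le> T\<^sup>2" by (metis abs_ge_zero power2_abs power_mono)
    then show ?thesis using assms odd_power_mult_self_nonneg[of t p] by (smt (verit) mult_left_mono mult_nonneg_nonneg)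
  next
    case False
    then have "B / \<alpha> \<le> \<bar>t\<bar> powr (p - 1)" using T assms powr_mono2[of "p - 1" T "\<bar>t\<bar>"] by simp
    then have "B \<le> \<alpha> * \<bar>t\<bar> powr (p - 1)" using assms by (simp add: field_simps)
    then have "B * t\<^sup>2 \<le> (\<alpha> * \<bar>t\<bar> powr (p - 1)) * t\<^sup>2" by (intro mult_right_mono) auto
    moreover have "B * T\<^sup>2 \<ge> 0" using assms by simp
    ultimately show ?thesis by (simp add: odd_power_mult_self mult.assoc)
  qed
  then show ?thesis using assms by (intro exI[of _ "B * T\<^sup>2"]) auto
qed

text \<open>Cutting off the argument makes the nonlinearity globally Lipschitz; the cut-off is removed
  afterwards by an a priori bound.\<close>

definition truncate :: "real \<Rightarrow> real \<Rightarrow> real" where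
  "truncate T t = max (- T) (min T t)"

lemma truncate_id: "\<bar>t\<bar> \<le> T \<Longrightarrow> truncate T t = t" by (auto simp: truncate_def)

lemma truncated_odd_power_lipschitz:
  assumes "p > 1" "T \<ge> 0"
  shows "\<bar>odd_power p (truncate T x) - odd_power p (truncate T y)\<bar> \<le> p * T powr (p - 1) * \<bar>x - y\<bar>"
proof -
  have "norm (odd_power p (truncate T x) - odd_power p (truncate T y)) \<le>
      (p * T powr (p - 1)) * norm (truncate T x - truncate T y)"
  proof (rule field_differentiable_bound[of "{- T..T}" "odd_power p" "\<lambda>t. p * \<bar>t\<bar> powr (p - 1)"])
    show "norm (p * \<bar>z\<bar> powr (p - 1)) \<le> p * T powr (p - 1)" if "z \<in> {- T..T}" for z
      using that assms by (auto simp: abs_mult intro!: powr_mono2)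
  qed (use assms in \<open>auto simp: truncate_def intro: has_field_derivative_at_within odd_power_deriv\<close>)
  also have "\<dots> \<le> (p * T powr (p - 1)) * \<bar>x - y\<bar>"
    using assms by (intro mult_left_mono) (auto simp: truncate_def)
  finally show ?thesis by simp
qed

lemma mono_from_deriv:
  fixes f :: "real \<Rightarrow> real"
  assumes "x \<le> y" "continuous_on {x..y} f"
    "\<And>t. x < t \<Longrightarrow> t < y \<Longrightarrow> (f has_real_derivative f' t) (at t)"
    "\<And>t. x < t \<Longrightarrow> t < y \<Longrightarrow> 0 \<le> f' t"
  shows "f x \<le> f y"
  using assms by (intro DERIV_nonneg_imp_increasing_open[of x y f]) auto

lemma antimono_from_deriv:
  fixes f :: "real \<Rightarrow> real"
  assumes "x \<le> y" "continuous_on {x..y} f"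
    "\<And>t. x < t \<Longrightarrow> t < y \<Longrightarrow> (f has_real_derivative f' t) (at t)"
    "\<And>t. x < t \<Longrightarrow> t < y \<Longrightarrow> f' t \<le> 0"
  shows "f y \<le> f x"
  using assms by (intro DERIV_nonpos_imp_decreasing_open[of x y f]) auto

text \<open>Integrals over \<open>[0, r]\<close> are moved to \<open>[0, 1]\<close>, because continuity of parameter integrals, here in \<open>r\<close>,
  needs a fixed interval of integration.\<close>

lemma integral_rescale:
  fixes q :: "real \<Rightarrow> real"
  assumes "0 \<le> r" "continuous_on {0..r} q"
  shows "integral {0..r} q = r * integral {0..1} (\<lambda>t. q (r * t))"
proof -
  define \<Phi> where "\<Phi> = (\<lambda>s. integral {0..s} q)"
  have \<Phi>: "(\<Phi> has_real_derivative q s) (at s within {0..r})" if "s \<in> {0..r}" for s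
    unfolding \<Phi>_def using assms that by (intro integral_has_real_derivative) auto
  have "((\<lambda>t. q (r * t) * r) has_integral (\<Phi> (r * 1) - \<Phi> (r * 0))) {0..1}"
  proof (rule fundamental_theorem_of_calculus)
    fix t :: real assume t: "t \<in> {0..1}"
    have rt: "r * t \<in> {0..r}" using t assms(1) by (auto simp: mult_left_le)
    have "((\<lambda>t. \<Phi> (r * t)) has_real_derivative q (r * t) * r) (at t within {0..1})"
    proof -
      have "((*) r) ` {0..1} \<subseteq> {0..r}" using assms(1) by (auto simp: mult_left_le)
      then have "(\<Phi> has_real_derivative q (r * t)) (at (r * t) within ((*) r) ` {0..1})"
        using DERIV_subset[OF \<Phi>[OF rt]] by blast
      moreover have "((*) r has_real_derivative r) (at t within {0..1})"
        by (auto intro!: derivative_eq_intros)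
      ultimately show ?thesis using DERIV_image_chain[of \<Phi>] by (fastforce simp: o_def)
    qed
    then show "((\<lambda>t. \<Phi> (r * t)) has_vector_derivative q (r * t) * r) (at t within {0..1})"
      by (simp add: has_real_derivative_iff_has_vector_derivative)
  qed simp
  from integral_unique[OF this] show ?thesis by (simp add: \<Phi>_def mult.commute)
qed

text \<open>Expressing \<open>sin\<close> through \<open>sinc\<close> cancels the singularities at \<open>r = 0\<close> explicitly.\<close>

definition sinc :: "real \<Rightarrow> real" where
  "sinc x = (if x = 0 then 1 else sin x / x)"

lemma continuous_sinc [continuous_intros]:
  assumes "continuous_on S f" shows "continuous_on S (\<lambda>x. sinc (f x))"
proof -
  have "isCont sinc x" for x
  proof (cases "x = 0")
    case True
    have "(sinc \<longlongrightarrow> 1) (at 0)"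
      using DERIV_sin[of "0::real", unfolded DERIV_def, simplified] by (rule tendsto_cong[THEN iffD1, rotated]) (auto simp: eventually_at_filter sinc_def)
    then show ?thesis using True by (simp add: isCont_def sinc_def)
  next
    case False
    have "isCont (\<lambda>x. sin x / x) x" using False by (intro continuous_intros) auto
    moreover have "\<forall>\<^sub>F y in nhds x. sin y / y = sinc y"
      using False by (intro eventually_nhds[THEN iffD2] exI[of _ "- {0}"]) (auto simp: sinc_def)
    ultimately show ?thesis using isCont_cong[of "\<lambda>x. sin x / x" sinc x] by simp
  qed
  then have "continuous_on UNIV sinc" by (simp add: continuous_at_imp_continuous_on)
  then show ?thesis using assms by (metis continuous_on_compose2 subset_UNIV)
qed

lemma sinc_pos: "0 \<le> x \<Longrightarrow> x < pi \<Longrightarrow> sinc x > 0"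
  by (auto simp: sinc_def sin_gt_zero)

section \<open>The equation between a pole and the zero of its drift\<close>

text \<open>The part of the problem between the pole \<open>r = 0\<close> and the zero of \<open>h\<close>.  The other part is the same
  problem with \<open>a\<close> and \<open>b\<close> exchanged.\<close>

locale half_problem =
  fixes a b :: nat and \<mu> p :: real
  assumes a_pos: "a > 0" and b_pos: "b > 0" and mu_pos: "\<mu> > 0" and p_gt_1: "p > 1"
begin

definition h :: "real \<Rightarrow> real" where
  "h r = (real a + real b) / 2 * cos r + (real a - real b) / 2"

definition H :: "real \<Rightarrow> real" where "H r = h r / sin r"

text \<open>The point where \<open>h\<close> vanishes.  Stopping there makes \<open>h\<close> nonnegative on the whole interval, which is
  what makes the energy monotone and the weight \<open>\<rho>\<close> increasing.\<close>

definition c :: real where "c = arccos ((real b - real a) / (real a + real b))"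

text \<open>The weight with \<open>\<rho>' = H \<rho>\<close>: it brings the equation into divergence form,
  \<open>(\<rho> w')' = - \<mu> \<rho> (\<bar>w\<bar> powr (p - 1) w - w)\<close>.\<close>

definition \<rho> :: "real \<Rightarrow> real" where "\<rho> r = sin (r / 2) ^ a * cos (r / 2) ^ b"

text \<open>The continuous extension of \<open>r H(r)\<close> to \<open>r = 0\<close>, where its value is \<open>a\<close>.\<close>

definition rH :: "real \<Rightarrow> real" where "rH r = h r / sinc r"

text \<open>The quotient \<open>\<rho> (s t) / \<rho> s\<close>, written so that it is continuous up to \<open>s = 0\<close>.\<close>

definition kernel :: "real \<Rightarrow> real \<Rightarrow> real" where
  "kernel s t = (t * sinc (s * t / 2) / sinc (s / 2)) ^ a * (cos (s * t / 2) / cos (s / 2)) ^ b"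

lemma c_arg: "-1 < (real b - real a) / (real a + real b)" "(real b - real a) / (real a + real b) < 1"
  using a_pos b_pos by (auto simp: field_simps)

lemma c_bounds: "0 < c" "c < pi"
  unfolding c_def using arccos_lt_bounded[OF c_arg] by auto

lemma cos_c: "cos c = (real b - real a) / (real a + real b)"
  unfolding c_def using c_arg by (intro cos_arccos) auto

lemma c_swap: "half_problem.c b a = pi - c"
proof -
  interpret R: half_problem b a \<mu> p
    by unfold_locales (rule a_pos b_pos mu_pos p_gt_1)+
  have "R.c = arccos (- ((real b - real a) / (real a + real b)))"
    unfolding R.c_def by (simp add: add.commute minus_divide_left)
  also have "\<dots> = pi - c" unfolding c_def using c_arg by (intro arccos_minus) auto
  finally show ?thesis .
qed

lemma h_nonneg: assumes "r \<in> {0..c}" shows "h r \<ge> 0"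
proof -
  have "cos c \<le> cos r" using assms c_bounds by (intro cos_monotone_0_pi_le) auto
  then have "(real b - real a) \<le> (real a + real b) * cos r"
    using a_pos b_pos by (simp add: cos_c pos_divide_le_eq mult.commute)
  moreover have "h r = ((real a + real b) * cos r - (real b - real a)) / 2"
    by (simp add: h_def diff_divide_distrib)
  ultimately show ?thesis by simp
qed

lemma h_0: "h 0 = real a" by (simp add: h_def field_simps)

lemma H_nonneg: "r \<in> {0<..c} \<Longrightarrow> H r \<ge> 0"
  using h_nonneg[of r] c_bounds sin_gt_zero[of r] by (auto simp: H_def)

lemma rho_pos: "r \<in> {0<..<pi} \<Longrightarrow> \<rho> r > 0"
  unfolding \<rho>_def by (intro mult_pos_pos zero_less_power cos_gt_zero sin_gt_zero2) auto

lemma rho_0 [simp]: "\<rho> 0 = 0" using a_pos by (simp add: \<rho>_def)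

lemma rho_le_1: assumes "r \<in> {0..pi}" shows "\<rho> r \<le> 1"
proof -
  have "sin (r / 2) ^ a \<le> 1" "cos (r / 2) ^ b \<le> 1" 
    using assms by (auto intro!: power_le_one sin_ge_zero cos_ge_zero)
  then show ?thesis unfolding \<rho>_def
    using assms by (intro mult_le_one) (auto intro!: zero_le_power cos_ge_zero)
qed

lemma rho_deriv: assumes "r \<in> {0<..<pi}" shows "(\<rho> has_real_derivative H r * \<rho> r) (at r)"
proof -
  have s: "sin (r / 2) > 0" "cos (r / 2) > 0"
    using assms by (auto intro!: sin_gt_zero2 cos_gt_zero)
  have H: "H r = real a / 2 * (cos (r/2) / sin (r/2)) - real b / 2 * (sin (r/2) / cos (r/2))"
  proof -
    have "sin r = 2 * sin (r/2) * cos (r/2)" using sin_double[of "r/2"] by simp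
    moreover have "h r = real a * (cos (r/2))\<^sup>2 - real b * (sin (r/2))\<^sup>2"
    proof -
      have cr: "cos r = 2 * (cos (r/2))\<^sup>2 - 1" using cos_double_cos[of "r/2"] by simp
      show ?thesis unfolding h_def sin_squared_eq cr by (simp add: field_simps)
    qed
    ultimately show ?thesis using s by (simp add: H_def field_simps power2_eq_square)
  qed
  have 1: "real a * sin (r/2) ^ (a - 1) = real a / sin (r/2) * sin (r/2) ^ a"
    using s a_pos by (cases a) auto
  have 2: "real b * cos (r/2) ^ (b - 1) = real b / cos (r/2) * cos (r/2) ^ b"
    using s b_pos by (cases b) auto
  have "(\<rho> has_real_derivative
     (real a * sin (r/2) ^ (a - 1)) * (cos (r/2) / 2) * cos (r/2) ^ b
      - sin (r/2) ^ a * ((real b * cos (r/2) ^ (b - 1)) * (sin (r/2) / 2))) (at r)"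
    unfolding \<rho>_def by (auto intro!: derivative_eq_intros simp: algebra_simps)
  moreover have "(real a * sin (r/2) ^ (a - 1)) * (cos (r/2) / 2) * cos (r/2) ^ b
      - sin (r/2) ^ a * ((real b * cos (r/2) ^ (b - 1)) * (sin (r/2) / 2)) = H r * \<rho> r"
    unfolding 1 2 H \<rho>_def using s by (simp add: field_simps)
  ultimately show ?thesis by simp
qed

lemma continuous_rho [continuous_intros]:
  fixes S :: "'a::t2_space set"
  shows "continuous_on S f \<Longrightarrow> continuous_on S (\<lambda>x. \<rho> (f x))"
  unfolding \<rho>_def by (intro continuous_intros) auto

lemma rho_mono: assumes "0 \<le> r" "r \<le> s" "s \<le> c" shows "\<rho> r \<le> \<rho> s"
proof (rule mono_from_deriv[where f = \<rho> and f' = "\<lambda>x. H x * \<rho> x"])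
  fix x assume "r < x" "x < s"
  then have x: "x \<in> {0<..<pi}" "x \<in> {0<..c}" using assms c_bounds by auto
  show "(\<rho> has_real_derivative H x * \<rho> x) (at x)" by (rule rho_deriv) fact
  show "0 \<le> H x * \<rho> x" using H_nonneg[OF x(2)] rho_pos[OF x(1)] by simp
qed (use assms in \<open>auto intro!: continuous_rho continuous_intros\<close>)

lemma continuous_rH: "continuous_on {0..c} rH"
  unfolding rH_def h_def using c_bounds
  by (intro continuous_intros ballI less_imp_neq[symmetric] sinc_pos) auto

lemma rH_0: "rH 0 = real a" by (simp add: rH_def h_0 sinc_def)

lemma rH_eq: "r > 0 \<Longrightarrow> rH r = r * H r" by (simp add: rH_def H_def sinc_def)

lemma continuous_kernel:
  "continuous_on ({0..c} \<times> {0..1}) (\<lambda>(s, t). kernel s t)"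
proof -
  have "sinc (s / 2) \<noteq> 0" "cos (s / 2) \<noteq> 0" if "s \<in> {0..c}" for s
    using that c_bounds sinc_pos[of "s / 2"] cos_gt_zero_pi[of "s / 2"] by auto
  then show ?thesis
    unfolding kernel_def case_prod_unfold by (intro continuous_intros) auto
qed

lemma kernel_0: "kernel 0 t = t ^ a" by (simp add: kernel_def sinc_def)

lemma kernel_eq: assumes "s \<in> {0<..c}" shows "kernel s t = \<rho> (s * t) / \<rho> s"
  using assms a_pos by (auto simp: kernel_def \<rho>_def sinc_def power_divide power_mult_distrib power_0_left)

lemma kernel_bounds: assumes "s \<in> {0..c}" "t \<in> {0..1}" shows "0 \<le> kernel s t" "kernel s t \<le> 1"
proof -
  have "0 \<le> kernel s t \<and> kernel s t \<le> 1"
  proof (cases "s = 0")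
    case True
    then show ?thesis using assms by (auto simp: kernel_0 power_le_one)
  next
    case False
    then have s: "s \<in> {0<..c}" "0 < \<rho> s" using assms c_bounds rho_pos[of s] by auto
    have st: "0 \<le> s * t" "s * t \<le> s" using assms by (auto simp: mult_left_le)
    have "0 \<le> \<rho> (s * t)" using rho_mono[of 0 "s * t"] st s by auto
    moreover have "\<rho> (s * t) \<le> \<rho> s" using rho_mono[of "s * t" s] st s by auto
    ultimately show ?thesis using s by (simp add: kernel_eq)
  qed
  then show "0 \<le> kernel s t" "kernel s t \<le> 1" by auto
qed

end

section \<open>Solutions of the singular initial value problem\<close>

lemma derivative_within_at_Icc:
  fixes f :: "real \<Rightarrow> real"
  assumes "(f has_real_derivative D) (at t within {x..y})" "x < t" "t < y"
  shows "(f has_real_derivative D) (at t)"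
  using assms by (simp add: at_within_Icc_at)

context half_problem
begin

text \<open>Integrating the divergence form twice turns the initial value problem \<open>u(0) = 1\<close>, \<open>u'(0) = 0\<close> into a
  fixed point equation without singularity.  The fixed point is taken in a space of functions of
  both \<open>r\<close> and the parameter \<open>d\<close>, so joint continuity in the parameter comes for free.  The
  operator becomes a contraction in the norm with weight \<open>exp (- K r)\<close>.\<close>

lemma ivp_fixed_point:
  fixes F :: "real \<Rightarrow> real \<Rightarrow> real"
  assumes contF: "continuous_on UNIV (\<lambda>(d, x). F d x)"
    and Lip: "\<And>d x y. \<bar>F d x - F d y\<bar> \<le> L * \<bar>x - y\<bar>" and L: "L \<ge> 0"
    and F0: "\<And>d. F d 0 = 0"
  shows "\<exists>u. continuous_on UNIV (\<lambda>(r, d). u r d) \<and>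
    (\<forall>r\<in>{0..c}. \<forall>d. u r d = 1 - \<mu> * (r * integral {0..1} (\<lambda>\<sigma>. r * \<sigma> * integral {0..1}
        (\<lambda>t. kernel (r * \<sigma>) t * F d (u (r * \<sigma> * t) d)))))"
proof -
  define avg where "avg = (\<lambda>u s d. integral {0..1} (\<lambda>t. kernel s t * F d (u (s * t, d))))"
  define G where "G = (\<lambda>u r d. 1 - \<mu> * (r * integral {0..1} (\<lambda>\<sigma>. r * \<sigma> * avg u (r * \<sigma>) d)))"
  \<comment> \<open>The weight exponent is chosen so that the contraction factor \<open>\<mu> c L / K\<close> is at most \<open>1 / 2\<close>.\<close>
  define K where "K = 2 * \<mu> * c * L + 1"
  have K: "K \<ge> 1" using mu_pos c_bounds L by (simp add: K_def)
  have contF': "continuous_on S (\<lambda>x. F (f x) (g x))" if "continuous_on S f" "continuous_on S g"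
    for S :: "'s::topological_space set" and f g
    using continuous_on_compose2[OF contF continuous_on_Pair[OF that]] by auto
  have contk: "continuous_on S (\<lambda>x. kernel (f x) (g x))"
    if "continuous_on S f" "continuous_on S g" "\<And>x. x \<in> S \<Longrightarrow> f x \<in> {0..c}" "\<And>x. x \<in> S \<Longrightarrow> g x \<in> {0..1}"
    for S :: "'s::topological_space set" and f g
    using continuous_on_compose2[OF continuous_kernel continuous_on_Pair[OF that(1,2)]] that(3,4)
    by (auto simp: image_subset_iff)
  have cont_u: "continuous_on S (\<lambda>x. u (f x, g x))"
    if "continuous_on UNIV u" "continuous_on S f" "continuous_on S g"
    for S :: "'s::topological_space set" and f g and u :: "real \<times> real \<Rightarrow> real"
    using continuous_on_compose2[OF that(1) continuous_on_Pair[OF that(2,3)]] by auto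
  have cont_avg: "continuous_on ({0..c} \<times> UNIV) (\<lambda>(s, d). avg u s d)" if u: "continuous_on UNIV u" for u
  proof -
    have "continuous_on ({0..c} \<times> UNIV) (\<lambda>x. integral (cbox 0 1)
        (\<lambda>t. kernel (fst x) t * F (snd x) (u (fst x * t, snd x))))"
      by (rule integral_continuous_on_param)
         (auto intro!: continuous_intros contF' contk cont_u u simp: case_prod_unfold)
    then show ?thesis by (simp add: avg_def case_prod_unfold)
  qed
  have cont_avg': "continuous_on S (\<lambda>x. avg u (f x) (g x))"
    if "continuous_on UNIV u" "continuous_on S f" "continuous_on S g" "\<And>x. x \<in> S \<Longrightarrow> f x \<in> {0..c}"
    for S :: "'s::topological_space set" and f g u
    using continuous_on_compose2[OF cont_avg[OF that(1)] continuous_on_Pair[OF that(2,3)]] that(4)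
    by (auto simp: image_subset_iff)
  have cont_G: "continuous_on ({0..c} \<times> UNIV) (\<lambda>(s, d). G u s d)" if u: "continuous_on UNIV u" for u
  proof -
    have "continuous_on ({0..c} \<times> UNIV) (\<lambda>x. integral (cbox 0 1)
        (\<lambda>\<sigma>. fst x * \<sigma> * avg u (fst x * \<sigma>) (snd x)))"
      by (rule integral_continuous_on_param)
         (auto intro!: continuous_intros cont_avg' u simp: case_prod_unfold mult_le_one intro: order_trans[OF mult_left_le])
    then show ?thesis by (auto simp: G_def case_prod_unfold intro!: continuous_intros)
  qed
  have avg_diff: "\<bar>avg u1 s d - avg u2 s d\<bar> \<le> L * M * exp (K * s)"
    if u: "continuous_on UNIV u1" "continuous_on UNIV u2" and s: "s \<in> {0..c}" and M: "M \<ge> 0"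
      and d: "\<And>s. s \<in> {0..c} \<Longrightarrow> \<bar>u1 (s, d) - u2 (s, d)\<bar> \<le> M * exp (K * s)" for u1 u2 s d M
  proof -
    have int: "(\<lambda>t. kernel s t * F d (u (s * t, d))) integrable_on {0..1}" if "continuous_on UNIV u" for u
      using s that by (intro integrable_continuous_interval continuous_intros contk contF' cont_u) auto
    have eq: "avg u1 s d - avg u2 s d =
      integral {0..1} (\<lambda>t. kernel s t * F d (u1 (s * t, d)) - kernel s t * F d (u2 (s * t, d)))"
      unfolding avg_def by (rule integral_diff[symmetric]) (rule int u)+
    have "norm (avg u1 s d - avg u2 s d) \<le> integral {0..1} (\<lambda>t::real. L * M * exp (K * s))"
      unfolding eq
    proof (rule integral_norm_bound_integral)
      fix t :: real assume t: "t \<in> {0..1}"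
      have st: "s * t \<in> {0..c}" "s * t \<le> s" using s t by (auto simp: mult_left_le intro: order_trans[OF mult_left_le])
      have "\<bar>F d (u1 (s * t, d)) - F d (u2 (s * t, d))\<bar> \<le> L * \<bar>u1 (s * t, d) - u2 (s * t, d)\<bar>" by (rule Lip)
      also have "\<dots> \<le> L * (M * exp (K * (s * t)))" by (intro mult_left_mono d st L)
      also have "\<dots> \<le> L * (M * exp (K * s))" using st K L M by (intro mult_left_mono) auto
      finally have *: "\<bar>F d (u1 (s * t, d)) - F d (u2 (s * t, d))\<bar> \<le> L * (M * exp (K * s))" .
      have "norm (kernel s t * F d (u1 (s * t, d)) - kernel s t * F d (u2 (s * t, d)))
        = kernel s t * \<bar>F d (u1 (s * t, d)) - F d (u2 (s * t, d))\<bar>"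
        using kernel_bounds[OF s t] by (simp add: abs_mult flip: right_diff_distrib)
      also have "\<dots> \<le> 1 * (L * (M * exp (K * s)))"
        using kernel_bounds[OF s t] * by (intro mult_mono) auto
      finally show "norm (kernel s t * F d (u1 (s * t, d)) - kernel s t * F d (u2 (s * t, d))) \<le> L * M * exp (K * s)"
        by simp
    qed (auto intro!: integrable_diff int u)
    then show ?thesis by simp
  qed
  have G_diff: "\<bar>G u1 r d - G u2 r d\<bar> \<le> M * exp (K * r) / 2"
    if u: "continuous_on UNIV u1" "continuous_on UNIV u2" and r: "r \<in> {0..c}" and M: "M \<ge> 0"
      and d: "\<And>s. s \<in> {0..c} \<Longrightarrow> \<bar>u1 (s, d) - u2 (s, d)\<bar> \<le> M * exp (K * s)" for u1 u2 r d M
  proof -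
    have r\<sigma>: "r * \<sigma> \<in> {0..c}" if "\<sigma> \<in> {0..1}" for \<sigma>
      using r that by (auto intro: order_trans[OF mult_left_le])
    have int: "(\<lambda>\<sigma>. r * \<sigma> * avg u (r * \<sigma>) d) integrable_on {0..1}" if "continuous_on UNIV u" for u
      using that r\<sigma> by (intro integrable_continuous_interval continuous_intros cont_avg') auto
    have exp_int: "r * integral {0..1} (\<lambda>\<sigma>. exp (K * (r * \<sigma>))) \<le> exp (K * r) / K"
    proof -
      have "((\<lambda>s. exp (K * s)) has_integral (exp (K * r) / K - exp (K * 0) / K)) {0..r}"
        using r K by (intro fundamental_theorem_of_calculus)
          (auto intro!: derivative_eq_intros simp flip: has_real_derivative_iff_has_vector_derivative)
      moreover have "integral {0..r} (\<lambda>s. exp (K * s)) = r * integral {0..1} (\<lambda>\<sigma>. exp (K * (r * \<sigma>)))"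
        using r by (intro integral_rescale) (auto intro!: continuous_intros)
      ultimately have "r * integral {0..1} (\<lambda>\<sigma>. exp (K * (r * \<sigma>))) = exp (K * r) / K - 1 / K"
        by (simp add: integral_unique)
      then show ?thesis using K by simp
    qed
    have eq: "integral {0..1} (\<lambda>\<sigma>. r * \<sigma> * avg u1 (r * \<sigma>) d) - integral {0..1} (\<lambda>\<sigma>. r * \<sigma> * avg u2 (r * \<sigma>) d)
      = integral {0..1} (\<lambda>\<sigma>. r * \<sigma> * avg u1 (r * \<sigma>) d - r * \<sigma> * avg u2 (r * \<sigma>) d)"
      by (rule integral_diff[symmetric]) (rule int u)+
    have "norm (integral {0..1} (\<lambda>\<sigma>. r * \<sigma> * avg u1 (r * \<sigma>) d) - integral {0..1} (\<lambda>\<sigma>. r * \<sigma> * avg u2 (r * \<sigma>) d))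
        \<le> integral {0..1} (\<lambda>\<sigma>. c * L * M * exp (K * (r * \<sigma>)))"
      unfolding eq
    proof (rule integral_norm_bound_integral)
      fix \<sigma> :: real assume \<sigma>: "\<sigma> \<in> {0..1}"
      have "norm (r * \<sigma> * avg u1 (r * \<sigma>) d - r * \<sigma> * avg u2 (r * \<sigma>) d)
        = (r * \<sigma>) * \<bar>avg u1 (r * \<sigma>) d - avg u2 (r * \<sigma>) d\<bar>"
        using r\<sigma>[OF \<sigma>] r \<sigma> by (simp add: abs_mult flip: right_diff_distrib)
      also have "\<dots> \<le> c * (L * M * exp (K * (r * \<sigma>)))"
        using r\<sigma>[OF \<sigma>] c_bounds by (intro mult_mono avg_diff u M d) auto
      finally show "norm (r * \<sigma> * avg u1 (r * \<sigma>) d - r * \<sigma> * avg u2 (r * \<sigma>) d) \<le> c * L * M * exp (K * (r * \<sigma>))"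
        by (simp add: mult.assoc)
    qed (rule integrable_diff int u integrable_continuous_interval | intro continuous_intros)+
    then have *: "\<bar>integral {0..1} (\<lambda>\<sigma>. r * \<sigma> * avg u1 (r * \<sigma>) d) - integral {0..1} (\<lambda>\<sigma>. r * \<sigma> * avg u2 (r * \<sigma>) d)\<bar>
      \<le> c * L * M * integral {0..1} (\<lambda>\<sigma>. exp (K * (r * \<sigma>)))" by simp
    have "\<bar>G u1 r d - G u2 r d\<bar> = \<mu> * r * \<bar>integral {0..1} (\<lambda>\<sigma>. r * \<sigma> * avg u1 (r * \<sigma>) d) - integral {0..1} (\<lambda>\<sigma>. r * \<sigma> * avg u2 (r * \<sigma>) d)\<bar>"
    proof -
      define J where "J = (\<lambda>u. integral {0..1} (\<lambda>\<sigma>. r * \<sigma> * avg u (r * \<sigma>) d))"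
      have GJ: "G u r d = 1 - \<mu> * (r * J u)" for u by (simp only: G_def J_def)
      have "\<bar>G u1 r d - G u2 r d\<bar> = \<bar>- (\<mu> * r * (J u1 - J u2))\<bar>" by (simp add: GJ algebra_simps)
      also have "\<dots> = \<mu> * r * \<bar>J u1 - J u2\<bar>" using mu_pos r by (simp add: abs_mult)
      finally show ?thesis by (simp only: J_def)
    qed
    also have "\<dots> \<le> \<mu> * r * (c * L * M * integral {0..1} (\<lambda>\<sigma>. exp (K * (r * \<sigma>))))"
      using mu_pos r by (intro mult_left_mono *) auto
    also have "\<dots> = \<mu> * c * L * M * (r * integral {0..1} (\<lambda>\<sigma>. exp (K * (r * \<sigma>))))" by (simp add: mult_ac)
    also have "\<dots> \<le> \<mu> * c * L * M * (exp (K * r) / K)"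
      using mu_pos c_bounds L M by (intro mult_left_mono exp_int) auto
    also have "\<dots> = (\<mu> * c * L / K) * (M * exp (K * r))" by simp
    also have "\<dots> \<le> (1 / 2) * (M * exp (K * r))"
      using K M by (intro mult_right_mono) (auto simp: K_def field_simps)
    finally show ?thesis by simp
  qed
  \<comment> \<open>Bounded continuous functions live on the whole plane, so \<open>r\<close> is clamped to \<open>[0, c]\<close>.\<close>
  define cl where "cl = (\<lambda>r. max 0 (min c r))"
  have cl: "cl r \<in> {0..c}" for r using c_bounds by (auto simp: cl_def)
  have cl_id: "cl r = r" if "r \<in> {0..c}" for r using that by (auto simp: cl_def)
  have cont_cl: "continuous_on S (\<lambda>x. cl (f x))" if "continuous_on S f" for S :: "'s::topological_space set" and f
    unfolding cl_def by (intro continuous_intros that)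
  define lift where "lift = (\<lambda>v :: (real \<times> real) \<Rightarrow>\<^sub>C real. \<lambda>x. exp (K * fst x) * apply_bcontfun v x)"
  have cont_lift: "continuous_on UNIV (lift v)" for v
    unfolding lift_def by (intro continuous_intros continuous_on_apply_bcontfun)
  define \<Phi> where "\<Phi> = (\<lambda>v x. exp (- K * cl (fst x)) * G (lift v) (cl (fst x)) (snd x))"
  have G_0: "G (\<lambda>_. 0) r d = 1" for r d by (simp add: G_def avg_def F0)
  have \<Phi>_diff_aux: "\<bar>exp (- K * cl r) * G u1 (cl r) d - exp (- K * cl r) * G u2 (cl r) d\<bar> \<le> M / 2"
    if u: "continuous_on UNIV u1" "continuous_on UNIV u2" and M: "M \<ge> 0"
      and d: "\<And>s. s \<in> {0..c} \<Longrightarrow> \<bar>u1 (s, d) - u2 (s, d)\<bar> \<le> M * exp (K * s)" for u1 u2 r d M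
  proof -
    have "\<bar>exp (- K * cl r) * G u1 (cl r) d - exp (- K * cl r) * G u2 (cl r) d\<bar>
       = exp (- K * cl r) * \<bar>G u1 (cl r) d - G u2 (cl r) d\<bar>"
      by (simp add: abs_mult flip: right_diff_distrib)
    also have "\<dots> \<le> exp (- K * cl r) * (M * exp (K * cl r) / 2)"
      by (intro mult_left_mono G_diff[OF u cl M d]) auto
    also have "\<dots> = M / 2" by (simp add: exp_minus field_simps)
    finally show ?thesis .
  qed
  have lift_diff: "\<bar>lift v1 (s, d) - lift v2 (s, d)\<bar> \<le> dist v1 v2 * exp (K * s)" for v1 v2 s d
  proof -
    have "\<bar>lift v1 (s, d) - lift v2 (s, d)\<bar> = exp (K * s) * \<bar>apply_bcontfun v1 (s, d) - apply_bcontfun v2 (s, d)\<bar>"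
      by (simp add: lift_def abs_mult flip: right_diff_distrib)
    also have "\<dots> \<le> exp (K * s) * dist v1 v2"
      using dist_bounded[of v1 "(s, d)" v2] by (intro mult_left_mono) (auto simp: dist_real_def)
    finally show ?thesis by (simp add: mult.commute)
  qed
  have \<Phi>_bcont: "\<Phi> v \<in> bcontfun" for v
  proof (rule bcontfun_normI)
    show "continuous_on UNIV (\<Phi> v)"
      unfolding \<Phi>_def
      by (intro continuous_intros cont_cl continuous_on_compose2[OF cont_G[OF cont_lift], of _ "\<lambda>x. (cl (fst x), snd x)", simplified])
         (use cl in auto)
  next
    fix x :: "real \<times> real"
    obtain r d where x: "x = (r, d)" by force
    have "\<bar>exp (- K * cl r) * G (lift v) (cl r) d - exp (- K * cl r) * G (\<lambda>_. 0) (cl r) d\<bar> \<le> norm v / 2"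
      using lift_diff[of v _ d 0] by (intro \<Phi>_diff_aux cont_lift) (auto simp: lift_def)
    moreover have "0 \<le> exp (- K * cl r)" "exp (- K * cl r) \<le> 1" using cl[of r] K by auto
    ultimately have "\<bar>exp (- K * cl r) * G (lift v) (cl r) d\<bar> \<le> norm v / 2 + 1"
      unfolding G_0 by arith
    then show "norm (\<Phi> v x) \<le> norm v / 2 + 1" by (simp add: x \<Phi>_def)
  qed
  have "\<exists>!v. Bcontfun (\<Phi> v) = v"
  proof (rule banach_fix_type[of "1/2"])
    show "\<forall>v1 v2. dist (Bcontfun (\<Phi> v1)) (Bcontfun (\<Phi> v2)) \<le> 1 / 2 * dist v1 v2"
    proof (intro allI dist_bound)
      fix v1 v2 and x :: "real \<times> real"
      obtain r d where x: "x = (r, d)" by force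
      show "dist (apply_bcontfun (Bcontfun (\<Phi> v1)) x) (apply_bcontfun (Bcontfun (\<Phi> v2)) x) \<le> 1 / 2 * dist v1 v2"
        using \<Phi>_diff_aux[OF cont_lift cont_lift _ lift_diff, of v1 v2 r d]
        unfolding Bcontfun_inverse[OF \<Phi>_bcont] by (simp add: \<Phi>_def x dist_real_def)
    qed
  qed auto
  then obtain v where v: "Bcontfun (\<Phi> v) = v" by blast
  then have "apply_bcontfun v = \<Phi> v" by (metis Bcontfun_inverse \<Phi>_bcont)
  define u where "u = (\<lambda>r d. lift v (r, d))"
  have "u r d = G (lift v) r d" if "r \<in> {0..c}" for r d
  proof -
    have "u r d = exp (K * r) * \<Phi> v (r, d)" using \<open>apply_bcontfun v = \<Phi> v\<close> by (simp add: u_def lift_def)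
    also have "\<dots> = G (lift v) r d" using cl_id[OF that] by (simp add: \<Phi>_def exp_minus)
    finally show ?thesis .
  qed
  moreover have "continuous_on UNIV (\<lambda>(r, d). u r d)"
    using cont_lift[of v] by (simp add: u_def case_prod_unfold)
  ultimately show ?thesis
    by (intro exI[of _ u]) (simp add: G_def avg_def u_def)
qed

text \<open>The fixed point is a classical solution up to \<open>r = 0\<close>.  Its first derivative is \<open>r\<close> times an average of
  the nonlinearity, so at \<open>0\<close> the second derivative is the value of that average, and the singular
  term \<open>H u'\<close> equals the average times the continuous function \<open>rH\<close>.\<close>

lemma ivp_lipschitz:
  fixes F :: "real \<Rightarrow> real \<Rightarrow> real"
  assumes contF: "continuous_on UNIV (\<lambda>(d, x). F d x)"
    and Lip: "\<And>d x y. \<bar>F d x - F d y\<bar> \<le> L * \<bar>x - y\<bar>" and L: "L \<ge> 0"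
    and F0: "\<And>d. F d 0 = 0"
  shows "\<exists>u u1 u2. continuous_on ({0..c} \<times> UNIV) (\<lambda>(r, d). u r d) \<and>
    continuous_on ({0..c} \<times> UNIV) (\<lambda>(r, d). u1 r d) \<and>
    continuous_on ({0..c} \<times> UNIV) (\<lambda>(r, d). u2 r d) \<and>
    (\<forall>d. u 0 d = 1 \<and> u1 0 d = 0 \<and>
      (\<forall>r\<in>{0..c}. ((\<lambda>r. u r d) has_real_derivative u1 r d) (at r within {0..c})) \<and>
      (\<forall>r\<in>{0..c}. ((\<lambda>r. u1 r d) has_real_derivative u2 r d) (at r within {0..c})) \<and>
      (\<forall>r\<in>{0<..c}. u2 r d = - H r * u1 r d - \<mu> * F d (u r d)))"
proof -
  obtain u where contu: "continuous_on UNIV (\<lambda>(r, d). u r d)" and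
    u: "\<And>r d. r \<in> {0..c} \<Longrightarrow> u r d = 1 - \<mu> * (r * integral {0..1} (\<lambda>\<sigma>. r * \<sigma> * integral {0..1}
        (\<lambda>t. kernel (r * \<sigma>) t * F d (u (r * \<sigma> * t) d))))"
    using ivp_fixed_point[OF assms] by blast
  define avg where "avg = (\<lambda>s d. integral {0..1} (\<lambda>t. kernel s t * F d (u (s * t) d)))"
  have contF': "continuous_on S (\<lambda>x. F (f x) (g x))" if "continuous_on S f" "continuous_on S g"
    for S :: "'s::topological_space set" and f g
    using continuous_on_compose2[OF contF continuous_on_Pair[OF that]] by auto
  have contu': "continuous_on S (\<lambda>x. u (f x) (g x))" if "continuous_on S f" "continuous_on S g"
    for S :: "'s::topological_space set" and f g
    using continuous_on_compose2[OF contu continuous_on_Pair[OF that]] by auto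
  have contk: "continuous_on S (\<lambda>x. kernel (f x) (g x))"
    if "continuous_on S f" "continuous_on S g" "\<And>x. x \<in> S \<Longrightarrow> f x \<in> {0..c}" "\<And>x. x \<in> S \<Longrightarrow> g x \<in> {0..1}"
    for S :: "'s::topological_space set" and f g
    using continuous_on_compose2[OF continuous_kernel continuous_on_Pair[OF that(1,2)]] that(3,4)
    by (auto simp: image_subset_iff)
  have cont_avg: "continuous_on ({0..c} \<times> UNIV) (\<lambda>(s, d). avg s d)"
  proof -
    have "continuous_on ({0..c} \<times> UNIV) (\<lambda>x. integral (cbox 0 1)
        (\<lambda>t. kernel (fst x) t * F (snd x) (u (fst x * t) (snd x))))"
      by (rule integral_continuous_on_param)
         (auto intro!: continuous_intros contF' contk contu' simp: case_prod_unfold)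
    then show ?thesis by (simp add: avg_def case_prod_unfold)
  qed
  have cont_avg1: "continuous_on {0..c} (\<lambda>s. avg s d)" for d
    using continuous_on_compose2[OF cont_avg continuous_on_Pair[OF continuous_on_id continuous_on_const[of _ d]], of "{0..c}"]
    by auto
  define u1 where "u1 = (\<lambda>r d. - \<mu> * (r * avg r d))"
  define u2 where "u2 = (\<lambda>r d. - \<mu> * (F d (u r d) - rH r * avg r d))"
  have u_int: "u r d = 1 - \<mu> * integral {0..r} (\<lambda>s. s * avg s d)" if "r \<in> {0..c}" for r d
  proof -
    have "integral {0..r} (\<lambda>s. s * avg s d) = r * integral {0..1} (\<lambda>\<sigma>. r * \<sigma> * avg (r * \<sigma>) d)"
      using that by (intro integral_rescale continuous_intros continuous_on_subset[OF cont_avg1]) auto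
    then show ?thesis using u[OF that, of d] by (simp add: avg_def)
  qed
  have du: "((\<lambda>r. u r d) has_real_derivative u1 r d) (at r within {0..c})" if r: "r \<in> {0..c}" for r d
  proof -
    have "((\<lambda>r. 1 - \<mu> * integral {0..r} (\<lambda>s. s * avg s d)) has_real_derivative - (\<mu> * (r * avg r d))) (at r within {0..c})"
      using r by (auto intro!: derivative_eq_intros integral_has_real_derivative continuous_intros cont_avg1)
    then show ?thesis
      using r by (intro has_field_derivative_transform_within[of _ _ _ _ 1 "\<lambda>r. u r d"])
        (auto simp: u1_def u_int)
  qed
  have avg_eq: "s * avg s d = integral {0..s} (\<lambda>x. \<rho> x * F d (u x d)) / \<rho> s" if s: "s \<in> {0<..c}" for s d
  proof -
    have \<rho>: "\<rho> s > 0" using s c_bounds by (intro rho_pos) auto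
    have "integral {0..s} (\<lambda>x. \<rho> x * F d (u x d)) = s * integral {0..1} (\<lambda>t. \<rho> (s * t) * F d (u (s * t) d))"
      using s by (intro integral_rescale continuous_intros contF' contu' continuous_rho) auto
    also have "(\<lambda>t. \<rho> (s * t) * F d (u (s * t) d)) = (\<lambda>t. \<rho> s * (kernel s t * F d (u (s * t) d)))"
      using \<rho> by (simp add: kernel_eq[OF s] fun_eq_iff)
    finally show ?thesis using \<rho> by (simp add: avg_def)
  qed
  have avg_0: "avg 0 d = F d (u 0 d) / (real a + 1)" for d
  proof -
    define C where "C = F d (u 0 d)"
    have "((\<lambda>t. t ^ Suc a / real (Suc a) * C) has_real_derivative t ^ a * C) (at t within {0..1})" for t
      using DERIV_cmult_right[OF DERIV_cdivide[OF DERIV_pow[of "Suc a" t "{0..1}"], of "real (Suc a)"], of C]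
      by (simp del: of_nat_Suc power_Suc)
    then have "((\<lambda>t. t ^ a * C) has_integral (1 ^ Suc a / real (Suc a) * C - 0 ^ Suc a / real (Suc a) * C)) {0..1}"
      by (intro fundamental_theorem_of_calculus) (auto simp flip: has_real_derivative_iff_has_vector_derivative)
    then have "integral {0..1} (\<lambda>t. t ^ a * C) = C / (real a + 1)"
      using a_pos by (subst integral_unique) (auto simp: add.commute)
    moreover have "avg 0 d = integral {0..1} (\<lambda>t. t ^ a * C)"
      by (simp only: avg_def kernel_0 mult_zero_left C_def)
    ultimately show ?thesis by (simp add: C_def)
  qed
  have du1: "((\<lambda>r. u1 r d) has_real_derivative u2 r d) (at r within {0..c})" if r: "r \<in> {0..c}" for r d
  proof (cases "r = 0")
    case True
    have "((\<lambda>s. avg s d) \<longlongrightarrow> avg 0 d) (at 0 within {0..c})"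
      using cont_avg1[of d] c_bounds by (auto simp: continuous_on_def)
    then have "((\<lambda>s. - \<mu> * avg s d) \<longlongrightarrow> - \<mu> * avg 0 d) (at 0 within {0..c})" by (intro tendsto_intros)
    then have "((\<lambda>s. (u1 s d - u1 0 d) / (s - 0)) \<longlongrightarrow> - \<mu> * avg 0 d) (at 0 within {0..c})"
      by (rule tendsto_cong[THEN iffD1, rotated]) (auto simp: eventually_at_filter u1_def)
    moreover have "u2 0 d = - \<mu> * avg 0 d" by (simp add: u2_def rH_0 avg_0 field_simps)
    ultimately show ?thesis using True by (simp add: has_field_derivative_iff)
  next
    case False
    then have r': "r \<in> {0<..c}" and \<rho>: "\<rho> r > 0" using r c_bounds by (auto intro!: rho_pos)
    let ?N = "\<lambda>s. integral {0..s} (\<lambda>x. \<rho> x * F d (u x d))"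
    have N: "(?N has_real_derivative \<rho> r * F d (u r d)) (at r within {0..c})"
      using r by (auto intro!: integral_has_real_derivative continuous_intros contF' contu' continuous_rho)
    have R: "(\<rho> has_real_derivative H r * \<rho> r) (at r within {0..c})"
      using r' c_bounds by (auto intro: has_field_derivative_at_within[OF rho_deriv])
    have "((\<lambda>s. - \<mu> * (?N s / \<rho> s)) has_real_derivative
       - \<mu> * ((\<rho> r * F d (u r d) * \<rho> r - ?N r * (H r * \<rho> r)) / (\<rho> r * \<rho> r))) (at r within {0..c})"
      using \<rho> by (intro DERIV_cmult DERIV_divide N R) auto
    also have "- \<mu> * ((\<rho> r * F d (u r d) * \<rho> r - ?N r * (H r * \<rho> r)) / (\<rho> r * \<rho> r)) = u2 r d"
    proof -
      have "rH r * avg r d = H r * (?N r / \<rho> r)"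
        unfolding avg_eq[OF r', of d, symmetric] using r' by (simp add: rH_eq)
      then show ?thesis unfolding u2_def using \<rho> by (simp add: field_simps)
    qed
    finally have "((\<lambda>s. - \<mu> * (?N s / \<rho> s)) has_real_derivative u2 r d) (at r within {0..c})" .
    then show ?thesis
    proof (rule has_field_derivative_transform_within[where d = r])
      show "- \<mu> * (?N s / \<rho> s) = u1 s d" if "s \<in> {0..c}" "dist s r < r" for s
        using that avg_eq[of s d] by (auto simp: u1_def dist_real_def)
    qed (use r r' in auto)
  qed
  have "continuous_on ({0..c} \<times> UNIV) (\<lambda>(r, d). u r d)"
    using contu continuous_on_subset by blast
  moreover have "continuous_on ({0..c} \<times> UNIV) (\<lambda>(r, d). u1 r d)"
    using cont_avg unfolding u1_def by (auto simp: case_prod_unfold intro!: continuous_intros)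
  moreover have "continuous_on ({0..c} \<times> UNIV) (\<lambda>(r, d). u2 r d)"
    using cont_avg unfolding u2_def
    by (auto simp: case_prod_unfold intro!: continuous_intros contF' contu' continuous_on_compose2[OF continuous_rH])
  moreover have "u 0 d = 1" "u1 0 d = 0" for d
    using u[of 0 d] c_bounds by (auto simp: u1_def)
  moreover have "u2 r d = - H r * u1 r d - \<mu> * F d (u r d)" if "r \<in> {0<..c}" for r d
    using that by (simp add: u2_def u1_def rH_eq algebra_simps)
  ultimately show ?thesis
    using du du1 by (intro exI[of _ u] exI[of _ u1] exI[of _ u2]) simp
qed

text \<open>The function \<open>d u\<close> solves the original equation with initial value \<open>d\<close>; dividing by \<open>d\<close> keeps the family
  nondegenerate at \<open>d = 0\<close>.  The quantity \<open>Y\<close>, an energy in which the quadratic term has the good sign,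
  grows at most exponentially as long as the cut-off is inactive.  A first exit argument then shows
  that the cut-off never becomes active.\<close>

lemma shooting_family:
  assumes D: "D \<ge> 0"
  shows "\<exists>u u1 u2. continuous_on ({0..c} \<times> {0..D}) (\<lambda>(r, d). u r d) \<and>
    continuous_on ({0..c} \<times> {0..D}) (\<lambda>(r, d). u1 r d) \<and>
    continuous_on ({0..c} \<times> {0..D}) (\<lambda>(r, d). u2 r d) \<and>
    (\<forall>d\<in>{0..D}. u 0 d = 1 \<and> u1 0 d = 0 \<and>
      (\<forall>r\<in>{0..c}. ((\<lambda>r. u r d) has_real_derivative u1 r d) (at r within {0..c})) \<and>
      (\<forall>r\<in>{0..c}. ((\<lambda>r. u1 r d) has_real_derivative u2 r d) (at r within {0..c})) \<and>
      (\<forall>r\<in>{0<..c}. u2 r d = - H r * u1 r d - \<mu> * (d powr (p - 1) * odd_power p (u r d) - u r d)))"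
proof -
  define cl where "cl = (\<lambda>d. max 0 (min D d))"
  define q where "q = (\<lambda>d. cl d powr (p - 1))"
  have cl: "cl d \<in> {0..D}" for d using D by (auto simp: cl_def)
  have q0: "q d \<ge> 0" "q d \<le> D powr (p - 1)" for d
    using cl[of d] p_gt_1 by (auto simp: q_def intro!: powr_mono2)
  define Y0 where "Y0 = \<mu> * D powr (p - 1) / (p + 1) + 1 / 2"
  have Y0: "Y0 \<ge> 1 / 2" using mu_pos p_gt_1 by (simp add: Y0_def)
  \<comment> \<open>The bound for \<open>\<bar>u\<bar>\<close> that the growth of \<open>Y\<close> gives, with room to spare.\<close>
  define T where "T = sqrt (2 * Y0 * exp ((1 + \<mu>) * c)) + 1"
  have T: "T > 1" using Y0 by (simp add: T_def)
  define F where "F = (\<lambda>d x. q d * odd_power p (truncate T x) - x)"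
  define L where "L = D powr (p - 1) * (p * T powr (p - 1)) + 1"
  have q_cont: "continuous_on UNIV q"
    unfolding q_def cl_def using p_gt_1 by (intro continuous_on_powr' continuous_intros) auto
  obtain u u1 u2 where cont: "continuous_on ({0..c} \<times> UNIV) (\<lambda>(r, d). u r d)"
    "continuous_on ({0..c} \<times> UNIV) (\<lambda>(r, d). u1 r d)"
    "continuous_on ({0..c} \<times> UNIV) (\<lambda>(r, d). u2 r d)"
    and u: "\<And>d. u 0 d = 1" "\<And>d. u1 0 d = 0"
      "\<And>d r. r \<in> {0..c} \<Longrightarrow> ((\<lambda>r. u r d) has_real_derivative u1 r d) (at r within {0..c})"
      "\<And>d r. r \<in> {0..c} \<Longrightarrow> ((\<lambda>r. u1 r d) has_real_derivative u2 r d) (at r within {0..c})"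
      "\<And>d r. r \<in> {0<..c} \<Longrightarrow> u2 r d = - H r * u1 r d - \<mu> * F d (u r d)"
  proof -
    have "\<exists>u u1 u2. continuous_on ({0..c} \<times> UNIV) (\<lambda>(r, d). u r d) \<and>
    continuous_on ({0..c} \<times> UNIV) (\<lambda>(r, d). u1 r d) \<and>
    continuous_on ({0..c} \<times> UNIV) (\<lambda>(r, d). u2 r d) \<and>
    (\<forall>d. u 0 d = 1 \<and> u1 0 d = 0 \<and>
      (\<forall>r\<in>{0..c}. ((\<lambda>r. u r d) has_real_derivative u1 r d) (at r within {0..c})) \<and>
      (\<forall>r\<in>{0..c}. ((\<lambda>r. u1 r d) has_real_derivative u2 r d) (at r within {0..c})) \<and>
      (\<forall>r\<in>{0<..c}. u2 r d = - H r * u1 r d - \<mu> * F d (u r d)))"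
    proof (rule ivp_lipschitz)
      show "continuous_on UNIV (\<lambda>(d, x). F d x)"
        unfolding F_def case_prod_unfold truncate_def
        by (intro continuous_intros continuous_on_compose2[OF q_cont] p_gt_1) auto
      show "L \<ge> 0" using p_gt_1 by (simp add: L_def)
      show "F d 0 = 0" for d using T by (simp add: F_def truncate_id)
      fix d x y
      have "\<bar>F d x - F d y\<bar> \<le> q d * \<bar>odd_power p (truncate T x) - odd_power p (truncate T y)\<bar> + \<bar>x - y\<bar>"
      proof -
        have "F d x - F d y = q d * (odd_power p (truncate T x) - odd_power p (truncate T y)) - (x - y)"
          by (simp add: F_def algebra_simps)
        also have "\<bar>\<dots>\<bar> \<le> \<bar>q d * (odd_power p (truncate T x) - odd_power p (truncate T y))\<bar> + \<bar>x - y\<bar>"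
          by (rule abs_triangle_ineq4)
        finally show ?thesis using q0(1)[of d] by (simp add: abs_mult)
      qed
      also have "\<dots> \<le> D powr (p - 1) * (p * T powr (p - 1) * \<bar>x - y\<bar>) + \<bar>x - y\<bar>"
        using q0[of d] T p_gt_1 by (intro add_right_mono mult_mono truncated_odd_power_lipschitz) auto
      finally show "\<bar>F d x - F d y\<bar> \<le> L * \<bar>x - y\<bar>" by (simp add: L_def algebra_simps)
    qed
    then show ?thesis using that by blast
  qed
  have bound: "\<bar>u r d\<bar> < T" if r: "r \<in> {0..c}" for r d
  proof (rule ccontr)
    assume neg: "\<not> \<bar>u r d\<bar> < T"
    have cu: "continuous_on {0..c} (\<lambda>r. u r d)" "continuous_on {0..c} (\<lambda>r. u1 r d)"
      using DERIV_continuous_on[OF u(3)] DERIV_continuous_on[OF u(4)] by auto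
    \<comment> \<open>The cut-off value is reached for the first time at the least element \<open>s\<close> of this set.\<close>
    define Z where "Z = {0..c} \<inter> (\<lambda>r. \<bar>u r d\<bar>) -` {T..}"
    have "closed Z" unfolding Z_def
      using cu by (intro continuous_closed_preimage continuous_intros) auto
    moreover have "bounded Z"
      by (rule bounded_subset[of "{0..c}"]) (auto simp: Z_def)
    ultimately have cZ: "compact Z" by (simp add: compact_eq_bounded_closed)
    have neZ: "Z \<noteq> {}" using r neg by (auto simp: Z_def)
    obtain s where s: "s \<in> Z" "\<And>x. x \<in> Z \<Longrightarrow> s \<le> x"
      using compact_attains_inf[OF cZ neZ] by blast
    have sc: "s \<in> {0..c}" "\<bar>u s d\<bar> \<ge> T" using s(1) by (auto simp: Z_def)
    have less: "\<bar>u x d\<bar> < T" if "0 \<le> x" "x < s" for x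
    proof (rule ccontr)
      assume "\<not> \<bar>u x d\<bar> < T"
      then have "x \<in> Z" using that sc by (auto simp: Z_def)
      then show False using s(2) that by force
    qed
    define Y where "Y = (\<lambda>x. (u1 x d)\<^sup>2 / 2 + \<mu> * q d * (u x d * odd_power p (u x d) / (p + 1)) + (u x d)\<^sup>2 / 2)"
    have Yge: "(u1 x d)\<^sup>2 / 2 + (u x d)\<^sup>2 / 2 \<le> Y x" for x
      using odd_power_mult_self_nonneg[of "u x d" p] mu_pos q0(1)[of d] p_gt_1 by (auto simp: Y_def)
    have contY: "continuous_on {0..s} Y"
      unfolding Y_def using sc p_gt_1
      by (intro continuous_intros continuous_on_subset[OF cu(1)] continuous_on_subset[OF cu(2)]) auto
    have "Y s * exp (- (1 + \<mu>) * s) \<le> Y 0 * exp (- (1 + \<mu>) * 0)"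
    proof (rule antimono_from_deriv[where f = "\<lambda>x. Y x * exp (- (1 + \<mu>) * x)"])
      fix x assume x: "0 < x" "x < s"
      then have xc: "x \<in> {0<..c}" "x < c" using sc by auto
      have d1: "((\<lambda>r. u r d) has_real_derivative u1 x d) (at x)" "((\<lambda>r. u1 r d) has_real_derivative u2 x d) (at x)"
        using u(3,4)[of x d] xc by (auto intro: derivative_within_at_Icc[of _ _ _ 0 c])
      have "(Y has_real_derivative (2 * u1 x d * u2 x d / 2 + \<mu> * q d * (odd_power p (u x d) * u1 x d) + 2 * u x d * u1 x d / 2)) (at x)"
        unfolding Y_def
        by (intro DERIV_add DERIV_cmult DERIV_cdivide DERIV_chain2[OF odd_power_primitive[OF p_gt_1]] d1)
           (auto intro!: derivative_eq_intros d1)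
      then show "((\<lambda>x. Y x * exp (- (1 + \<mu>) * x)) has_real_derivative
         (u1 x d * u2 x d + \<mu> * q d * odd_power p (u x d) * u1 x d + u x d * u1 x d - (1 + \<mu>) * Y x) * exp (- (1 + \<mu>) * x)) (at x)"
        by (auto intro!: derivative_eq_intros simp: algebra_simps)
      have tr: "truncate T (u x d) = u x d" using less[of x] x by (intro truncate_id) auto
      have "u1 x d * u2 x d + \<mu> * q d * odd_power p (u x d) * u1 x d + u x d * u1 x d
        = - H x * (u1 x d)\<^sup>2 + (1 + \<mu>) * (u x d * u1 x d)"
      proof -
        have e: "u2 x d = - H x * u1 x d - \<mu> * (q d * odd_power p (u x d) - u x d)"
          using u(5)[OF xc(1), of d] by (simp add: F_def tr)
        show ?thesis unfolding e by (simp add: power2_eq_square algebra_simps)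
      qed
      also have "\<dots> \<le> (1 + \<mu>) * (u x d * u1 x d)" using H_nonneg[OF xc(1)] by simp
      also have "\<dots> \<le> (1 + \<mu>) * Y x"
      proof (rule mult_left_mono)
        have "u x d * u1 x d \<le> (u1 x d)\<^sup>2 / 2 + (u x d)\<^sup>2 / 2"
          using zero_le_power2[of "u x d - u1 x d"] by (simp add: power2_diff)
        then show "u x d * u1 x d \<le> Y x" using Yge[of x] by linarith
      qed (use mu_pos in simp)
      finally show "(u1 x d * u2 x d + \<mu> * q d * odd_power p (u x d) * u1 x d + u x d * u1 x d - (1 + \<mu>) * Y x) * exp (- (1 + \<mu>) * x) \<le> 0"
        by (simp add: mult_nonpos_nonneg)
    qed (use sc contY in \<open>auto intro!: continuous_intros\<close>)
    moreover have "Y 0 \<le> Y0"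
      using q0[of d] mu_pos p_gt_1 by (simp add: Y_def Y0_def u divide_right_mono)
    ultimately have "Y s * exp (- (1 + \<mu>) * s) \<le> Y0" by simp
    then have "Y s * exp (- (1 + \<mu>) * s) * exp ((1 + \<mu>) * s) \<le> Y0 * exp ((1 + \<mu>) * s)"
      by (intro mult_right_mono) auto
    then have "Y s \<le> Y0 * exp ((1 + \<mu>) * s)"
      by (simp only: mult.assoc exp_add[symmetric]) (simp add: algebra_simps)
    also have "\<dots> \<le> Y0 * exp ((1 + \<mu>) * c)" using sc Y0 mu_pos by (intro mult_left_mono) auto
    finally have "(u s d)\<^sup>2 \<le> 2 * Y0 * exp ((1 + \<mu>) * c)" using Yge[of s] zero_le_power2[of "u1 s d"] by linarith
    then have "\<bar>u s d\<bar> \<le> sqrt (2 * Y0 * exp ((1 + \<mu>) * c))" using real_le_rsqrt by (metis abs_le_square_iff power2_abs)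
    then show False using sc by (simp add: T_def)
  qed
  have "F d (u r d) = d powr (p - 1) * odd_power p (u r d) - u r d" if "d \<in> {0..D}" "r \<in> {0..c}" for d r
    using bound[OF that(2), of d] that(1) by (simp add: F_def q_def cl_def truncate_id)
  moreover have "{0..c} \<times> {0..D} \<subseteq> {0..c} \<times> UNIV" by auto
  ultimately show ?thesis
    using u cont by (intro exI[of _ u] exI[of _ u1] exI[of _ u2]) (auto intro: continuous_on_subset)
qed

end

section \<open>Energy and unique continuation\<close>

context half_problem
begin

text \<open>The coefficient \<open>q\<close> of the nonlinearity is \<open>1\<close> for the original equation, \<open>d powr (p - 1)\<close> after
  division by the initial value \<open>d\<close>, and \<open>0\<close> for the linearisation at \<open>0\<close>.\<close>

definition solves :: "real \<Rightarrow> (real \<Rightarrow> real) \<Rightarrow> (real \<Rightarrow> real) \<Rightarrow> (real \<Rightarrow> real) \<Rightarrow> bool" where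
  "solves q w w1 w2 \<longleftrightarrow> C2_with_derivs {0..c} w w1 w2 \<and> w1 0 = 0 \<and>
     (\<forall>r\<in>{0<..c}. w2 r = - H r * w1 r - \<mu> * (q * odd_power p (w r) - w r))"

lemma solvesD:
  assumes "solves q w w1 w2"
  shows "r \<in> {0..c} \<Longrightarrow> (w has_real_derivative w1 r) (at r within {0..c})"
    "r \<in> {0..c} \<Longrightarrow> (w1 has_real_derivative w2 r) (at r within {0..c})"
    "w1 0 = 0"
    "r \<in> {0<..c} \<Longrightarrow> w2 r = - H r * w1 r - \<mu> * (q * odd_power p (w r) - w r)"
    "0 < r \<Longrightarrow> r < c \<Longrightarrow> (w has_real_derivative w1 r) (at r)"
    "0 < r \<Longrightarrow> r < c \<Longrightarrow> (w1 has_real_derivative w2 r) (at r)"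
    "continuous_on {0..c} w" "continuous_on {0..c} w1" "continuous_on {0..c} w2"
proof -
  show d: "(w has_real_derivative w1 r) (at r within {0..c})" if "r \<in> {0..c}" for r
    using assms that by (auto simp: solves_def C2_with_derivs_def)
  show d1: "(w1 has_real_derivative w2 r) (at r within {0..c})" if "r \<in> {0..c}" for r
    using assms that by (auto simp: solves_def C2_with_derivs_def)
  show "w1 0 = 0"
    "r \<in> {0<..c} \<Longrightarrow> w2 r = - H r * w1 r - \<mu> * (q * odd_power p (w r) - w r)"
    "continuous_on {0..c} w2"
    using assms by (auto simp: solves_def C2_with_derivs_def)
  show "0 < r \<Longrightarrow> r < c \<Longrightarrow> (w has_real_derivative w1 r) (at r)"
    "0 < r \<Longrightarrow> r < c \<Longrightarrow> (w1 has_real_derivative w2 r) (at r)"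
    using d[of r] d1[of r] by (auto intro: derivative_within_at_Icc[of _ _ _ 0 c])
  show "continuous_on {0..c} w" "continuous_on {0..c} w1"
    using DERIV_continuous_on[OF d] DERIV_continuous_on[OF d1] by auto
qed

lemma continuous_H: "0 < s \<Longrightarrow> continuous_on {s..c} H"
  unfolding H_def h_def using c_bounds by (intro continuous_intros ballI less_imp_neq[symmetric] sin_gt_zero) auto

lemma H_upper_bound: assumes "0 < s" "s \<le> c" shows "\<exists>C\<ge>0. \<forall>r\<in>{s..c}. H r \<le> C"
proof -
  obtain x where "x \<in> {s..c}" "\<And>y. y \<in> {s..c} \<Longrightarrow> H y \<le> H x"
    using continuous_attains_sup[OF _ _ continuous_H[OF assms(1)]] assms by auto
  then show ?thesis using H_nonneg[of x] assms by (intro exI[of _ "H x"]) auto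
qed

definition energy :: "real \<Rightarrow> (real \<Rightarrow> real) \<Rightarrow> (real \<Rightarrow> real) \<Rightarrow> real \<Rightarrow> real" where
  "energy q w w1 r = (w1 r)\<^sup>2 / 2 + \<mu> * (q * (w r * odd_power p (w r) / (p + 1)) - (w r)\<^sup>2 / 2)"

lemma energy_deriv:
  assumes s: "solves q w w1 w2" and r: "0 < r" "r < c"
  shows "(energy q w w1 has_real_derivative - H r * (w1 r)\<^sup>2) (at r)"
proof -
  have "((\<lambda>r. w r * odd_power p (w r) / (p + 1)) has_real_derivative odd_power p (w r) * w1 r) (at r)"
    by (rule DERIV_chain2[OF odd_power_primitive[OF p_gt_1] solvesD(5)[OF s r]])
  then have "(energy q w w1 has_real_derivative
      2 * w1 r * w2 r / 2 + \<mu> * (q * (odd_power p (w r) * w1 r) - 2 * w r * w1 r / 2)) (at r)"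
    unfolding energy_def
    by (intro DERIV_add DERIV_cmult DERIV_cdivide DERIV_diff)
       (auto intro!: derivative_eq_intros solvesD(5,6)[OF s r])
  moreover have "2 * w1 r * w2 r / 2 + \<mu> * (q * (odd_power p (w r) * w1 r) - 2 * w r * w1 r / 2) = - H r * (w1 r)\<^sup>2"
  proof -
    have e: "w2 r = - H r * w1 r - \<mu> * (q * odd_power p (w r) - w r)" using solvesD(4)[OF s, of r] r by simp
    have "2 * w1 r * w2 r / 2 + \<mu> * (q * (odd_power p (w r) * w1 r) - 2 * w r * w1 r / 2)
      = w1 r * w2 r + \<mu> * (q * (odd_power p (w r) * w1 r) - w r * w1 r)" by simp
    also have "\<dots> = - H r * (w1 r)\<^sup>2" unfolding e by (simp add: power2_eq_square algebra_simps)
    finally show ?thesis .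
  qed
  ultimately show ?thesis by simp
qed

lemma continuous_energy:
  assumes s: "solves q w w1 w2" shows "continuous_on {0..c} (energy q w w1)"
  unfolding energy_def using p_gt_1 by (intro continuous_intros solvesD(7,8)[OF s]) auto

lemma energy_antimono:
  assumes s: "solves q w w1 w2" and "0 \<le> x" "x \<le> y" "y \<le> c"
  shows "energy q w w1 y \<le> energy q w w1 x"
proof (rule antimono_from_deriv[where f = "energy q w w1" and f' = "\<lambda>r. - H r * (w1 r)\<^sup>2"])
  show "continuous_on {x..y} (energy q w w1)"
    using assms by (intro continuous_on_subset[OF continuous_energy[OF s]]) auto
  fix t assume "x < t" "t < y"
  then have t: "0 < t" "t < c" using assms by auto
  show "(energy q w w1 has_real_derivative - H t * (w1 t)\<^sup>2) (at t)" by (rule energy_deriv[OF s t])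
  show "- H t * (w1 t)\<^sup>2 \<le> 0" using H_nonneg[of t] t by simp
qed fact

text \<open>A Gronwall estimate for the squared distance to the rest point, on intervals away from the
  singular point \<open>0\<close>; the value at \<open>0\<close> follows by continuity.\<close>

lemma rest_point_backward:
  assumes s: "solves q w w1 w2" and q: "q \<ge> 0" and y0: "q * odd_power p y0 = y0"
    and r0: "r0 \<in> {0<..c}" "w r0 = y0" "w1 r0 = 0"
  shows "w 0 = y0"
proof -
  have const: "w t = y0" if t: "t \<in> {0<..<r0}" for t
  proof -
    obtain C where C: "C \<ge> 0" "\<And>r. r \<in> {t..c} \<Longrightarrow> H r \<le> C" using H_upper_bound[of t] t r0 by auto
    have "compact (w ` {0..c})" by (intro compact_continuous_image solvesD[OF s]) auto
    then obtain B0 where "\<And>r. r \<in> {0..c} \<Longrightarrow> \<bar>w r\<bar> \<le> B0"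
      by (metis bounded_iff compact_imp_bounded image_eqI real_norm_def)
    then obtain B where B: "B \<ge> 0" "\<bar>y0\<bar> \<le> B" "\<And>r. r \<in> {0..c} \<Longrightarrow> \<bar>w r\<bar> \<le> B"
      by (metis abs_ge_zero max.cobounded1 max.cobounded2 order_trans)
    define L where "L = \<mu> * (q * (p * B powr (p - 1)) + 1)"
    have L: "L \<ge> 0" using mu_pos q p_gt_1 by (simp add: L_def)
    have N: "\<bar>\<mu> * (q * odd_power p (w r) - w r)\<bar> \<le> L * \<bar>w r - y0\<bar>" if "r \<in> {0..c}" for r
    proof -
      have lip: "\<bar>odd_power p (w r) - odd_power p y0\<bar> \<le> p * B powr (p - 1) * \<bar>w r - y0\<bar>"
        using truncated_odd_power_lipschitz[OF p_gt_1 B(1), of "w r" y0] B that by (simp add: truncate_id)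
      have "q * odd_power p (w r) - w r = q * (odd_power p (w r) - odd_power p y0) - (w r - y0)"
        using y0 by (simp add: algebra_simps)
      also have "\<bar>\<dots>\<bar> \<le> q * \<bar>odd_power p (w r) - odd_power p y0\<bar> + \<bar>w r - y0\<bar>"
        using q abs_triangle_ineq4[of "q * (odd_power p (w r) - odd_power p y0)" "w r - y0"] by (simp add: abs_mult)
      also have "\<dots> \<le> q * (p * B powr (p - 1) * \<bar>w r - y0\<bar>) + \<bar>w r - y0\<bar>"
        using lip q by (intro add_right_mono mult_left_mono) auto
      finally have "\<bar>q * odd_power p (w r) - w r\<bar> \<le> q * (p * B powr (p - 1) * \<bar>w r - y0\<bar>) + \<bar>w r - y0\<bar>" .
      from mult_left_mono[OF this, of \<mu>]
      have "\<mu> * \<bar>q * odd_power p (w r) - w r\<bar> \<le> L * \<bar>w r - y0\<bar>"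
        using mu_pos by (simp add: L_def algebra_simps)
      then show ?thesis using mu_pos by (simp only: abs_mult abs_of_pos)
    qed
    define Q where "Q = (\<lambda>r. (w r - y0)\<^sup>2 + (w1 r)\<^sup>2)"
    define K where "K = 1 + 2 * C + L"
    have "Q t * exp (K * t) \<le> Q r0 * exp (K * r0)"
    proof (rule mono_from_deriv[where f = "\<lambda>r. Q r * exp (K * r)" and f' = "\<lambda>r. (2 * (w r - y0) * w1 r + 2 * w1 r * w2 r + K * Q r) * exp (K * r)"])
      show "t \<le> r0" using t by simp
      show "continuous_on {t..r0} (\<lambda>r. Q r * exp (K * r))"
        unfolding Q_def using t r0
        by (intro continuous_intros continuous_on_subset[OF solvesD(7)[OF s]] continuous_on_subset[OF solvesD(8)[OF s]]) auto
      fix r assume "t < r" "r < r0"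
      then have r: "0 < r" "r < c" "r \<in> {0<..c}" "r \<in> {t..c}" "r \<in> {0..c}" using t r0 by auto
      show "((\<lambda>r. Q r * exp (K * r)) has_real_derivative (2 * (w r - y0) * w1 r + 2 * w1 r * w2 r + K * Q r) * exp (K * r)) (at r)"
        unfolding Q_def by (auto intro!: derivative_eq_intros solvesD(5,6)[OF s r(1,2)] simp: algebra_simps)
      let ?N = "\<mu> * (q * odd_power p (w r) - w r)"
      have "2 * w1 r * w2 r = - 2 * H r * (w1 r)\<^sup>2 - 2 * (w1 r * ?N)"
        unfolding solvesD(4)[OF s r(3)] by (simp add: power2_eq_square algebra_simps)
      moreover have "H r * (w1 r)\<^sup>2 \<le> C * Q r"
        using C(1) C(2)[OF r(4)] by (intro mult_mono) (auto simp: Q_def)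
      moreover have "2 * \<bar>x * y\<bar> \<le> x\<^sup>2 + y\<^sup>2" for x y :: real
        using zero_le_power2[of "\<bar>x\<bar> - \<bar>y\<bar>"] by (simp add: power2_diff abs_mult)
      note young = this
      have "2 * ((w r - y0) * w1 r) \<ge> - Q r" using young[of "w r - y0" "w1 r"] by (simp add: Q_def)
      moreover have "2 * (w1 r * ?N) \<le> L * Q r"
      proof -
        have "w1 r * ?N \<le> \<bar>w1 r\<bar> * \<bar>?N\<bar>" by (metis abs_ge_self abs_mult)
        also have "\<dots> \<le> \<bar>w1 r\<bar> * (L * \<bar>w r - y0\<bar>)" using N[OF r(5)] by (intro mult_left_mono) auto
        finally have "2 * (w1 r * ?N) \<le> 2 * (\<bar>w1 r\<bar> * (L * \<bar>w r - y0\<bar>))" by (rule mult_left_mono) simp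
        also have "\<dots> = L * (2 * \<bar>(w r - y0) * w1 r\<bar>)" by (simp add: abs_mult)
        also have "\<dots> \<le> L * Q r" using young[of "w r - y0" "w1 r"] L by (intro mult_left_mono) (auto simp: Q_def)
        finally show ?thesis .
      qed
      ultimately have "0 \<le> 2 * (w r - y0) * w1 r + 2 * w1 r * w2 r + K * Q r" by (simp add: K_def algebra_simps)
      then show "0 \<le> (2 * (w r - y0) * w1 r + 2 * w1 r * w2 r + K * Q r) * exp (K * r)" by simp
    qed
    moreover have "Q r0 = 0" by (simp add: Q_def r0)
    ultimately have "Q t \<le> 0" by (simp add: mult_le_0_iff)
    then show ?thesis unfolding Q_def by (smt (verit) zero_le_power2 power2_eq_square mult_eq_0_iff zero_eq_power2)
  qed
  have "closure {0<..<r0} = {0..r0}" using r0 by simp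
  then show ?thesis
    using continuous_constant_on_closure[of "{0<..<r0}" w y0 0] const r0
      continuous_on_subset[OF solvesD(7)[OF s], of "{0..r0}"] by auto
qed

lemma solution_curve_nonzero:
  assumes s: "solves q w w1 w2" and q: "q \<ge> 0" and w0: "w 0 \<noteq> 0" and r: "r \<in> {0..c}"
  shows "w r \<noteq> 0 \<or> w1 r \<noteq> 0"
proof (cases "r = 0")
  case False
  then show ?thesis using rest_point_backward[OF s q, of 0 r] w0 r by auto
qed (use w0 in auto)

end

section \<open>The phase angle\<close>

text \<open>The angle is obtained by integration instead of lifting: \<open>\<theta>'\<close> is the angular velocity of the
  curve, and the curve, normalised and rotated back by \<open>\<theta>\<close>, has derivative zero.\<close>

lemma polar_coordinates_of_curve:
  fixes x y x' y' :: "real \<Rightarrow> real"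
  assumes T: "T \<ge> 0"
    and dx: "\<And>t. t \<in> {0..T} \<Longrightarrow> (x has_real_derivative x' t) (at t within {0..T})"
    and dy: "\<And>t. t \<in> {0..T} \<Longrightarrow> (y has_real_derivative y' t) (at t within {0..T})"
    and cx': "continuous_on {0..T} x'" and cy': "continuous_on {0..T} y'"
    and nz: "\<And>t. t \<in> {0..T} \<Longrightarrow> (x t)\<^sup>2 + (y t)\<^sup>2 > 0"
    and init: "x 0 > 0" "y 0 = 0"
  defines "\<theta>' \<equiv> \<lambda>t. (x t * y' t - y t * x' t) / ((x t)\<^sup>2 + (y t)\<^sup>2)"
  defines "\<theta> \<equiv> \<lambda>r. integral {0..r} \<theta>'"
  shows "t \<in> {0..T} \<Longrightarrow> (\<theta> has_real_derivative \<theta>' t) (at t within {0..T})"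
    "t \<in> {0..T} \<Longrightarrow> x t = sqrt ((x t)\<^sup>2 + (y t)\<^sup>2) * cos (\<theta> t)"
    "t \<in> {0..T} \<Longrightarrow> y t = sqrt ((x t)\<^sup>2 + (y t)\<^sup>2) * sin (\<theta> t)"
proof -
  define R where "R = (\<lambda>t. sqrt ((x t)\<^sup>2 + (y t)\<^sup>2))"
  have Rpos: "R t > 0" if "t \<in> {0..T}" for t using nz[OF that] by (simp add: R_def)
  have R2: "R t * R t = (x t)\<^sup>2 + (y t)\<^sup>2" for t by (simp add: R_def)
  have cx: "continuous_on {0..T} x" "continuous_on {0..T} y"
    using DERIV_continuous_on[OF dx] DERIV_continuous_on[OF dy] by auto
  have "continuous_on {0..T} \<theta>'"
    unfolding \<theta>'_def using nz by (intro continuous_intros cx cx' cy') (metis less_irrefl)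
  then show d\<theta>: "(\<theta> has_real_derivative \<theta>' t) (at t within {0..T})" if "t \<in> {0..T}" for t
    using that unfolding \<theta>_def by (rule integral_has_real_derivative)
  have dR: "(R has_real_derivative (x t * x' t + y t * y' t) / R t) (at t within {0..T})" if t: "t \<in> {0..T}" for t
  proof -
    have "((\<lambda>t. (x t)\<^sup>2 + (y t)\<^sup>2) has_real_derivative 2 * (x t * x' t + y t * y' t)) (at t within {0..T})"
      by (auto intro!: derivative_eq_intros dx[OF t] dy[OF t])
    from DERIV_chain2[where g = "\<lambda>t. (x t)\<^sup>2 + (y t)\<^sup>2", OF DERIV_real_sqrt[OF nz[OF t]] this]
    have "(R has_real_derivative inverse (R t) / 2 * (2 * (x t * x' t + y t * y' t))) (at t within {0..T})"
      unfolding R_def .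
    also have "inverse (R t) / 2 * (2 * (x t * x' t + y t * y' t)) = (x t * x' t + y t * y' t) / R t"
      using Rpos[OF t] by (simp add: field_simps)
    finally show ?thesis .
  qed
  have dX: "((\<lambda>t. x t / R t) has_real_derivative - \<theta>' t * (y t / R t)) (at t within {0..T})" if t: "t \<in> {0..T}" for t
  proof -
    have "((\<lambda>t. x t / R t) has_real_derivative (x' t * R t - x t * ((x t * x' t + y t * y' t) / R t)) / (R t * R t)) (at t within {0..T})"
      using Rpos[OF t] by (intro DERIV_divide dx dR t) auto
    moreover have "(x' t * R t - x t * ((x t * x' t + y t * y' t) / R t)) / (R t * R t) = - \<theta>' t * (y t / R t)"
    proof -
      have "(x' t * R t - x t * ((x t * x' t + y t * y' t) / R t)) / (R t * R t)
        = (x' t * (R t * R t) - x t * (x t * x' t + y t * y' t)) / (R t * R t * R t)"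
        using Rpos[OF t] by (simp add: field_simps)
      also have "\<dots> = - (x t * y' t - y t * x' t) * y t / (R t * R t * R t)"
        unfolding R2 by (simp add: power2_eq_square algebra_simps)
      also have "\<dots> = - \<theta>' t * (y t / R t)"
        unfolding \<theta>'_def R2[symmetric] by (simp only: minus_divide_left times_divide_times_eq)
      finally show ?thesis .
    qed
    ultimately show ?thesis by simp
  qed
  have dY: "((\<lambda>t. y t / R t) has_real_derivative \<theta>' t * (x t / R t)) (at t within {0..T})" if t: "t \<in> {0..T}" for t
  proof -
    have "((\<lambda>t. y t / R t) has_real_derivative (y' t * R t - y t * ((x t * x' t + y t * y' t) / R t)) / (R t * R t)) (at t within {0..T})"
      using Rpos[OF t] by (intro DERIV_divide dy dR t) auto
    moreover have "(y' t * R t - y t * ((x t * x' t + y t * y' t) / R t)) / (R t * R t) = \<theta>' t * (x t / R t)"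
    proof -
      have "(y' t * R t - y t * ((x t * x' t + y t * y' t) / R t)) / (R t * R t)
        = (y' t * (R t * R t) - y t * (x t * x' t + y t * y' t)) / (R t * R t * R t)"
        using Rpos[OF t] by (simp add: field_simps)
      also have "\<dots> = (x t * y' t - y t * x' t) * x t / (R t * R t * R t)"
        unfolding R2 by (simp add: power2_eq_square algebra_simps)
      also have "\<dots> = \<theta>' t * (x t / R t)" unfolding \<theta>'_def R2[symmetric] by simp
      finally show ?thesis .
    qed
    ultimately show ?thesis by simp
  qed
  define A where "A = (\<lambda>t. x t / R t * cos (\<theta> t) + y t / R t * sin (\<theta> t))"
  define B where "B = (\<lambda>t. y t / R t * cos (\<theta> t) - x t / R t * sin (\<theta> t))"
  have dA: "(A has_real_derivative 0) (at t within {0..T})" if t: "t \<in> {0..T}" for t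
    unfolding A_def
    by (rule derivative_eq_intros dX[OF t] dY[OF t] d\<theta>[OF t] refl)+ (simp add: algebra_simps)
  have dB: "(B has_real_derivative 0) (at t within {0..T})" if t: "t \<in> {0..T}" for t
    unfolding B_def
    by (rule derivative_eq_intros dX[OF t] dY[OF t] d\<theta>[OF t] refl)+ (simp add: algebra_simps)
  obtain ca cb where ca: "\<And>t. t \<in> {0..T} \<Longrightarrow> A t = ca" and cb: "\<And>t. t \<in> {0..T} \<Longrightarrow> B t = cb"
    using has_field_derivative_zero_constant[OF _ dA] has_field_derivative_zero_constant[OF _ dB] by auto
  have "A 0 = 1" "B 0 = 0" using init by (auto simp: A_def B_def R_def \<theta>_def)
  then have A1: "A t = 1" and B0: "B t = 0" if "t \<in> {0..T}" for t
    using ca[of 0] ca[OF that] cb[of 0] cb[OF that] T by auto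
  have sc: "cos s * cos s + sin s * sin s = 1" for s :: real
    using sin_cos_squared_add[of s] by (simp add: power2_eq_square)
  have rot: "X = (X * C + Y * S) * C - (Y * C - X * S) * S \<and> Y = (X * C + Y * S) * S + (Y * C - X * S) * C"
    if "C * C + S * S = 1" for X Y C S :: real
  proof -
    have "(X * C + Y * S) * C - (Y * C - X * S) * S = X * (C * C + S * S)"
      "(X * C + Y * S) * S + (Y * C - X * S) * C = Y * (C * C + S * S)"
      by (simp_all add: algebra_simps)
    then show ?thesis using that by simp
  qed
  have "x t / R t = A t * cos (\<theta> t) - B t * sin (\<theta> t)"
    "y t / R t = A t * sin (\<theta> t) + B t * cos (\<theta> t)" for t
    unfolding A_def B_def using rot[OF sc, of "x t / R t" "\<theta> t" "y t / R t"] by blast+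
  then have xy: "x t / R t = cos (\<theta> t)" "y t / R t = sin (\<theta> t)" if "t \<in> {0..T}" for t
    using A1[OF that] B0[OF that] by auto
  show "x t = sqrt ((x t)\<^sup>2 + (y t)\<^sup>2) * cos (\<theta> t)" if "t \<in> {0..T}" for t
  proof -
    have "x t = R t * cos (\<theta> t)" using xy(1)[OF that] Rpos[OF that] by (simp add: field_simps)
    then show ?thesis unfolding R_def .
  qed
  show "y t = sqrt ((x t)\<^sup>2 + (y t)\<^sup>2) * sin (\<theta> t)" if "t \<in> {0..T}" for t
  proof -
    have "y t = R t * sin (\<theta> t)" using xy(2)[OF that] Rpos[OF that] by (simp add: field_simps)
    then show ?thesis unfolding R_def .
  qed
qed

context half_problem
begin

text \<open>The factor \<open>A\<close> stretches the phase plane.  In the stretched plane a solution of large energy rotates,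
  away from the pole, with speed at least \<open>A / 4\<close>, so a large \<open>A\<close> gives a large total angle.\<close>

definition angle :: "real \<Rightarrow> (real \<Rightarrow> real) \<Rightarrow> (real \<Rightarrow> real) \<Rightarrow> (real \<Rightarrow> real) \<Rightarrow> real \<Rightarrow> real" where
  "angle A w w1 w2 r = integral {0..r} (\<lambda>t. (A * w t * w2 t - w1 t * (A * w1 t)) / ((A * w t)\<^sup>2 + (w1 t)\<^sup>2))"

definition radius :: "real \<Rightarrow> (real \<Rightarrow> real) \<Rightarrow> (real \<Rightarrow> real) \<Rightarrow> real \<Rightarrow> real" where
  "radius A w w1 r = sqrt ((A * w r)\<^sup>2 + (w1 r)\<^sup>2)"

lemma polar_solution:
  assumes s: "solves q w w1 w2" and q: "q \<ge> 0" and w0: "w 0 > 0" and A: "A > 0"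
    and r: "r \<in> {0..c}"
  shows "(angle A w w1 w2 has_real_derivative
            (A * w r * w2 r - w1 r * (A * w1 r)) / ((A * w r)\<^sup>2 + (w1 r)\<^sup>2)) (at r within {0..c})"
    "A * w r = radius A w w1 r * cos (angle A w w1 w2 r)"
    "w1 r = radius A w w1 r * sin (angle A w w1 w2 r)"
    "radius A w w1 r > 0"
proof -
  have nz: "(A * w r)\<^sup>2 + (w1 r)\<^sup>2 > 0" if "r \<in> {0..c}" for r
    using solution_curve_nonzero[OF s q _ that] w0 A by (simp add: sum_power2_gt_zero_iff)
  show "radius A w w1 r > 0" using nz[OF r] by (simp add: radius_def)
  note pc = polar_coordinates_of_curve[of c "\<lambda>r. A * w r" "\<lambda>r. A * w1 r" w1 w2,
     OF _ DERIV_cmult[OF solvesD(1)[OF s]] solvesD(2)[OF s] _ solvesD(9)[OF s] nz _ solvesD(3)[OF s], folded angle_def radius_def]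
  show "(angle A w w1 w2 has_real_derivative
            (A * w r * w2 r - w1 r * (A * w1 r)) / ((A * w r)\<^sup>2 + (w1 r)\<^sup>2)) (at r within {0..c})"
    "A * w r = radius A w w1 r * cos (angle A w w1 w2 r)"
    "w1 r = radius A w w1 r * sin (angle A w w1 w2 r)"
    using r w0 A c_bounds by (auto intro!: pc continuous_intros solvesD(8)[OF s])
qed

lemma angle_0 [simp]: "angle A w w1 w2 0 = 0" by (simp add: angle_def)

lemma continuous_angle:
  assumes "solves q w w1 w2" "q \<ge> 0" "w 0 > 0" "A > 0"
  shows "continuous_on {0..c} (angle A w w1 w2)"
  using polar_solution(1)[OF assms] by (intro DERIV_continuous_on) auto

text \<open>At a zero of \<open>w\<close> the angle decreases with speed \<open>A\<close>, so it never reaches \<open>\<pi> / 2\<close> from below.\<close>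

lemma angle_less:
  assumes s: "solves q w w1 w2" and q: "q \<ge> 0" and w0: "w 0 > 0" and A: "A > 0"
    and r: "r \<in> {0..c}"
  shows "angle A w w1 w2 r < pi / 2"
proof (rule ccontr)
  let ?\<theta> = "angle A w w1 w2"
  assume neg: "\<not> ?\<theta> r < pi / 2"
  define Z where "Z = {0..c} \<inter> ?\<theta> -` {pi / 2..}"
  have "closed Z" unfolding Z_def
    using continuous_angle[OF s q w0 A] by (intro continuous_closed_preimage) auto
  moreover have "bounded Z" by (rule bounded_subset[of "{0..c}"]) (auto simp: Z_def)
  ultimately have cZ: "compact Z" by (simp add: compact_eq_bounded_closed)
  have neZ: "Z \<noteq> {}" using r neg by (auto simp: Z_def)
  obtain t where t: "t \<in> Z" "\<And>x. x \<in> Z \<Longrightarrow> t \<le> x"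
    using compact_attains_inf[OF cZ neZ] by blast
  have tc: "t \<in> {0..c}" "?\<theta> t \<ge> pi / 2" using t(1) by (auto simp: Z_def)
  then have t0: "t > 0" using pi_gt_zero by (cases "t = 0") auto
  have less: "?\<theta> x < pi / 2" if "0 \<le> x" "x < t" for x
  proof (rule ccontr)
    assume "\<not> ?\<theta> x < pi / 2"
    then have "x \<in> Z" using that tc by (auto simp: Z_def)
    then show False using t(2) that by force
  qed
  have eq: "?\<theta> t = pi / 2"
  proof (rule ccontr)
    assume "?\<theta> t \<noteq> pi / 2"
    then have "pi / 2 < ?\<theta> t" using tc by simp
    then obtain x where x: "0 \<le> x" "x \<le> t" "?\<theta> x = pi / 2"
      using IVT'[of ?\<theta> 0 "pi / 2" t] t0 tc continuous_on_subset[OF continuous_angle[OF s q w0 A], of "{0..t}"] by auto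
    then have "x < t" using \<open>?\<theta> t \<noteq> pi / 2\<close> by (cases "x = t") auto
    then show False using less[of x] x by simp
  qed
  have w0': "w t = 0" using polar_solution(2)[OF s q w0 A tc(1)] eq A by simp
  then have w1: "w1 t \<noteq> 0" using solution_curve_nonzero[OF s q _ tc(1)] w0 by auto
  have "(?\<theta> has_real_derivative - A) (at t within {0..c})"
    using polar_solution(1)[OF s q w0 A tc(1)] w0' w1 by (simp add: power2_eq_square)
  from has_real_derivative_neg_dec_left[OF this] A obtain e where e: "e > 0"
    "\<And>h. h > 0 \<Longrightarrow> t - h \<in> {0..c} \<Longrightarrow> h < e \<Longrightarrow> ?\<theta> t < ?\<theta> (t - h)" by auto
  define h where "h = min e t / 2"
  have h: "0 < h" "h < e" "h < t" using e t0 by (auto simp: h_def min_def)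
  then have "?\<theta> t < ?\<theta> (t - h)" using tc by (intro e) auto
  then show False using less[of "t - h"] h eq by simp
qed

text \<open>The energy of a solution of the linear equation is negative at the start, hence negative
  throughout, whereas at a zero of \<open>w\<close> it would be nonnegative.\<close>

lemma angle_gt_without_nonlinearity:
  assumes s: "solves 0 w w1 w2" and w0: "w 0 > 0" and A: "A > 0"
  shows "angle A w w1 w2 c > - (pi / 2)"
proof (rule ccontr)
  let ?\<theta> = "angle A w w1 w2"
  assume "\<not> ?\<theta> c > - (pi / 2)"
  then obtain x where x: "0 \<le> x" "x \<le> c" "?\<theta> x = - (pi / 2)"
    using IVT2'[of ?\<theta> c "- (pi / 2)" 0] c_bounds continuous_angle[OF s _ w0 A] by auto
  have "w x = 0" using polar_solution(2)[OF s _ w0 A, of x] x A by simp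
  moreover have "energy 0 w w1 x \<le> energy 0 w w1 0" using x by (intro energy_antimono[OF s]) auto
  ultimately have "(w1 x)\<^sup>2 / 2 \<le> - \<mu> * ((w 0)\<^sup>2 / 2)" by (simp add: energy_def solvesD(3)[OF s])
  moreover have "\<mu> * ((w 0)\<^sup>2 / 2) > 0" using mu_pos w0 by simp
  ultimately show False using zero_le_power2[of "w1 x"] by linarith
qed

lemma angle_attains:
  assumes s: "solves q w w1 w2" and q: "q \<ge> 0" and w0: "w 0 > 0" and A: "A > 0"
    and v: "angle A w w1 w2 c \<le> v" "v < 0"
  shows "\<exists>r\<in>{0<..c}. angle A w w1 w2 r = v"
proof -
  obtain x where x: "0 \<le> x" "x \<le> c" "angle A w w1 w2 x = v"
    using IVT2'[of "angle A w w1 w2" c v 0] v c_bounds continuous_angle[OF s q w0 A] by auto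
  then show ?thesis using v by (intro bexI[of _ x]) (auto simp: less_le)
qed

end

section \<open>Growth of the energy and of the phase angle\<close>

lemma powr_eventually_ge:
  fixes \<eta> M :: real
  assumes "\<eta> > 0" shows "\<exists>D\<ge>1. \<forall>d\<ge>D. M \<le> d powr \<eta>"
proof (intro exI[of _ "max 1 (\<bar>M\<bar> powr (1 / \<eta>))"] conjI allI impI)
  fix d assume d: "max 1 (\<bar>M\<bar> powr (1 / \<eta>)) \<le> d"
  have "M \<le> (\<bar>M\<bar> powr (1 / \<eta>)) powr \<eta>" using assms by (simp add: powr_powr)
  also have "\<dots> \<le> d powr \<eta>" using d assms by (intro powr_mono2) auto
  finally show "M \<le> d powr \<eta>" .
qed simp

context half_problem
begin

text \<open>The potential is increasing beyond \<open>1\<close>, and the energy does not increase.\<close>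

lemma solution_le_initial_value:
  assumes s: "solves 1 w w1 w2" and d: "w 0 = d" "d \<ge> 1" and r: "r \<in> {0..c}"
  shows "\<bar>w r\<bar> \<le> d"
proof (rule ccontr)
  define G where "G = (\<lambda>x. x * odd_power p x / (p + 1) - x\<^sup>2 / 2)"
  assume "\<not> \<bar>w r\<bar> \<le> d"
  then have less: "d < \<bar>w r\<bar>" by simp
  have dG: "(G has_real_derivative odd_power p x - x) (at x)" for x
    unfolding G_def
    by (intro DERIV_diff odd_power_primitive p_gt_1) (auto intro!: derivative_eq_intros)
  have "G d < G \<bar>w r\<bar>"
  proof (rule DERIV_pos_imp_increasing_open[OF less])
    fix x assume "d < x" "x < \<bar>w r\<bar>"
    then have x: "x > 1" using d by simp
    have "x powr 1 < x powr p" using x p_gt_1 by (intro powr_less_mono) auto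
    then have "odd_power p x - x > 0" using x by (simp add: odd_power_pos)
    then show "\<exists>y. (G has_real_derivative y) (at x) \<and> 0 < y" using dG by blast
  next
    show "continuous_on {d..\<bar>w r\<bar>} G"
      by (rule DERIV_continuous_on[of _ _ "\<lambda>x. odd_power p x - x"])
         (rule has_field_derivative_at_within[OF dG])
  qed
  moreover have "G \<bar>w r\<bar> = G (w r)" by (cases "w r \<ge> 0") (auto simp: G_def)
  moreover have "energy 1 w w1 r \<le> energy 1 w w1 0" using r by (intro energy_antimono[OF s]) auto
  then have "(w1 r)\<^sup>2 / 2 + \<mu> * G (w r) \<le> \<mu> * G d"
    by (simp add: energy_def G_def solvesD(3)[OF s] d)
  then have "\<mu> * G (w r) \<le> \<mu> * G d" using zero_le_power2[of "w1 r"] by linarith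
  then have "G (w r) \<le> G d" using mu_pos by simp
  ultimately show False by simp
qed

text \<open>The nonlinearity is at most \<open>d powr p\<close>, so \<open>w' \<ge> - \<mu> d powr p r\<close> by the divergence form of the equation.\<close>

lemma solution_near_initial_value:
  assumes s: "solves 1 w w1 w2" and d: "w 0 = d" "d \<ge> 1" and r: "r \<in> {0..c}"
  shows "w r \<ge> d - \<mu> * d powr p * r\<^sup>2 / 2"
proof -
  define M where "M = \<mu> * d powr p"
  have M: "M \<ge> 0" using mu_pos by (simp add: M_def)
  have w1: "w1 r \<ge> - M * r" if r: "r \<in> {0<..c}" for r
  proof -
    have "\<rho> 0 * (w1 0 + M * 0) \<le> \<rho> r * (w1 r + M * r)"
    proof (rule mono_from_deriv[where f = "\<lambda>t. \<rho> t * (w1 t + M * t)" and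
          f' = "\<lambda>t. H t * \<rho> t * (w1 t + M * t) + (w2 t + M) * \<rho> t"])
      show "0 \<le> r" using r by simp
      show "continuous_on {0..r} (\<lambda>t. \<rho> t * (w1 t + M * t))"
        using r by (intro continuous_intros continuous_rho continuous_on_subset[OF solvesD(8)[OF s]]) auto
      fix t assume "0 < t" "t < r"
      then have t: "0 < t" "t < c" "t \<in> {0<..c}" "t \<in> {0..c}" "t \<in> {0<..<pi}" using r c_bounds by auto
      have "((\<lambda>t. w1 t + M * t) has_real_derivative w2 t + M) (at t)"
        by (auto intro!: derivative_eq_intros solvesD(6)[OF s t(1,2)])
      from DERIV_mult[OF rho_deriv[OF t(5)] this]
      show "((\<lambda>t. \<rho> t * (w1 t + M * t)) has_real_derivative H t * \<rho> t * (w1 t + M * t) + (w2 t + M) * \<rho> t) (at t)" .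
      have "\<bar>odd_power p (w t) - w t\<bar> \<le> d powr p"
        by (intro nonlinearity_bound p_gt_1 solution_le_initial_value[OF s d t(4)] d)
      then have "odd_power p (w t) - w t \<le> d powr p" by simp
      then have "\<mu> * (odd_power p (w t) - w t) \<le> M" unfolding M_def using mu_pos by (intro mult_left_mono) auto
      then have 1: "0 \<le> (M - \<mu> * (odd_power p (w t) - w t)) * \<rho> t" using rho_pos[OF t(5)] by simp
      have 2: "0 \<le> H t * \<rho> t * (M * t)" using H_nonneg[OF t(3)] rho_pos[OF t(5)] M t by simp
      have "H t * \<rho> t * (w1 t + M * t) + (w2 t + M) * \<rho> t
        = (M - \<mu> * (odd_power p (w t) - w t)) * \<rho> t + H t * \<rho> t * (M * t)"
        unfolding solvesD(4)[OF s t(3)] by (simp add: algebra_simps)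
      then show "0 \<le> H t * \<rho> t * (w1 t + M * t) + (w2 t + M) * \<rho> t" using 1 2 by linarith
    qed
    moreover have "\<rho> r > 0" using r c_bounds by (intro rho_pos) auto
    ultimately have "0 \<le> w1 r + M * r" by (simp add: zero_le_mult_iff)
    then show ?thesis by simp
  qed
  have "w 0 + M * 0\<^sup>2 / 2 \<le> w r + M * r\<^sup>2 / 2"
  proof (rule mono_from_deriv[where f = "\<lambda>t. w t + M * t\<^sup>2 / 2" and f' = "\<lambda>t. w1 t + M * t"])
    show "continuous_on {0..r} (\<lambda>t. w t + M * t\<^sup>2 / 2)"
      using r by (intro continuous_intros continuous_on_subset[OF solvesD(7)[OF s]]) auto
    fix t assume "0 < t" "t < r"
    then have t: "0 < t" "t < c" "t \<in> {0<..c}" using r by auto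
    show "((\<lambda>t. w t + M * t\<^sup>2 / 2) has_real_derivative w1 t + M * t) (at t)"
      by (auto intro!: derivative_eq_intros solvesD(5)[OF s t(1,2)])
    show "0 \<le> w1 t + M * t" using w1[OF t(3)] by simp
  qed (use r in auto)
  then show ?thesis using d by (simp add: M_def)
qed

text \<open>The constants for the Pohozaev identity.  At \<open>r = 0\<close> the conditions on \<open>\<beta>\<close> read
  \<open>(a - 1) / 2 < \<beta> < (a + 1) / (p + 1)\<close>, and \<open>p\<close> is subcritical exactly if this interval is nonempty.
  By continuity of \<open>rH\<close> they persist on a small interval.\<close>

lemma subcritical_multiplier:
  assumes sub: "p * (real a - 1) < real a + 3"
  shows "\<exists>\<delta> \<beta> \<gamma>. 0 < \<delta> \<and> \<delta> < c \<and> 0 < \<beta> \<and> 0 < \<gamma> \<and>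
     (\<forall>r\<in>{0..\<delta>}. (rH r - 1) / 2 \<le> \<beta> \<and> \<beta> + \<gamma> \<le> (1 + rH r) / (p + 1) \<and> rH r \<le> real a + 1)"
proof -
  \<comment> \<open>The length of the admissible interval; a third of it goes to \<open>\<beta>\<close>, one to \<open>\<gamma>\<close> and one to the error of \<open>rH\<close>.\<close>
  define m where "m = (real a + 1) / (p + 1) - (real a - 1) / 2"
  have m: "m > 0" using sub p_gt_1 by (simp add: m_def field_simps)
  define \<beta> where "\<beta> = (real a - 1) / 2 + m / 3"
  have \<beta>: "\<beta> > 0" using m a_pos by (simp add: \<beta>_def add_nonneg_pos)
  define \<epsilon> where "\<epsilon> = min 1 (m / 3)"
  have \<epsilon>: "\<epsilon> > 0" "\<epsilon> \<le> 1" "\<epsilon> \<le> m / 3" using m by (auto simp: \<epsilon>_def)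
  have "\<exists>\<delta>>0. \<forall>r\<in>{0..c}. dist r 0 < \<delta> \<longrightarrow> dist (rH r) (rH 0) < \<epsilon>"
    using continuous_rH[unfolded continuous_on_iff, rule_format, of 0 \<epsilon>] c_bounds \<epsilon>(1) by auto
  then obtain \<delta>0 where \<delta>0: "\<delta>0 > 0" "\<And>r. r \<in> {0..c} \<Longrightarrow> r < \<delta>0 \<Longrightarrow> \<bar>rH r - real a\<bar> < \<epsilon>"
    by (auto simp: dist_real_def rH_0)
  define \<delta> where "\<delta> = min \<delta>0 c / 2"
  have \<delta>: "0 < \<delta>" "\<delta> < c" "\<delta> < \<delta>0" using \<delta>0 c_bounds by (auto simp: \<delta>_def min_def)
  have "(rH r - 1) / 2 \<le> \<beta> \<and> \<beta> + m / 3 \<le> (1 + rH r) / (p + 1) \<and> rH r \<le> real a + 1" if r: "r \<in> {0..\<delta>}" for r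
  proof -
    have close: "\<bar>rH r - real a\<bar> < \<epsilon>" using r \<delta> by (intro \<delta>0) auto
    have "(rH r - 1) / 2 \<le> \<beta>" using close \<epsilon> by (simp add: \<beta>_def field_simps)
    moreover have "\<beta> + m / 3 \<le> (1 + rH r) / (p + 1)"
    proof -
      have "\<epsilon> / (p + 1) \<le> \<epsilon>" using \<epsilon> p_gt_1 by (simp add: field_simps)
      have "(real a + 1) / (p + 1) = m + (real a - 1) / 2" by (simp add: m_def)
      then have "\<beta> + m / 3 = (real a + 1) / (p + 1) - m / 3" by (simp add: \<beta>_def)
      also have "\<dots> \<le> (real a + 1) / (p + 1) - \<epsilon> / (p + 1)" using \<open>\<epsilon> / (p + 1) \<le> \<epsilon>\<close> \<epsilon> by linarith
      also have "\<dots> = (1 + (real a - \<epsilon>)) / (p + 1)" by (simp add: diff_divide_distrib[symmetric])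
      also have "\<dots> \<le> (1 + rH r) / (p + 1)" using close p_gt_1 by (intro divide_right_mono) auto
      finally show ?thesis .
    qed
    ultimately show ?thesis using close \<epsilon> by auto
  qed
  then show ?thesis using \<delta> \<beta> m
    by (intro exI[of _ \<delta>] exI[of _ \<beta>] exI[of _ "m / 3"]) auto
qed

lemma rho_lower_bound: "\<exists>\<kappa>>0. \<forall>r\<in>{0..c}. \<kappa> * r ^ a \<le> \<rho> r"
proof -
  define k where "k = (\<lambda>r. (sinc (r / 2) / 2) ^ a * cos (r / 2) ^ b)"
  have "continuous_on {0..c} k" unfolding k_def by (intro continuous_intros) auto
  then obtain x where x: "x \<in> {0..c}" "\<And>y. y \<in> {0..c} \<Longrightarrow> k x \<le> k y"
    using continuous_attains_inf[of "{0..c}" k] c_bounds by auto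
  have "k x > 0" unfolding k_def
    using x c_bounds by (intro mult_pos_pos zero_less_power divide_pos_pos sinc_pos cos_gt_zero_pi) auto
  moreover have "k x * r ^ a \<le> \<rho> r" if r: "r \<in> {0..c}" for r
  proof -
    have "k x * r ^ a \<le> k r * r ^ a" using x(2)[OF r] r by (intro mult_right_mono) auto
    also have "\<dots> = \<rho> r"
    proof (cases "r = 0")
      case True
      then show ?thesis using a_pos by simp
    next
      case False
      then show ?thesis by (simp add: k_def \<rho>_def sinc_def power_divide)
    qed
    finally show ?thesis .
  qed
  ultimately show ?thesis by blast
qed

text \<open>The identity for the multiplier \<open>r w' + \<beta> w\<close>.  The choice of \<open>\<beta>\<close> makes the coefficient of \<open>w'\<^sup>2\<close>
  nonnegative and keeps that of the superlinear term positive.\<close>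

lemma pohozaev_deriv:
  assumes s: "solves 1 w w1 w2" and t: "0 < t" "t < c"
  shows "((\<lambda>t. \<rho> t * (t * energy 1 w w1 t + \<beta> * (w t * w1 t))) has_real_derivative
     \<rho> t * ((w1 t)\<^sup>2 * ((1 - rH t) / 2 + \<beta>) +
        \<mu> * (w t * odd_power p (w t) * ((1 + rH t) / (p + 1) - \<beta>) - (w t)\<^sup>2 * ((1 + rH t) / 2 - \<beta>)))) (at t)"
proof -
  have t': "t \<in> {0<..c}" "t \<in> {0<..<pi}" using t c_bounds by auto
  let ?E = "energy 1 w w1"
  have inner: "((\<lambda>t. t * ?E t + \<beta> * (w t * w1 t)) has_real_derivative
      ?E t + t * (- H t * (w1 t)\<^sup>2) + \<beta> * ((w1 t)\<^sup>2 + w t * w2 t)) (at t)"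
    by (auto intro!: derivative_eq_intros energy_deriv[OF s t] solvesD(5,6)[OF s t] simp: power2_eq_square algebra_simps)
  have eq: "H t * \<rho> t * (t * ?E t + \<beta> * (w t * w1 t)) +
      (?E t + t * (- H t * (w1 t)\<^sup>2) + \<beta> * ((w1 t)\<^sup>2 + w t * w2 t)) * \<rho> t
     = \<rho> t * ((w1 t)\<^sup>2 * ((1 - rH t) / 2 + \<beta>) +
        \<mu> * (w t * odd_power p (w t) * ((1 + rH t) / (p + 1) - \<beta>) - (w t)\<^sup>2 * ((1 + rH t) / 2 - \<beta>)))"
  proof -
    have r: "rH t = t * H t" using t by (simp add: rH_eq)
    define S where "S = w t * odd_power p (w t)"
    have E: "?E t = (w1 t)\<^sup>2 / 2 + \<mu> * (S / (p + 1) - (w t)\<^sup>2 / 2)" by (simp add: energy_def S_def)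
    have w2: "w t * w2 t = - H t * (w t * w1 t) - \<mu> * (S - (w t)\<^sup>2)"
      unfolding solvesD(4)[OF s t'(1)] S_def by (simp add: power2_eq_square algebra_simps)
    define k where "k = 1 / (p + 1)"
    have Sk: "x / (p + 1) = x * k" for x by (simp add: k_def)
    show ?thesis unfolding S_def[symmetric] E w2 r Sk
      by (simp add: field_simps power2_eq_square)
  qed
  from DERIV_mult[OF rho_deriv[OF t'(2)] inner] show ?thesis unfolding eq .
qed

text \<open>Let \<open>P\<close> be the Pohozaev functional.  Its derivative is bounded below on \<open>[0, \<delta>]\<close>, and on \<open>[0, r1]\<close>, where
  \<open>w \<ge> d / 2\<close>, it is at least a multiple of \<open>t ^ a (d / 2) powr (p + 1)\<close>.  Hence \<open>P \<delta> \<ge> k d powr \<eta> - const\<close>.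
  At \<open>\<delta>\<close> the functional is controlled by the energy, and from \<open>\<delta>\<close> to \<open>c\<close>, where \<open>H\<close> is bounded, the energy
  loses at most a constant factor and an additive constant.\<close>

lemma energy_large:
  assumes sub: "p * (real a - 1) < real a + 3"
  shows "\<exists>D\<ge>1. \<forall>d\<ge>D. \<forall>w w1 w2. solves 1 w w1 w2 \<longrightarrow> w 0 = d \<longrightarrow> X \<le> energy 1 w w1 c"
proof -
  obtain \<delta> \<beta> \<gamma> where \<delta>: "0 < \<delta>" "\<delta> < c" and \<beta>: "0 < \<beta>" and \<gamma>: "0 < \<gamma>" and
    mult: "\<And>r. r \<in> {0..\<delta>} \<Longrightarrow> (rH r - 1) / 2 \<le> \<beta>"
      "\<And>r. r \<in> {0..\<delta>} \<Longrightarrow> \<beta> + \<gamma> \<le> (1 + rH r) / (p + 1)"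
      "\<And>r. r \<in> {0..\<delta>} \<Longrightarrow> rH r \<le> real a + 1"
    using subcritical_multiplier[OF sub] by blast
  obtain \<kappa> where \<kappa>: "\<kappa> > 0" "\<And>r. r \<in> {0..c} \<Longrightarrow> \<kappa> * r ^ a \<le> \<rho> r"
    using rho_lower_bound by blast
  obtain C2 where C2: "C2 \<ge> 0" "\<And>t. (real a + 2) / 2 * t\<^sup>2 \<le> \<gamma> / 2 * (t * odd_power p t) + C2"
    using odd_power_superquadratic[OF p_gt_1, of "\<gamma> / 2" "(real a + 2) / 2"] \<gamma> by auto
  obtain C3 where C3: "C3 \<ge> 0" "\<And>t. (1 + \<mu>) / 2 * t\<^sup>2 \<le> \<mu> / (p + 1) * (t * odd_power p t) + C3"
    using odd_power_superquadratic[OF p_gt_1, of "\<mu> / (p + 1)" "(1 + \<mu>) / 2"] mu_pos p_gt_1 by auto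
  obtain C where C: "C \<ge> 0" "\<And>r. r \<in> {\<delta>..c} \<Longrightarrow> H r \<le> C"
    using H_upper_bound[of \<delta>] \<delta> by auto
  define \<eta> where "\<eta> = p + 1 - (p - 1) * (real a + 1) / 2"
  have \<eta>: "\<eta> > 0" using sub by (simp add: \<eta>_def field_simps)
  define k where "k = \<kappa> * \<mu> * (\<gamma> / 4) * ((1 / 2) powr (p - 1) / 4) / (sqrt \<mu> ^ (a + 1) * (real a + 1))"
  have k: "k > 0" using \<kappa> mu_pos \<gamma> by (auto simp: k_def intro!: divide_pos_pos mult_pos_pos)
  define M where "M = (\<bar>X\<bar> + C3) * exp (2 * C * c)"
  have M: "M \<ge> 0" using C3 by (simp add: M_def)
  define M' where "M' = (\<delta> + \<beta>) * M + \<mu> * C2 * \<delta> + \<beta> * C3"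
  have M': "M' \<ge> \<mu> * C2 * \<delta>" using \<delta> \<beta> M C3 by (simp add: M'_def)
  obtain D1 where D1: "D1 \<ge> 1" "\<And>d. d \<ge> D1 \<Longrightarrow> M' / k \<le> d powr \<eta>"
    using powr_eventually_ge[OF \<eta>] by blast
  obtain D2 where D2: "D2 \<ge> 1" "\<And>d. d \<ge> D2 \<Longrightarrow> 1 / (\<delta> * sqrt \<mu>) \<le> d powr ((p - 1) / 2)"
    using powr_eventually_ge[of "(p - 1) / 2"] p_gt_1 by auto
  have main: "X \<le> energy 1 w w1 c"
    if d1: "d \<ge> D1" "d \<ge> D2" "d \<ge> 2" "d \<ge> 8 * C2 / \<gamma>" and s: "solves 1 w w1 w2" and w0: "w 0 = d" for d w w1 w2
  proof -
    have d_1: "d \<ge> 1" using d1 by simp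
    let ?E = "energy 1 w w1"
    let ?P = "\<lambda>t. \<rho> t * (t * ?E t + \<beta> * (w t * w1 t))"
    let ?P' = "\<lambda>t. \<rho> t * ((w1 t)\<^sup>2 * ((1 - rH t) / 2 + \<beta>) +
        \<mu> * (w t * odd_power p (w t) * ((1 + rH t) / (p + 1) - \<beta>) - (w t)\<^sup>2 * ((1 + rH t) / 2 - \<beta>)))"
    have contP: "continuous_on {x..y} ?P" if "0 \<le> x" "y \<le> c" for x y
      using that
      by (intro continuous_intros continuous_rho continuous_on_subset[OF continuous_energy[OF s]]
           continuous_on_subset[OF solvesD(7)[OF s]] continuous_on_subset[OF solvesD(8)[OF s]]) auto
    have P'_ge: "\<rho> t * (\<mu> * (\<gamma> / 2 * (w t * odd_power p (w t)) - C2)) \<le> ?P' t" if t: "0 < t" "t < \<delta>" for t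
    proof -
      have t': "t \<in> {0..\<delta>}" "t \<in> {0<..<pi}" using t \<delta> c_bounds by auto
      have "0 \<le> (w1 t)\<^sup>2 * ((1 - rH t) / 2 + \<beta>)"
      proof (rule mult_nonneg_nonneg)
        show "0 \<le> (1 - rH t) / 2 + \<beta>" using mult(1)[OF t'(1)] by (simp add: field_simps)
      qed simp
      moreover have "\<mu> * (\<gamma> / 2 * (w t * odd_power p (w t)) - C2)
        \<le> \<mu> * (w t * odd_power p (w t) * ((1 + rH t) / (p + 1) - \<beta>) - (w t)\<^sup>2 * ((1 + rH t) / 2 - \<beta>))"
      proof (rule mult_left_mono)
        have "w t * odd_power p (w t) * \<gamma> \<le> w t * odd_power p (w t) * ((1 + rH t) / (p + 1) - \<beta>)"
          using mult(2)[OF t'(1)] by (intro mult_left_mono odd_power_mult_self_nonneg) auto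
        moreover have "(w t)\<^sup>2 * ((1 + rH t) / 2 - \<beta>) \<le> (w t)\<^sup>2 * ((real a + 2) / 2)"
          using mult(3)[OF t'(1)] \<beta> by (intro mult_left_mono) (auto simp: field_simps)
        ultimately show "\<gamma> / 2 * (w t * odd_power p (w t)) - C2
          \<le> w t * odd_power p (w t) * ((1 + rH t) / (p + 1) - \<beta>) - (w t)\<^sup>2 * ((1 + rH t) / 2 - \<beta>)"
          using C2(2)[of "w t"] by (simp add: mult.commute)
      qed (use mu_pos in simp)
      ultimately show ?thesis using rho_pos[OF t'(2)] by (intro mult_left_mono) auto
    qed
    \<comment> \<open>The solution has lost at most half of its initial value when \<open>\<mu> d powr p r\<^sup>2 = d\<close>.\<close>
    define r1 where "r1 = d powr ((1 - p) / 2) / sqrt \<mu>"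
    have r1_0: "r1 > 0" using d1 mu_pos by (simp add: r1_def)
    have r1_sq: "\<mu> * d powr p * r1\<^sup>2 = d"
    proof -
      have "(d powr ((1 - p) / 2))\<^sup>2 = d powr (1 - p)" using d_1 by (simp add: powr_power diff_divide_distrib)
      then have "\<mu> * d powr p * r1\<^sup>2 = d powr p * d powr (1 - p)"
        using mu_pos by (simp add: r1_def power_divide)
      also have "\<dots> = d" using d_1 by (simp flip: powr_add)
      finally show ?thesis .
    qed
    have r1_\<delta>: "r1 \<le> \<delta>"
    proof -
      have "d powr ((1 - p) / 2) = inverse (d powr ((p - 1) / 2))"
        by (simp flip: powr_minus add: minus_divide_left)
      also have "\<dots> \<le> inverse (1 / (\<delta> * sqrt \<mu>))"
        using D2(2)[OF d1(2)] \<delta> mu_pos by (intro le_imp_inverse_le) auto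
      finally show ?thesis using mu_pos by (simp add: r1_def field_simps)
    qed
    define S where "S = (d / 2) powr (p - 1) * (d / 2)\<^sup>2"
    have S_le: "S \<le> w t * odd_power p (w t)" if t: "0 < t" "t < r1" for t
    proof -
      have "\<mu> * d powr p * t\<^sup>2 \<le> \<mu> * d powr p * r1\<^sup>2"
        using t mu_pos by (intro mult_left_mono power_mono) auto
      then have "w t \<ge> d / 2"
        using solution_near_initial_value[OF s w0 d_1, of t] t r1_\<delta> \<delta> unfolding r1_sq by simp
      then show ?thesis
        unfolding S_def odd_power_mult_self using d_1 p_gt_1 by (intro mult_mono powr_mono2 power_mono) auto
    qed
    have S_C2: "C2 \<le> \<gamma> / 4 * S"
    proof -
      have "1 \<le> (d / 2) powr (p - 1)" using d1 p_gt_1 by (simp add: ge_one_powr_ge_zero)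
      moreover have "d / 2 \<le> (d / 2)\<^sup>2" using d1 by (simp add: power2_eq_square)
      ultimately have "1 * (d / 2) \<le> S" unfolding S_def using d1 by (intro mult_mono) auto
      then have "\<gamma> / 4 * (d / 2) \<le> \<gamma> / 4 * S" using \<gamma> by (intro mult_left_mono) auto
      moreover have "C2 \<le> \<gamma> / 4 * (d / 2)" using d1(4) \<gamma> by (simp add: field_simps)
      ultimately show ?thesis by linarith
    qed
    define B where "B = \<mu> * (\<gamma> / 4 * S)"
    have B: "B \<ge> 0" using mu_pos \<gamma> by (simp add: B_def S_def)
    have "?P 0 - \<kappa> * B * (0 ^ (a + 1) / real (a + 1)) \<le> ?P r1 - \<kappa> * B * (r1 ^ (a + 1) / real (a + 1))"
    proof (rule mono_from_deriv[where f = "\<lambda>t. ?P t - \<kappa> * B * (t ^ (a + 1) / real (a + 1))" and f' = "\<lambda>t. ?P' t - \<kappa> * B * t ^ a"])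
      show "0 \<le> r1" using r1_0 by simp
      show "continuous_on {0..r1} (\<lambda>t. ?P t - \<kappa> * B * (t ^ (a + 1) / real (a + 1)))"
        using r1_\<delta> \<delta> by (intro continuous_on_diff contP) (auto intro!: continuous_intros)
      fix t assume t: "0 < t" "t < r1"
      have t': "0 < t" "t < c" "t < \<delta>" "t \<in> {0..c}" using t r1_\<delta> \<delta> by auto
      have "((\<lambda>t. t ^ (a + 1) / real (a + 1)) has_real_derivative t ^ a) (at t)"
        using DERIV_cdivide[OF DERIV_pow[of "Suc a" t UNIV], of "real (Suc a)"] by (simp del: of_nat_Suc power_Suc)
      then show "((\<lambda>t. ?P t - \<kappa> * B * (t ^ (a + 1) / real (a + 1))) has_real_derivative ?P' t - \<kappa> * B * t ^ a) (at t)"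
        by (intro DERIV_diff pohozaev_deriv[OF s t'(1,2)] DERIV_cmult)
      have "\<gamma> / 4 * S \<le> \<gamma> / 2 * (w t * odd_power p (w t)) - C2"
      proof -
        have "\<gamma> / 2 * S \<le> \<gamma> / 2 * (w t * odd_power p (w t))"
          using \<gamma> by (intro mult_left_mono S_le t) auto
        then show ?thesis using S_C2 by (simp add: mult.assoc)
      qed
      then have "B \<le> \<mu> * (\<gamma> / 2 * (w t * odd_power p (w t)) - C2)"
        unfolding B_def using mu_pos by (intro mult_left_mono) auto
      then have "\<kappa> * t ^ a * B \<le> \<rho> t * (\<mu> * (\<gamma> / 2 * (w t * odd_power p (w t)) - C2))"
        using \<kappa>(2)[OF t'(4)] B rho_pos[of t] t' c_bounds by (intro mult_mono) auto
      then show "0 \<le> ?P' t - \<kappa> * B * t ^ a" using P'_ge[OF t'(1,3)] by (simp add: mult_ac)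
    qed
    then have P_r1: "\<kappa> * B * (r1 ^ (a + 1) / (real a + 1)) \<le> ?P r1" by (simp add: add.commute)
    have growth: "\<kappa> * B * (r1 ^ (a + 1) / (real a + 1)) = k * d powr \<eta>"
    proof -
      have r1p: "r1 ^ (a + 1) = d powr ((real a + 1) * ((1 - p) / 2)) / sqrt \<mu> ^ (a + 1)"
        unfolding r1_def power_divide using d_1 by (subst powr_power) (auto simp: add.commute)
      have S: "S = (1 / 2) powr (p - 1) / 4 * d powr (p + 1)"
      proof -
        have "d powr (p - 1) * d\<^sup>2 = d powr (p + 1)"
          using d_1 by (simp add: powr_add[symmetric] add.commute flip: powr_numeral)
        then show ?thesis
          using d_1 by (simp add: S_def powr_divide power_divide)
      qed
      have e: "d powr (p + 1) * d powr ((real a + 1) * ((1 - p) / 2)) = d powr \<eta>"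
        unfolding powr_add[symmetric] \<eta>_def by (rule arg_cong[where f = "\<lambda>x. d powr x"]) (simp add: field_simps)
      have "\<kappa> * B * (r1 ^ (a + 1) / (real a + 1)) = k * (d powr (p + 1) * d powr ((real a + 1) * ((1 - p) / 2)))"
        unfolding B_def S r1p k_def by simp
      then show ?thesis unfolding e .
    qed
    have "?P r1 + \<mu> * C2 * r1 \<le> ?P \<delta> + \<mu> * C2 * \<delta>"
    proof (rule mono_from_deriv[where f = "\<lambda>t. ?P t + \<mu> * C2 * t" and f' = "\<lambda>t. ?P' t + \<mu> * C2"])
      show "r1 \<le> \<delta>" by (rule r1_\<delta>)
      show "continuous_on {r1..\<delta>} (\<lambda>t. ?P t + \<mu> * C2 * t)"
        using r1_0 \<delta> by (intro continuous_on_add contP) (auto intro!: continuous_intros)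
      fix t assume "r1 < t" "t < \<delta>"
      then have t: "0 < t" "t < c" "t < \<delta>" "t \<in> {0..pi}" "t \<in> {0<..<pi}" using r1_0 \<delta> c_bounds by auto
      have "((\<lambda>t. \<mu> * C2 * t) has_real_derivative \<mu> * C2) (at t)" by (auto intro!: derivative_eq_intros)
      then show "((\<lambda>t. ?P t + \<mu> * C2 * t) has_real_derivative ?P' t + \<mu> * C2) (at t)"
        by (intro DERIV_add pohozaev_deriv[OF s t(1,2)])
      have "\<rho> t * (\<mu> * C2) \<le> 1 * (\<mu> * C2)"
        using rho_le_1[OF t(4)] mu_pos C2 by (intro mult_right_mono) auto
      moreover have "0 \<le> \<rho> t * (\<mu> * (\<gamma> / 2 * (w t * odd_power p (w t))))"
        using rho_pos[OF t(5)] mu_pos \<gamma> odd_power_mult_self_nonneg[of "w t" p] by simp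
      ultimately have "- (\<mu> * C2) \<le> \<rho> t * (\<mu> * (\<gamma> / 2 * (w t * odd_power p (w t)) - C2))"
        by (simp add: right_diff_distrib)
      then show "0 \<le> ?P' t + \<mu> * C2" using P'_ge[OF t(1,3)] by linarith
    qed
    moreover have "0 \<le> \<mu> * C2 * r1" using mu_pos C2 r1_0 by simp
    ultimately have P_\<delta>: "k * d powr \<eta> - \<mu> * C2 * \<delta> \<le> ?P \<delta>" using P_r1 unfolding growth by linarith
    have big: "M' \<le> k * d powr \<eta>" using D1(2)[OF d1(1)] k by (simp add: field_simps)
    define z where "z = \<delta> * ?E \<delta> + \<beta> * (w \<delta> * w1 \<delta>)"
    have "?P \<delta> \<le> z"
    proof -
      have "0 \<le> \<rho> \<delta> * z" using P_\<delta> big M' by (simp add: z_def)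
      moreover have "\<rho> \<delta> > 0" "\<rho> \<delta> \<le> 1" using \<delta> c_bounds by (auto intro!: rho_pos rho_le_1)
      ultimately show ?thesis unfolding z_def[symmetric]
        by (simp add: zero_le_mult_iff mult_left_le_one_le)
    qed
    have E_C3: "(w1 t)\<^sup>2 / 2 + (w t)\<^sup>2 / 2 \<le> ?E t + C3" for t
    proof -
      have "?E t = (w1 t)\<^sup>2 / 2 + \<mu> / (p + 1) * (w t * odd_power p (w t)) - \<mu> * (w t)\<^sup>2 / 2"
        by (simp add: energy_def right_diff_distrib)
      moreover have "(1 + \<mu>) / 2 * (w t)\<^sup>2 = (w t)\<^sup>2 / 2 + \<mu> * (w t)\<^sup>2 / 2"
        by (simp add: distrib_right add_divide_distrib)
      ultimately show ?thesis using C3(2)[of "w t"] by linarith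
    qed
    have "w \<delta> * w1 \<delta> \<le> (w1 \<delta>)\<^sup>2 / 2 + (w \<delta>)\<^sup>2 / 2"
      using zero_le_power2[of "w \<delta> - w1 \<delta>"] by (simp add: power2_diff)
    then have "w \<delta> * w1 \<delta> \<le> ?E \<delta> + C3" using E_C3[of \<delta>] by linarith
    then have "\<beta> * (w \<delta> * w1 \<delta>) \<le> \<beta> * (?E \<delta> + C3)" using \<beta> by simp
    then have "z \<le> (\<delta> + \<beta>) * ?E \<delta> + \<beta> * C3" by (simp add: z_def algebra_simps)
    then have "(\<delta> + \<beta>) * M \<le> (\<delta> + \<beta>) * ?E \<delta>"
      using P_\<delta> \<open>?P \<delta> \<le> z\<close> big unfolding M'_def by linarith
    then have E_\<delta>: "M \<le> ?E \<delta>" using \<delta> \<beta> by (simp add: mult_le_cancel_left)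
    have "(?E \<delta> + C3) * exp (2 * C * \<delta>) \<le> (?E c + C3) * exp (2 * C * c)"
    proof (rule mono_from_deriv[where f = "\<lambda>t. (?E t + C3) * exp (2 * C * t)" and
          f' = "\<lambda>t. (- H t * (w1 t)\<^sup>2 + 2 * C * (?E t + C3)) * exp (2 * C * t)"])
      show "continuous_on {\<delta>..c} (\<lambda>t. (?E t + C3) * exp (2 * C * t))"
        using \<delta> by (intro continuous_intros continuous_on_subset[OF continuous_energy[OF s]]) auto
      fix t assume "\<delta> < t" "t < c"
      then have t: "0 < t" "t < c" "t \<in> {\<delta>..c}" using \<delta> by auto
      show "((\<lambda>t. (?E t + C3) * exp (2 * C * t)) has_real_derivative
          (- H t * (w1 t)\<^sup>2 + 2 * C * (?E t + C3)) * exp (2 * C * t)) (at t)"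
        by (auto intro!: derivative_eq_intros energy_deriv[OF s t(1,2)] simp: algebra_simps)
      have "H t * (w1 t)\<^sup>2 \<le> C * (w1 t)\<^sup>2" using C(2)[OF t(3)] by (intro mult_right_mono) auto
      also have "\<dots> \<le> C * (2 * (?E t + C3))"
      proof (rule mult_left_mono[OF _ C(1)])
        have "(w1 t)\<^sup>2 / 2 \<le> ?E t + C3" by (rule order_trans[OF _ E_C3]) simp
        then show "(w1 t)\<^sup>2 \<le> 2 * (?E t + C3)" by (simp only: pos_divide_le_eq[OF zero_less_numeral] mult.commute)
      qed
      finally have "0 \<le> - H t * (w1 t)\<^sup>2 + 2 * C * (?E t + C3)" by (simp add: algebra_simps)
      then show "0 \<le> (- H t * (w1 t)\<^sup>2 + 2 * C * (?E t + C3)) * exp (2 * C * t)"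
        by (rule mult_nonneg_nonneg) simp
    qed (use \<delta> in simp)
    moreover have "M \<le> (?E \<delta> + C3) * exp (2 * C * \<delta>)"
    proof -
      have "(?E \<delta> + C3) * 1 \<le> (?E \<delta> + C3) * exp (2 * C * \<delta>)"
        using E_\<delta> M C3 C \<delta> by (intro mult_left_mono) auto
      then show ?thesis using E_\<delta> C3 by simp
    qed
    ultimately have "(\<bar>X\<bar> + C3) * exp (2 * C * c) \<le> (?E c + C3) * exp (2 * C * c)" unfolding M_def by linarith
    then show ?thesis by simp
  qed
  show ?thesis
    using D1(1) main by (intro exI[of _ "max (max D1 D2) (max 2 (8 * C2 / \<gamma>))"]) auto
qed

text \<open>On \<open>[c / 2, c]\<close> the coefficient \<open>H\<close> is bounded, so once the energy exceeds a constant depending on \<open>A\<close> the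
  angle decreases there with speed at least \<open>A / 4\<close>.\<close>

lemma angle_large:
  assumes sub: "p * (real a - 1) < real a + 3" and A: "A > 0"
  shows "\<exists>D\<ge>1. \<forall>d\<ge>D. \<forall>w w1 w2. solves 1 w w1 w2 \<longrightarrow> w 0 = d \<longrightarrow>
    angle A w w1 w2 c \<le> pi / 2 - A * c / 8"
proof -
  obtain C where C: "C \<ge> 0" "\<And>r. r \<in> {c / 2..c} \<Longrightarrow> H r \<le> C"
    using H_upper_bound[of "c / 2"] c_bounds by auto
  define B where "B = \<mu> + C\<^sup>2 + A\<^sup>2 / 4"
  obtain C4 where C4: "C4 \<ge> 0" "\<And>t. B * t\<^sup>2 \<le> \<mu> * p / (p + 1) * (t * odd_power p t) + C4"
    using odd_power_superquadratic[OF p_gt_1, of "\<mu> * p / (p + 1)" B] mu_pos p_gt_1 by (auto simp: B_def)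
  obtain D where D: "D \<ge> 1"
    "\<And>d w w1 w2. d \<ge> D \<Longrightarrow> solves 1 w w1 w2 \<Longrightarrow> w 0 = d \<Longrightarrow> C4 \<le> energy 1 w w1 c"
    using energy_large[OF sub, of C4] by blast
  have "angle A w w1 w2 c \<le> pi / 2 - A * c / 8" if d: "d \<ge> D" and s: "solves 1 w w1 w2" and w0: "w 0 = d" for d w w1 w2
  proof -
    let ?\<theta> = "angle A w w1 w2"
    have w0': "w 0 > 0" using D d w0 by simp
    have q: "(0::real) \<le> 1" by simp
    have "?\<theta> c + A / 4 * c \<le> ?\<theta> (c / 2) + A / 4 * (c / 2)"
    proof (rule antimono_from_deriv[where f = "\<lambda>t. ?\<theta> t + A / 4 * t" and
        f' = "\<lambda>t. (A * w t * w2 t - w1 t * (A * w1 t)) / ((A * w t)\<^sup>2 + (w1 t)\<^sup>2) + A / 4"])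
      show "c / 2 \<le> c" using c_bounds by simp
      show "continuous_on {c / 2..c} (\<lambda>t. ?\<theta> t + A / 4 * t)"
        using c_bounds by (intro continuous_intros continuous_on_subset[OF continuous_angle[OF s q w0' A]]) auto
      fix t assume "c / 2 < t" "t < c"
      then have t: "0 < t" "t < c" "t \<in> {0..c}" "t \<in> {0<..c}" "t \<in> {c / 2..c}" using c_bounds by auto
      have "(?\<theta> has_real_derivative (A * w t * w2 t - w1 t * (A * w1 t)) / ((A * w t)\<^sup>2 + (w1 t)\<^sup>2)) (at t)"
        using derivative_within_at_Icc[OF polar_solution(1)[OF s q w0' A t(3)] t(1,2)] .
      moreover have "((\<lambda>t. A / 4 * t) has_real_derivative A / 4) (at t)" by (auto intro!: derivative_eq_intros)
      ultimately show "((\<lambda>t. ?\<theta> t + A / 4 * t) has_real_derivative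
          (A * w t * w2 t - w1 t * (A * w1 t)) / ((A * w t)\<^sup>2 + (w1 t)\<^sup>2) + A / 4) (at t)"
        by (rule DERIV_add)
      define S where "S = w t * odd_power p (w t)"
      have E: "C4 \<le> (w1 t)\<^sup>2 / 2 + \<mu> * (S / (p + 1) - (w t)\<^sup>2 / 2)"
        using D(2)[OF d s w0] energy_antimono[OF s, of t c] t by (simp add: energy_def S_def)
      have num: "A * w t * w2 t - w1 t * (A * w1 t)
          = - A * ((w1 t)\<^sup>2 + H t * (w t * w1 t) + \<mu> * (S - (w t)\<^sup>2))"
        unfolding solvesD(4)[OF s t(4)] S_def by (simp add: power2_eq_square algebra_simps)
      have "- ((w1 t)\<^sup>2 / 4 + (H t)\<^sup>2 * (w t)\<^sup>2) \<le> H t * (w t * w1 t)"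
        using zero_le_power2[of "w1 t / 2 + H t * w t"] by (simp add: power2_eq_square algebra_simps)
      moreover have "(H t)\<^sup>2 * (w t)\<^sup>2 \<le> C\<^sup>2 * (w t)\<^sup>2"
        using C(2)[OF t(5)] H_nonneg[OF t(4)] by (intro mult_right_mono power_mono) auto
      moreover have "\<mu> * p / (p + 1) * S + \<mu> * (S / (p + 1)) = \<mu> * S"
      proof -
        have "p / (p + 1) + 1 / (p + 1) = 1" using p_gt_1 by (simp flip: add_divide_distrib)
        then have "\<mu> * S * (p / (p + 1) + 1 / (p + 1)) = \<mu> * S" by simp
        then show ?thesis by (simp add: distrib_left mult_ac)
      qed
      moreover have "B * (w t)\<^sup>2 = \<mu> * (w t)\<^sup>2 + C\<^sup>2 * (w t)\<^sup>2 + (A * w t)\<^sup>2 / 4"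
        by (simp add: B_def power_mult_distrib algebra_simps)
      moreover have "0 \<le> \<mu> * (w t)\<^sup>2" using mu_pos by simp
      ultimately have "((A * w t)\<^sup>2 + (w1 t)\<^sup>2) / 4 \<le> (w1 t)\<^sup>2 + H t * (w t * w1 t) + \<mu> * (S - (w t)\<^sup>2)"
        using E C4(2)[of "w t", folded S_def] by (simp add: right_diff_distrib)
      then have "A * (((A * w t)\<^sup>2 + (w1 t)\<^sup>2) / 4) \<le> A * ((w1 t)\<^sup>2 + H t * (w t * w1 t) + \<mu> * (S - (w t)\<^sup>2))"
        using A by (intro mult_left_mono) auto
      then have "A * w t * w2 t - w1 t * (A * w1 t) \<le> - (A / 4) * ((A * w t)\<^sup>2 + (w1 t)\<^sup>2)"
        unfolding num by simp
      moreover have "(A * w t)\<^sup>2 + (w1 t)\<^sup>2 > 0"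
        using polar_solution(4)[OF s q w0' A t(3)] by (simp add: radius_def)
      ultimately have "(A * w t * w2 t - w1 t * (A * w1 t)) / ((A * w t)\<^sup>2 + (w1 t)\<^sup>2) \<le> - (A / 4)"
        by (simp add: pos_divide_le_eq)
      then show "(A * w t * w2 t - w1 t * (A * w1 t)) / ((A * w t)\<^sup>2 + (w1 t)\<^sup>2) + A / 4 \<le> 0" by simp
    qed
    moreover have "?\<theta> (c / 2) < pi / 2" using c_bounds by (intro angle_less[OF s q w0' A]) auto
    ultimately show ?thesis by simp
  qed
  then show ?thesis using D(1) by blast
qed

end

section \<open>Zeros and critical points forced by the phase angle\<close>

context half_problem
begin

text \<open>Zeros of \<open>w\<close> are found where the angle is an odd multiple of \<open>- \<pi> / 2\<close>, critical points where it is a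
  multiple of \<open>- \<pi>\<close>.  A critical point at a rest point of the equation would force \<open>w\<close> to start at that
  rest point, hence with negative energy; but the energy is nonnegative at a zero of \<open>w\<close>.\<close>

lemma oscillation_from_angle:
  fixes k :: nat
  assumes s: "solves 1 w w1 w2" and w0: "w 0 > 0" and A: "A > 0"
    and ang: "angle A w w1 w2 c \<le> - (real (k + 1) * pi)"
  shows "\<exists>Z\<subseteq>{0<..c}. finite Z \<and> card Z = k \<and> (\<forall>r\<in>Z. w r = 0 \<and> w1 r \<noteq> 0)"
    "\<exists>Z\<subseteq>{0<..c}. finite Z \<and> card Z = k + 1 \<and> (\<forall>r\<in>Z. w1 r = 0 \<and> odd_power p (w r) - w r \<noteq> 0)"
    "\<exists>r\<in>{0<..c}. w r < 0"
proof -
  let ?\<theta> = "angle A w w1 w2"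
  have q: "(0::real) \<le> 1" by simp
  have att: "\<exists>r\<in>{0<..c}. ?\<theta> r = - (x * pi)" if "0 < x" "x \<le> real (k + 1)" for x
  proof (rule angle_attains[OF s q w0 A])
    have "x * pi \<le> real (k + 1) * pi" using that by (intro mult_right_mono) auto
    then show "?\<theta> c \<le> - (x * pi)" using ang by linarith
    show "- (x * pi) < 0" using that by simp
  qed
  have polar: "A * w r = radius A w w1 r * cos (?\<theta> r)" "w1 r = radius A w w1 r * sin (?\<theta> r)" "radius A w w1 r > 0"
    if "r \<in> {0<..c}" for r
    using polar_solution(2,3,4)[OF s q w0 A, of r] that by auto
  have family: "\<exists>Z\<subseteq>{0<..c}. finite Z \<and> card Z = m \<and> (\<forall>r\<in>Z. \<exists>j::nat. ?\<theta> r = - ((real j + x) * pi))"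
    if "0 < x" "real m - 1 + x \<le> real (k + 1)" for m :: nat and x
  proof -
    have "\<exists>z. \<forall>j\<in>{..<m}. z j \<in> {0<..c} \<and> ?\<theta> (z j) = - ((real j + x) * pi)"
    proof (rule bchoice, rule ballI)
      fix j assume "j \<in> {..<m}"
      then have "\<exists>r\<in>{0<..c}. ?\<theta> r = - ((real j + x) * pi)" using that by (intro att) auto
      then show "\<exists>r. r \<in> {0<..c} \<and> ?\<theta> r = - ((real j + x) * pi)" by blast
    qed
    then obtain z where z: "\<And>j. j < m \<Longrightarrow> z j \<in> {0<..c}" "\<And>j. j < m \<Longrightarrow> ?\<theta> (z j) = - ((real j + x) * pi)"
      by blast
    have "inj_on z {..<m}"
    proof (rule inj_onI)
      fix i j assume ij: "i \<in> {..<m}" "j \<in> {..<m}" and eq: "z i = z j"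
      have "- ((real i + x) * pi) = ?\<theta> (z i)" using ij by (intro z(2)[symmetric]) simp
      also have "\<dots> = - ((real j + x) * pi)" unfolding eq using ij by (intro z(2)) simp
      finally show "i = j" by simp
    qed
    then show ?thesis using z by (intro exI[of _ "z ` {..<m}"]) (auto simp: card_image)
  qed
  have cos_half: "cos (- ((real j + 1 / 2) * pi)) = 0" "sin (- ((real j + 1 / 2) * pi)) \<noteq> 0" for j :: nat
  proof -
    have "(real j + 1 / 2) * pi = real j * pi + pi / 2" by (simp add: algebra_simps)
    then show "cos (- ((real j + 1 / 2) * pi)) = 0" "sin (- ((real j + 1 / 2) * pi)) \<noteq> 0"
      by (simp_all add: cos_diff sin_diff)
  qed
  have zero: "w r = 0" "w1 r \<noteq> 0" if "r \<in> {0<..c}" "?\<theta> r = - ((real j + 1 / 2) * pi)" for r and j :: nat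
  proof -
    have "A * w r = 0" using polar(1)[OF that(1)] cos_half(1)[of j] unfolding that(2) by simp
    then show "w r = 0" using A by simp
    show "w1 r \<noteq> 0" using polar(2,3)[OF that(1)] cos_half(2)[of j] unfolding that(2) by simp
  qed
  show "\<exists>Z\<subseteq>{0<..c}. finite Z \<and> card Z = k \<and> (\<forall>r\<in>Z. w r = 0 \<and> w1 r \<noteq> 0)"
  proof -
    obtain Z where "Z \<subseteq> {0<..c}" "finite Z" "card Z = k" "\<forall>r\<in>Z. \<exists>j::nat. ?\<theta> r = - ((real j + 1 / 2) * pi)"
      using family[of "1 / 2" k] by auto
    then show ?thesis using zero by (intro exI[of _ Z]) blast
  qed
  obtain rz where rz: "rz \<in> {0<..c}" "w rz = 0"
    using att[of "1 / 2"] zero(1)[of _ 0] by auto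
  have crit: "w1 r = 0 \<and> odd_power p (w r) - w r \<noteq> 0" if r: "r \<in> {0<..c}" "?\<theta> r = - ((real j + 1) * pi)" for r and j :: nat
  proof -
    have "sin ((real j + 1) * pi) = 0" by (metis of_nat_Suc add.commute sin_npi)
    then have w1: "w1 r = 0" using polar(2)[OF r(1)] unfolding r(2) by simp
    then have nz: "w r \<noteq> 0" using solution_curve_nonzero[OF s q, of r] w0 r(1) by auto
    have "odd_power p (w r) - w r \<noteq> 0"
    proof
      assume eq: "odd_power p (w r) - w r = 0"
      then have "w 0 = w r" by (intro rest_point_backward[OF s q _ r(1) refl w1]) simp
      then have "energy 1 w w1 0 = \<mu> * ((w r)\<^sup>2 * (1 / (p + 1) - 1 / 2))"
        using eq by (simp add: energy_def solvesD(3)[OF s] power2_eq_square algebra_simps)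
      moreover have "(w r)\<^sup>2 * (1 / (p + 1) - 1 / 2) < 0"
        using nz p_gt_1 by (intro mult_pos_neg) (auto simp: field_simps)
      ultimately have "energy 1 w w1 0 < 0" using mu_pos by (simp add: mult_pos_neg)
      moreover have "energy 1 w w1 rz \<le> energy 1 w w1 0" using rz by (intro energy_antimono[OF s]) auto
      moreover have "energy 1 w w1 rz \<ge> 0" by (simp add: energy_def rz)
      ultimately show False by simp
    qed
    then show ?thesis using w1 by simp
  qed
  show "\<exists>Z\<subseteq>{0<..c}. finite Z \<and> card Z = k + 1 \<and> (\<forall>r\<in>Z. w1 r = 0 \<and> odd_power p (w r) - w r \<noteq> 0)"
  proof -
    obtain Z where "Z \<subseteq> {0<..c}" "finite Z" "card Z = k + 1" "\<forall>r\<in>Z. \<exists>j::nat. ?\<theta> r = - ((real j + 1) * pi)"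
      using family[of 1 "k + 1"] by auto
    then show ?thesis using crit by (intro exI[of _ Z]) blast
  qed
  obtain r where r: "r \<in> {0<..c}" "?\<theta> r = - (1 * pi)" using att[of 1] by auto
  then have "A * w r < 0" using polar(1,3)[OF r(1)] by simp
  then show "\<exists>r\<in>{0<..c}. w r < 0" using r A by (auto simp: mult_less_0_iff)
qed

end

section \<open>Shooting from both poles\<close>

text \<open>A fixed point of the clamped map \<open>z \<mapsto> z + (X - Y, X + Y)\<close> is a common zero.  If a clamp were active,
  the corresponding combination of \<open>X\<close> and \<open>Y\<close> would push outward there, and the signs on the boundary
  exclude this on every side and at the corner.\<close>

lemma common_zero_on_rectangle:
  fixes X Y :: "real \<times> real \<Rightarrow> real"
  assumes D: "D > 0" "D' > 0"
    and cont: "continuous_on ({0..D} \<times> {0..D'}) X" "continuous_on ({0..D} \<times> {0..D'}) Y"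
    and left: "\<And>e. e \<in> {0..D'} \<Longrightarrow> Y (0, e) \<le> 0"
    and bottom: "\<And>d. d \<in> {0..D} \<Longrightarrow> Y (d, 0) \<ge> 0"
    and corner: "X (0, 0) > 0"
    and right: "\<And>e. e \<in> {0..D'} \<Longrightarrow> X (D, e) < 0"
    and top: "\<And>d. d \<in> {0..D} \<Longrightarrow> X (d, D') < 0"
  shows "\<exists>d\<in>{0..D}. \<exists>e\<in>{0..D'}. X (d, e) = 0 \<and> Y (d, e) = 0"
proof -
  let ?S = "{0..D} \<times> {0..D'}"
  define f where "f = (\<lambda>z. (max 0 (min D (fst z + (X z - Y z))), max 0 (min D' (snd z + (X z + Y z)))))"
  have "compact ?S" "convex ?S" "?S \<noteq> {}"
    using D by (auto intro!: compact_Times convex_Times)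
  moreover have "continuous_on ?S f" unfolding f_def by (intro continuous_intros cont)
  moreover have "f \<in> ?S \<rightarrow> ?S" using D by (auto simp: f_def)
  ultimately obtain z where z: "z \<in> ?S" "f z = z" using brouwer[of ?S f] by metis
  obtain d e where de: "z = (d, e)" by force
  have d: "d \<in> {0..D}" and e: "e \<in> {0..D'}" using z de by auto
  have fd: "max 0 (min D (d + (X z - Y z))) = d" and fe: "max 0 (min D' (e + (X z + Y z))) = e"
    using z(2) by (auto simp: f_def de)
  have dD: "d \<noteq> D"
  proof
    assume eq: "d = D"
    have "X z < 0" using right[OF e] by (simp add: de eq)
    moreover have "X z - Y z \<ge> 0" using fd eq D by (auto simp: max_def min_def split: if_splits)
    ultimately have "X z + Y z < 0" by simp
    then have "e = 0" using fe e by (auto simp: max_def min_def split: if_splits)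
    then show False using bottom[OF d] \<open>X z < 0\<close> \<open>X z - Y z \<ge> 0\<close> by (simp add: de)
  qed
  have eD: "e \<noteq> D'"
  proof
    assume eq: "e = D'"
    have "X z < 0" using top[OF d] by (simp add: de eq)
    moreover have "X z + Y z \<ge> 0" using fe eq D by (auto simp: max_def min_def split: if_splits)
    ultimately have "X z - Y z < 0" by simp
    then have "d = 0" using fd d by (auto simp: max_def min_def split: if_splits)
    then show False using left[OF e] \<open>X z < 0\<close> \<open>X z + Y z \<ge> 0\<close> by (simp add: de)
  qed
  have V1: "X z - Y z \<le> 0" "d \<noteq> 0 \<Longrightarrow> X z - Y z = 0"
    using fd d dD by (auto simp: max_def min_def split: if_splits)
  have V2: "X z + Y z \<le> 0" "e \<noteq> 0 \<Longrightarrow> X z + Y z = 0"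
    using fe e eD by (auto simp: max_def min_def split: if_splits)
  have "X z = 0 \<and> Y z = 0"
  proof (cases "d = 0"; cases "e = 0")
    assume "d = 0" "e = 0"
    then show ?thesis using corner V1 V2 by (auto simp: de)
  next
    assume "d = 0" "e \<noteq> 0"
    then show ?thesis using left[OF e] V1 V2 by (auto simp: de)
  next
    assume "d \<noteq> 0" "e = 0"
    then show ?thesis using bottom[OF d] V1 V2 by (auto simp: de)
  next
    assume "d \<noteq> 0" "e \<noteq> 0"
    then show ?thesis using V1 V2 by auto
  qed
  then show ?thesis using d e de by blast
qed

context half_problem
begin

lemma solves_scale:
  assumes s: "solves (d powr (p - 1)) u u1 u2" and d: "d > 0"
  shows "solves 1 (\<lambda>r. d * u r) (\<lambda>r. d * u1 r) (\<lambda>r. d * u2 r)"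
    "angle A (\<lambda>r. d * u r) (\<lambda>r. d * u1 r) (\<lambda>r. d * u2 r) = angle A u u1 u2"
    "radius A (\<lambda>r. d * u r) (\<lambda>r. d * u1 r) r = d * radius A u u1 r"
proof -
  have "d * u2 r = - H r * (d * u1 r) - \<mu> * (1 * odd_power p (d * u r) - d * u r)" if "r \<in> {0<..c}" for r
    unfolding solvesD(4)[OF s that] using d by (simp add: odd_power_scale algebra_simps)
  then show "solves 1 (\<lambda>r. d * u r) (\<lambda>r. d * u1 r) (\<lambda>r. d * u2 r)"
    unfolding solves_def C2_with_derivs_def using solvesD(1,2,3,9)[OF s]
    by (auto intro!: DERIV_cmult continuous_intros)
  have "(A * (d * u t) * (d * u2 t) - d * u1 t * (A * (d * u1 t))) / ((A * (d * u t))\<^sup>2 + (d * u1 t)\<^sup>2)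
     = (A * u t * u2 t - u1 t * (A * u1 t)) / ((A * u t)\<^sup>2 + (u1 t)\<^sup>2)" for t
  proof -
    have "A * (d * u t) * (d * u2 t) - d * u1 t * (A * (d * u1 t)) = d\<^sup>2 * (A * u t * u2 t - u1 t * (A * u1 t))"
      "(A * (d * u t))\<^sup>2 + (d * u1 t)\<^sup>2 = d\<^sup>2 * ((A * u t)\<^sup>2 + (u1 t)\<^sup>2)"
      by (simp_all add: power2_eq_square algebra_simps)
    then show ?thesis using d by simp
  qed
  then show "angle A (\<lambda>r. d * u r) (\<lambda>r. d * u1 r) (\<lambda>r. d * u2 r) = angle A u u1 u2"
    by (simp add: angle_def fun_eq_iff)
  have "(A * (d * u r))\<^sup>2 + (d * u1 r)\<^sup>2 = d\<^sup>2 * ((A * u r)\<^sup>2 + (u1 r)\<^sup>2)"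
    by (simp add: power2_eq_square algebra_simps)
  then show "radius A (\<lambda>r. d * u r) (\<lambda>r. d * u1 r) r = d * radius A u u1 r"
    using d by (simp add: radius_def real_sqrt_mult)
qed

text \<open>Scaling leaves the angle unchanged, so the normalised family inherits its bound at \<open>D\<close> from the
  large solutions \<open>D u\<close>, while the bound at \<open>0\<close> comes from the linear equation.\<close>

lemma shooting_curve:
  assumes sub: "p * (real a - 1) < real a + 3" and A: "A > 0"
  shows "\<exists>D>0. \<exists>u u1 u2. (\<forall>d\<in>{0..D}. solves (d powr (p - 1)) (u d) (u1 d) (u2 d) \<and> u d 0 = 1) \<and>
    continuous_on {0..D} (\<lambda>d. angle A (u d) (u1 d) (u2 d) c) \<and>
    continuous_on {0..D} (\<lambda>d. radius A (u d) (u1 d) c) \<and>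
    angle A (u 0) (u1 0) (u2 0) c > - (pi / 2) \<and>
    angle A (u D) (u1 D) (u2 D) c \<le> pi / 2 - A * c / 8"
proof -
  obtain D where D: "D \<ge> 1"
    "\<And>d w w1 w2. d \<ge> D \<Longrightarrow> solves 1 w w1 w2 \<Longrightarrow> w 0 = d \<Longrightarrow> angle A w w1 w2 c \<le> pi / 2 - A * c / 8"
    using angle_large[OF sub A] by blast
  obtain u u1 u2 where cont: "continuous_on ({0..c} \<times> {0..D}) (\<lambda>(r, d). u r d)"
    "continuous_on ({0..c} \<times> {0..D}) (\<lambda>(r, d). u1 r d)"
    "continuous_on ({0..c} \<times> {0..D}) (\<lambda>(r, d). u2 r d)"
    and fam: "\<forall>d\<in>{0..D}. u 0 d = 1 \<and> u1 0 d = 0 \<and>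
      (\<forall>r\<in>{0..c}. ((\<lambda>r. u r d) has_real_derivative u1 r d) (at r within {0..c})) \<and>
      (\<forall>r\<in>{0..c}. ((\<lambda>r. u1 r d) has_real_derivative u2 r d) (at r within {0..c})) \<and>
      (\<forall>r\<in>{0<..c}. u2 r d = - H r * u1 r d - \<mu> * (d powr (p - 1) * odd_power p (u r d) - u r d))"
  proof -
    have "D \<ge> 0" using D(1) by simp
    from shooting_family[OF this] show ?thesis by (elim exE conjE) (rule that)
  qed
  have u: "\<And>d. d \<in> {0..D} \<Longrightarrow> u 0 d = 1" "\<And>d. d \<in> {0..D} \<Longrightarrow> u1 0 d = 0"
      "\<And>d r. d \<in> {0..D} \<Longrightarrow> r \<in> {0..c} \<Longrightarrow> ((\<lambda>r. u r d) has_real_derivative u1 r d) (at r within {0..c})"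
      "\<And>d r. d \<in> {0..D} \<Longrightarrow> r \<in> {0..c} \<Longrightarrow> ((\<lambda>r. u1 r d) has_real_derivative u2 r d) (at r within {0..c})"
      "\<And>d r. d \<in> {0..D} \<Longrightarrow> r \<in> {0<..c} \<Longrightarrow> u2 r d = - H r * u1 r d - \<mu> * (d powr (p - 1) * odd_power p (u r d) - u r d)"
    using fam by blast+
  have cs: "continuous_on S (\<lambda>x. u (f x) (g x))" "continuous_on S (\<lambda>x. u1 (f x) (g x))" "continuous_on S (\<lambda>x. u2 (f x) (g x))"
    if "continuous_on S f" "continuous_on S g" "\<And>x. x \<in> S \<Longrightarrow> f x \<in> {0..c}" "\<And>x. x \<in> S \<Longrightarrow> g x \<in> {0..D}"
    for S :: "'s::topological_space set" and f g
    using continuous_on_compose2[OF cont(1) continuous_on_Pair[OF that(1,2)]]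
      continuous_on_compose2[OF cont(2) continuous_on_Pair[OF that(1,2)]]
      continuous_on_compose2[OF cont(3) continuous_on_Pair[OF that(1,2)]] that(3,4)
    by (auto simp: image_subset_iff)
  let ?u = "\<lambda>d r. u r d" and ?u1 = "\<lambda>d r. u1 r d" and ?u2 = "\<lambda>d r. u2 r d"
  have sol: "solves (d powr (p - 1)) (?u d) (?u1 d) (?u2 d)" if "d \<in> {0..D}" for d
    unfolding solves_def C2_with_derivs_def using u that by (auto intro!: cs(3) continuous_intros)
  have pos: "(A * u r d)\<^sup>2 + (u1 r d)\<^sup>2 > 0" if "d \<in> {0..D}" "r \<in> {0..c}" for d r
    using polar_solution(4)[OF sol[OF that(1)] _ _ A that(2)] u(1)[OF that(1)] by (simp add: radius_def)
  have "continuous_on {0..D} (\<lambda>d. integral (cbox 0 c)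
     (\<lambda>t. (A * u t d * u2 t d - u1 t d * (A * u1 t d)) / ((A * u t d)\<^sup>2 + (u1 t d)\<^sup>2)))"
  proof (rule integral_continuous_on_param)
    show "continuous_on ({0..D} \<times> cbox 0 c)
       (\<lambda>(d, t). (A * u t d * u2 t d - u1 t d * (A * u1 t d)) / ((A * u t d)\<^sup>2 + (u1 t d)\<^sup>2))"
      unfolding case_prod_unfold
      using pos by (intro continuous_intros cs) (auto simp: less_le)
  qed
  then have "continuous_on {0..D} (\<lambda>d. angle A (?u d) (?u1 d) (?u2 d) c)" by (simp add: angle_def)
  moreover have "continuous_on {0..D} (\<lambda>d. radius A (?u d) (?u1 d) c)"
    unfolding radius_def using c_bounds by (intro continuous_intros cs) auto
  moreover have "angle A (?u 0) (?u1 0) (?u2 0) c > - (pi / 2)"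
    using sol[of 0] u(1)[of 0] D(1) p_gt_1 by (intro angle_gt_without_nonlinearity A) auto
  moreover have "angle A (?u D) (?u1 D) (?u2 D) c \<le> pi / 2 - A * c / 8"
    using D(2)[OF order_refl solves_scale(1)[OF sol[of D]]] solves_scale(2)[OF sol[of D]] u(1)[of D] D(1) by simp
  ultimately show ?thesis using D(1) sol u(1)
    by (intro exI[of _ D] conjI exI[of _ ?u] exI[of _ ?u1] exI[of _ ?u2]) auto
qed

end

text \<open>The second half is described in the reflected variable \<open>\<pi> - r\<close>.  The reflection changes the sign of
  derivatives and of the angle; this is why the slopes match up to sign and why it is the sum of the
  angles that has to be a multiple of \<open>2 \<pi>\<close>.\<close>

lemma matched_half_solutions:
  fixes a b k :: nat and \<mu> p :: real
  assumes L: "half_problem a b \<mu> p" and R: "half_problem b a \<mu> p"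
    and subL: "p * (real a - 1) < real a + 3" and subR: "p * (real b - 1) < real b + 3"
  shows "\<exists>A>0. \<exists>w w1 w2 v v1 v2.
    half_problem.solves a b \<mu> p 1 w w1 w2 \<and> w 0 > 0 \<and>
    half_problem.solves b a \<mu> p 1 v v1 v2 \<and> v 0 > 0 \<and>
    w (half_problem.c a b) = v (half_problem.c b a) \<and>
    w1 (half_problem.c a b) = - v1 (half_problem.c b a) \<and>
    (half_problem.angle A w w1 w2 (half_problem.c a b) \<le> - (real (k + 1) * pi) \<or>
     half_problem.angle A v v1 v2 (half_problem.c b a) \<le> - (real (k + 1) * pi))"
proof -
  interpret L: half_problem a b \<mu> p by fact
  interpret R: half_problem b a \<mu> p by fact
  \<comment> \<open>A multiple of \<open>2 \<pi>\<close>, so that prescribing the sum of the angles matches signs, and large enough that half of it suffices.\<close>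
  define K where "K = 2 * (real (k + 1) * pi)"
  have K: "K \<ge> 2 * pi" by (simp add: K_def)
  define m where "m = min L.c R.c"
  have m: "m > 0" "m \<le> L.c" "m \<le> R.c" using L.c_bounds R.c_bounds by (auto simp: m_def)
  \<comment> \<open>With this stretching the angle of a large solution at \<open>c\<close> is at most \<open>- K - \<pi> / 2\<close> on either side.\<close>
  define A where "A = 8 * (K + pi) / m"
  have "K + pi > 0" using K pi_gt_zero by linarith
  then have A: "A > 0" unfolding A_def using m by (intro divide_pos_pos mult_pos_pos) auto
  have Ac: "K + pi \<le> A * L.c / 8" "K + pi \<le> A * R.c / 8"
  proof -
    have "A * m / 8 = K + pi" using m by (simp add: A_def)
    moreover have "A * m / 8 \<le> A * L.c / 8" "A * m / 8 \<le> A * R.c / 8" using m A by auto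
    ultimately show "K + pi \<le> A * L.c / 8" "K + pi \<le> A * R.c / 8" by auto
  qed
  obtain D u u1 u2 where D: "D > 0" and
    u: "\<And>d. d \<in> {0..D} \<Longrightarrow> L.solves (d powr (p - 1)) (u d) (u1 d) (u2 d)" "\<And>d. d \<in> {0..D} \<Longrightarrow> u d 0 = 1"
    and cu: "continuous_on {0..D} (\<lambda>d. L.angle A (u d) (u1 d) (u2 d) L.c)"
      "continuous_on {0..D} (\<lambda>d. L.radius A (u d) (u1 d) L.c)"
    and u0: "L.angle A (u 0) (u1 0) (u2 0) L.c > - (pi / 2)"
    and uD: "L.angle A (u D) (u1 D) (u2 D) L.c \<le> pi / 2 - A * L.c / 8"
    using L.shooting_curve[OF subL A] by blast
  obtain D' v v1 v2 where D': "D' > 0" and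
    v: "\<And>d. d \<in> {0..D'} \<Longrightarrow> R.solves (d powr (p - 1)) (v d) (v1 d) (v2 d)" "\<And>d. d \<in> {0..D'} \<Longrightarrow> v d 0 = 1"
    and cv: "continuous_on {0..D'} (\<lambda>d. R.angle A (v d) (v1 d) (v2 d) R.c)"
      "continuous_on {0..D'} (\<lambda>d. R.radius A (v d) (v1 d) R.c)"
    and v0: "R.angle A (v 0) (v1 0) (v2 0) R.c > - (pi / 2)"
    and vD: "R.angle A (v D') (v1 D') (v2 D') R.c \<le> pi / 2 - A * R.c / 8"
    using R.shooting_curve[OF subR A] by blast
  define \<theta> where "\<theta> = (\<lambda>d. L.angle A (u d) (u1 d) (u2 d) L.c)"
  define \<phi> where "\<phi> = (\<lambda>e. R.angle A (v e) (v1 e) (v2 e) R.c)"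
  define P where "P = (\<lambda>d. L.radius A (u d) (u1 d) L.c)"
  define Q where "Q = (\<lambda>e. R.radius A (v e) (v1 e) R.c)"
  have \<theta>_less: "\<theta> d < pi / 2" and P_pos: "P d > 0" if "d \<in> {0..D}" for d
    using L.angle_less[OF u(1)[OF that] _ _ A, of L.c] L.polar_solution(4)[OF u(1)[OF that] _ _ A, of L.c]
      u(2)[OF that] L.c_bounds by (auto simp: \<theta>_def P_def)
  have \<phi>_less: "\<phi> d < pi / 2" and Q_pos: "Q d > 0" if "d \<in> {0..D'}" for d
    using R.angle_less[OF v(1)[OF that] _ _ A, of R.c] R.polar_solution(4)[OF v(1)[OF that] _ _ A, of R.c]
      v(2)[OF that] R.c_bounds by (auto simp: \<phi>_def Q_def)
  let ?X = "\<lambda>z. \<theta> (fst z) + \<phi> (snd z) + K" and ?Y = "\<lambda>z. fst z * P (fst z) - snd z * Q (snd z)"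
  have "\<exists>d\<in>{0..D}. \<exists>e\<in>{0..D'}. ?X (d, e) = 0 \<and> ?Y (d, e) = 0"
  proof (rule common_zero_on_rectangle[OF D D'])
    have c1: "continuous_on ({0..D} \<times> {0..D'}) (\<lambda>z. \<theta> (fst z))" "continuous_on ({0..D} \<times> {0..D'}) (\<lambda>z. P (fst z))"
      using cu unfolding \<theta>_def P_def by (auto intro!: continuous_on_compose2[OF cu(1)] continuous_on_compose2[OF cu(2)] continuous_intros)
    have c2: "continuous_on ({0..D} \<times> {0..D'}) (\<lambda>z. \<phi> (snd z))" "continuous_on ({0..D} \<times> {0..D'}) (\<lambda>z. Q (snd z))"
      using cv unfolding \<phi>_def Q_def by (auto intro!: continuous_on_compose2[OF cv(1)] continuous_on_compose2[OF cv(2)] continuous_intros)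
    show "continuous_on ({0..D} \<times> {0..D'}) ?X" "continuous_on ({0..D} \<times> {0..D'}) ?Y"
      by (intro continuous_intros c1 c2)+
    show "?X (0, 0) > 0" using u0 v0 K pi_gt_zero unfolding \<theta>_def \<phi>_def fst_conv snd_conv by linarith
    show "?Y (0, e) \<le> 0" if "e \<in> {0..D'}" for e using Q_pos[OF that] that by simp
    show "?Y (d, 0) \<ge> 0" if "d \<in> {0..D}" for d using P_pos[OF that] that by simp
    show "?X (D, e) < 0" if "e \<in> {0..D'}" for e
      using \<phi>_less[OF that] uD Ac(1) unfolding \<theta>_def[symmetric] fst_conv snd_conv
      by (simp add: \<theta>_def)
    show "?X (d, D') < 0" if "d \<in> {0..D}" for d
      using \<theta>_less[OF that] vD Ac(2) by (simp add: \<phi>_def)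
  qed
  then obtain d e where de: "d \<in> {0..D}" "e \<in> {0..D'}" and X: "\<theta> d + \<phi> e = - K" and Y: "d * P d = e * Q e"
    by (auto simp: algebra_simps)
  have "d > 0 \<and> e > 0"
  proof (rule ccontr)
    assume "\<not> (d > 0 \<and> e > 0)"
    then have "d = 0 \<or> e = 0" using de by auto
    then have "d = 0" "e = 0" using Y P_pos[OF de(1)] Q_pos[OF de(2)] by auto
    then have "\<theta> 0 + \<phi> 0 = - K" using X by simp
    then show False using u0 v0 K pi_gt_zero unfolding \<theta>_def \<phi>_def by linarith
  qed
  then have d: "d > 0" and e: "e > 0" by auto
  note sL = L.solves_scale[OF u(1)[OF de(1)] d] and sR = R.solves_scale[OF v(1)[OF de(2)] e]
  have pL: "A * u d L.c = P d * cos (\<theta> d)" "u1 d L.c = P d * sin (\<theta> d)"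
    using L.polar_solution(2,3)[OF u(1)[OF de(1)] _ _ A, of L.c] u(2)[OF de(1)] L.c_bounds by (auto simp: \<theta>_def P_def)
  have pR: "A * v e R.c = Q e * cos (\<phi> e)" "v1 e R.c = Q e * sin (\<phi> e)"
    using R.polar_solution(2,3)[OF v(1)[OF de(2)] _ _ A, of R.c] v(2)[OF de(2)] R.c_bounds by (auto simp: \<phi>_def Q_def)
  have \<phi>e: "\<phi> e = - (\<theta> d + 2 * pi * real (k + 1))" using X by (simp add: K_def algebra_simps)
  have trig: "cos (\<phi> e) = cos (\<theta> d)" "sin (\<phi> e) = - sin (\<theta> d)"
  proof -
    have "2 * pi * real (k + 1) = 2 * real (k + 1) * pi" by simp
    then have "cos (2 * pi * real (k + 1)) = 1" "sin (2 * pi * real (k + 1)) = 0"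
      using cos_2npi[of "k + 1"] sin_2npi[of "k + 1"] by (simp_all only:)
    then show "cos (\<phi> e) = cos (\<theta> d)" "sin (\<phi> e) = - sin (\<theta> d)"
      by (simp_all only: \<phi>e cos_minus sin_minus cos_add sin_add mult_1_right mult_zero_right diff_zero add_0_right)
  qed
  have "A * (d * u d L.c) = A * (e * v e R.c)"
  proof -
    have "A * (d * u d L.c) = (d * P d) * cos (\<theta> d)" using pL(1) by (simp add: mult.left_commute mult.assoc)
    also have "\<dots> = A * (e * v e R.c)" unfolding Y trig(1)[symmetric] using pR(1) by (simp add: mult.left_commute mult.assoc)
    finally show ?thesis .
  qed
  then have val: "d * u d L.c = e * v e R.c" using A by simp
  have slope: "d * u1 d L.c = - (e * v1 e R.c)"
  proof -
    have "d * u1 d L.c = (d * P d) * sin (\<theta> d)" using pL(2) by simp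
    also have "\<dots> = - (e * v1 e R.c)" unfolding Y using pR(2) trig(2) by simp
    finally show ?thesis .
  qed
  have turn: "\<theta> d \<le> - (real (k + 1) * pi) \<or> \<phi> e \<le> - (real (k + 1) * pi)"
    using X unfolding K_def by linarith
  show ?thesis
  proof (rule exI[of _ A], rule conjI[OF A], rule exI[of _ "\<lambda>r. d * u d r"], rule exI[of _ "\<lambda>r. d * u1 d r"],
      rule exI[of _ "\<lambda>r. d * u2 d r"], rule exI[of _ "\<lambda>r. e * v e r"], rule exI[of _ "\<lambda>r. e * v1 e r"],
      rule exI[of _ "\<lambda>r. e * v2 e r"], intro conjI)
    show "d * u d 0 > 0" "e * v e 0 > 0" using u(2)[OF de(1)] v(2)[OF de(2)] d e by auto
    show "L.angle A (\<lambda>r. d * u d r) (\<lambda>r. d * u1 d r) (\<lambda>r. d * u2 d r) L.c \<le> - (real (k + 1) * pi) \<or>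
      R.angle A (\<lambda>r. e * v e r) (\<lambda>r. e * v1 e r) (\<lambda>r. e * v2 e r) R.c \<le> - (real (k + 1) * pi)"
      unfolding sL(2) sR(2) using turn unfolding \<theta>_def \<phi>_def .
  qed (fact sL(1) sR(1) val slope)+
qed

section \<open>Gluing the two halves\<close>

lemma glue_has_real_derivative:
  fixes f g :: "real \<Rightarrow> real"
  assumes c: "0 < c" "c < T" and r: "r \<in> {0..T}"
    and f: "r \<le> c \<Longrightarrow> (f has_real_derivative f' r) (at r within {0..c})"
    and g: "c \<le> r \<Longrightarrow> (g has_real_derivative g' r) (at r within {c..T})"
    and eq: "f c = g c" "f' c = g' c"
  shows "((\<lambda>r. if r \<le> c then f r else g r) has_real_derivative (if r \<le> c then f' r else g' r)) (at r within {0..T})"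
proof -
  have cl: "closure {0..c} \<inter> closure {c<..T} = {c}" "{0..c} \<union> {c} = {0..c}" "{c<..T} \<union> {c} = {c..T}"
    using c by auto
  have "((\<lambda>r. if r \<in> {0..c} then f r else g r) has_vector_derivative (if r \<in> {0..c} then f' r else g' r)) (at r within {0..T})"
  proof (rule has_vector_derivative_If_within_closures[where S = "{0..c}" and T = "{c<..T}"], unfold cl)
    show "r \<in> {0..c} \<union> {c<..T}" "{0..T} = {0..c} \<union> {c<..T}" using r c by auto
    show "(f has_vector_derivative f' r) (at r within {0..c})" if "r \<in> {0..c}"
      using f that by (simp add: has_real_derivative_iff_has_vector_derivative)
    show "(g has_vector_derivative g' r) (at r within {c..T})" if "r \<in> {c..T}"
      using g that by (simp add: has_real_derivative_iff_has_vector_derivative)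
    show "f r = g r" "f' r = g' r" if "r \<in> closure {0..c}" "r \<in> closure {c<..T}"
    proof -
      have "r = c" using that cl(1) by blast
      then show "f r = g r" "f' r = g' r" using eq by auto
    qed
  qed
  then have "((\<lambda>r. if r \<in> {0..c} then f r else g r) has_real_derivative (if r \<le> c then f' r else g' r)) (at r within {0..T})"
    using r by (simp add: has_real_derivative_iff_has_vector_derivative)
  then show ?thesis
    by (rule has_field_derivative_transform_within[where d = 1]) (use r in auto)
qed

lemma isolated_simple_zero:
  fixes f :: "real \<Rightarrow> real"
  assumes f: "(f has_real_derivative D) (at x within S)" and "D \<noteq> 0" "f x = 0" "x \<in> S" "x \<in> interior S"
  shows "x isolated_in {s \<in> S. f s = 0}"
proof -
  have "at x within S = at x" by (rule at_within_interior) fact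
  then have "((\<lambda>y. (f y - f x) / (y - x)) \<longlongrightarrow> D) (at x)" using f by (simp add: has_field_derivative_iff)
  then have "\<forall>\<^sub>F y in at x. (f y - f x) / (y - x) \<noteq> 0" using \<open>D \<noteq> 0\<close> by (rule tendsto_imp_eventually_ne)
  then have "\<forall>\<^sub>F y in at x. y \<notin> {s \<in> S. f s = 0}" by eventually_elim (auto simp: \<open>f x = 0\<close>)
  then show ?thesis using assms by (simp add: isolated_in_islimpt_iff islimpt_iff_eventually)
qed

text \<open>The second derivatives agree at \<open>c\<close> because both halves satisfy the equation there.\<close>

lemma half_solutions_glue:
  fixes a b :: nat and \<mu> p :: real
  assumes Lh: "half_problem a b \<mu> p" and Rh: "half_problem b a \<mu> p"
    and l: "l \<ge> 1" "n \<ge> 1" "2 * (n - 1) = l * (a + b)" and lam: "\<mu> = lam / (real l)\<^sup>2"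
    and w: "half_problem.solves a b \<mu> p 1 w w1 w2" and v: "half_problem.solves b a \<mu> p 1 v v1 v2"
    and match: "w (half_problem.c a b) = v (half_problem.c b a)"
       "w1 (half_problem.c a b) = - v1 (half_problem.c b a)"
  defines "c \<equiv> half_problem.c a b"
  shows "neumann_solution n l a b lam p
     (\<lambda>r. if r \<le> c then w r else v (pi - r))
     (\<lambda>r. if r \<le> c then w1 r else - v1 (pi - r))
     (\<lambda>r. if r \<le> c then w2 r else v2 (pi - r))"
proof -
  interpret L: half_problem a b \<mu> p by fact
  interpret R: half_problem b a \<mu> p by fact
  have cc: "R.c = pi - c" using L.c_swap by (simp add: c_def)
  have c: "0 < c" "c < pi" using L.c_bounds by (auto simp: c_def)
  have refl: "R.H (pi - r) = - L.H r" for r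
  proof -
    have "R.h (pi - r) = - L.h r" by (simp add: R.h_def L.h_def field_simps)
    then show ?thesis by (simp add: R.H_def L.H_def)
  qed
  have H: "h_fun n l a b r / sin r = L.H r" for r
  proof -
    have "real (2 * (n - 1)) = real (l * (a + b))" using l by simp
    then have "(real n - 1) / real l = (real a + real b) / 2" using l by (simp add: field_simps of_nat_diff)
    then have "h_fun n l a b r = L.h r"
      unfolding h_fun_def L.h_def by (simp add: diff_divide_distrib)
    then show ?thesis by (simp add: L.H_def)
  qed
  have m0: "w c = v (pi - c)" and m1: "w1 c = - v1 (pi - c)" using match by (auto simp: c_def[symmetric] cc)
  have m2: "w2 c = v2 (pi - c)"
  proof -
    have "w2 c = - L.H c * w1 c - \<mu> * (1 * odd_power p (w c) - w c)"
      using c by (intro L.solvesD(4)[OF w]) (auto simp: c_def)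
    also have "\<dots> = - R.H (pi - c) * v1 (pi - c) - \<mu> * (1 * odd_power p (v (pi - c)) - v (pi - c))"
      unfolding refl m0 m1 by simp
    also have "\<dots> = v2 (pi - c)" using c by (intro R.solvesD(4)[OF v, symmetric]) (auto simp: cc)
    finally show ?thesis .
  qed
  have reflect: "((\<lambda>r. f (pi - r)) has_real_derivative - D) (at r within {c..pi})"
    if "(f has_real_derivative D) (at (pi - r) within {0..R.c})" for f D r
  proof -
    have "((-) pi has_real_derivative - 1) (at r within {c..pi})" by (auto intro!: derivative_eq_intros)
    from DERIV_image_chain[OF _ this, of f D] that show ?thesis by (simp add: cc o_def)
  qed
  have d0: "((\<lambda>r. if r \<le> c then w r else v (pi - r)) has_real_derivative (if r \<le> c then w1 r else - v1 (pi - r))) (at r within {0..pi})"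
    if r: "r \<in> {0..pi}" for r
  proof (rule glue_has_real_derivative[OF c r])
    show "(w has_real_derivative w1 r) (at r within {0..c})" if "r \<le> c"
      using L.solvesD(1)[OF w, of r] r that by (simp add: c_def)
    show "((\<lambda>r. v (pi - r)) has_real_derivative - v1 (pi - r)) (at r within {c..pi})" if "c \<le> r"
      using r that by (intro reflect R.solvesD(1)[OF v]) (auto simp: cc)
  qed (fact m0 m1)+
  have d1: "((\<lambda>r. if r \<le> c then w1 r else - v1 (pi - r)) has_real_derivative (if r \<le> c then w2 r else v2 (pi - r))) (at r within {0..pi})"
    if r: "r \<in> {0..pi}" for r
  proof (rule glue_has_real_derivative[OF c r])
    show "(w1 has_real_derivative w2 r) (at r within {0..c})" if "r \<le> c"
      using L.solvesD(2)[OF w, of r] r that by (simp add: c_def)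
    show "((\<lambda>r. - v1 (pi - r)) has_real_derivative v2 (pi - r)) (at r within {c..pi})" if "c \<le> r"
      using DERIV_minus[OF reflect[OF R.solvesD(2)[OF v, of "pi - r"]]] r that by (simp add: cc)
  qed (fact m1 m2)+
  have d2: "continuous_on {0..pi} (\<lambda>r. if r \<le> c then w2 r else v2 (pi - r))"
  proof -
    have "continuous_on ({0..c} \<union> {c..pi}) (\<lambda>r. if r \<le> c then w2 r else v2 (pi - r))"
    proof (rule continuous_on_If)
      show "continuous_on {0..c} w2" using L.solvesD(9)[OF w] by (simp add: c_def)
      show "continuous_on {c..pi} (\<lambda>r. v2 (pi - r))"
        by (rule continuous_on_compose2[OF R.solvesD(9)[OF v]]) (auto simp: cc intro!: continuous_intros)
    qed (use m2 in auto)
    moreover have "{0..c} \<union> {c..pi} = {0..pi}" using c by auto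
    ultimately show ?thesis by simp
  qed
  have ode: "(if r \<le> c then w2 r else v2 (pi - r)) + h_fun n l a b r / sin r * (if r \<le> c then w1 r else - v1 (pi - r))
      + lam / (real l)\<^sup>2 * (\<bar>if r \<le> c then w r else v (pi - r)\<bar> powr (p - 1) * (if r \<le> c then w r else v (pi - r))
         - (if r \<le> c then w r else v (pi - r))) = 0" if r: "r \<in> {0<..<pi}" for r
  proof (cases "r \<le> c")
    case True
    have "w2 r = - L.H r * w1 r - \<mu> * (1 * odd_power p (w r) - w r)"
      using r True by (intro L.solvesD(4)[OF w]) (auto simp: c_def)
    then show ?thesis using True by (simp add: H lam odd_power_def)
  next
    case False
    have "v2 (pi - r) = - R.H (pi - r) * v1 (pi - r) - \<mu> * (1 * odd_power p (v (pi - r)) - v (pi - r))"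
      using r False by (intro R.solvesD(4)[OF v]) (auto simp: cc)
    then show ?thesis using False by (simp add: H refl lam odd_power_def)
  qed
  show ?thesis
    unfolding neumann_solution_def C2_with_derivs_def
    using d0 d1 d2 ode c L.solvesD(3)[OF w] R.solvesD(3)[OF v] by auto
qed

lemma has_at_leastI: "Z \<subseteq> S \<Longrightarrow> finite Z \<Longrightarrow> card Z = k \<Longrightarrow> has_at_least k S"
  unfolding has_at_least_def by blast

section \<open>Sign-changing solutions\<close>

theorem theorem1p4:
  fixes F :: "'a::euclidean_space \<Rightarrow> real"
    and n l m_minus m_plus :: nat
    and n_minus n_plus :: int
    and lam :: real
  assumes "DIM('a) = n + 1" and "n \<ge> 3"
    and "lam > 0"
    and "isoparametric_family F l m_minus m_plus"
    and "n_minus = (int n - 1) - int m_minus"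
    and "n_plus = (int n - 1) - int m_plus"
    and "n_minus \<le> n_plus"
  shows "\<forall>p::real. \<forall>k::nat.
      p > 1 \<and>
      (int n - n_minus - 2 \<noteq> 0 \<longrightarrow>
         p < real_of_int (int n - n_minus + 2) / real_of_int (int n - n_minus - 2)) \<longrightarrow>
      (\<exists>w w' w''.
         neumann_solution n l m_minus m_plus lam p w w' w'' \<and>
         (\<exists>r\<in>{0..pi}. w r < 0) \<and> (\<exists>r\<in>{0..pi}. w r > 0) \<and>
         has_at_least k {r. r isolated_in {s\<in>{0..pi}. w s = 0}} \<and>
         has_at_least (k + 1) {r. r isolated_in {s\<in>{0..pi}. w' s = 0}})"
proof (intro allI impI)
  fix p :: real and k :: nat
  assume p: "p > 1 \<and> (int n - n_minus - 2 \<noteq> 0 \<longrightarrow>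
         p < real_of_int (int n - n_minus + 2) / real_of_int (int n - n_minus - 2))"
  define a where "a = m_minus"
  define b where "b = m_plus"
  define \<mu> where "\<mu> = lam / (real l)\<^sup>2"
  have mult: "l \<ge> 1" "a \<ge> 1" "b \<ge> 1" "2 * (n - 1) = l * (a + b)"
    using isoparametric_multiplicities[OF assms(1,2,4)] by (auto simp: a_def b_def)
  have ba: "b \<le> a" using assms(5-7) by (simp add: a_def b_def)
  have \<mu>: "\<mu> > 0" using assms(3) mult(1) by (simp add: \<mu>_def)
  have p1: "p > 1" using p by simp
  interpret L: half_problem a b \<mu> p using mult \<mu> p1 by unfold_locales auto
  interpret R: half_problem b a \<mu> p using mult \<mu> p1 by unfold_locales auto
  have subL: "p * (real a - 1) < real a + 3"
  proof (cases "a = 1")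
    case False
    have "int n - n_minus - 2 = int a - 1" "int n - n_minus + 2 = int a + 3" using assms(5) by (auto simp: a_def)
    then have "p < (real a + 3) / (real a - 1)" using p False by (auto simp: add.commute)
    then show ?thesis using False mult(2) by (simp add: field_simps)
  qed simp
  have subR: "p * (real b - 1) < real b + 3"
  proof -
    have "(p - 1) * real b \<le> (p - 1) * real a" using p1 ba by (intro mult_left_mono) auto
    then show ?thesis using subL by (simp add: algebra_simps)
  qed
  obtain A w w1 w2 v v1 v2 where A: "A > 0" and w: "L.solves 1 w w1 w2" "w 0 > 0"
    and v: "R.solves 1 v v1 v2" "v 0 > 0"
    and match: "w L.c = v R.c" "w1 L.c = - v1 R.c"
    and ang: "L.angle A w w1 w2 L.c \<le> - (real (k + 1) * pi) \<or> R.angle A v v1 v2 R.c \<le> - (real (k + 1) * pi)"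
    using matched_half_solutions[OF L.half_problem_axioms R.half_problem_axioms subL subR, of k] by blast
  define W where "W = (\<lambda>r. if r \<le> L.c then w r else v (pi - r))"
  define W1 where "W1 = (\<lambda>r. if r \<le> L.c then w1 r else - v1 (pi - r))"
  define W2 where "W2 = (\<lambda>r. if r \<le> L.c then w2 r else v2 (pi - r))"
  have sol: "neumann_solution n l a b lam p W W1 W2"
    unfolding W_def W1_def W2_def
    using mult assms(2) w v match by (intro half_solutions_glue[OF L.half_problem_axioms R.half_problem_axioms]) (auto simp: \<mu>_def)
  have cc: "R.c = pi - L.c" by (rule L.c_swap)
  have left: "W r = w r" "W1 r = w1 r" if "r \<le> L.c" for r using that by (auto simp: W_def W1_def)
  have right: "W (pi - r) = v r" "W1 (pi - r) = - v1 r" if "r \<le> R.c" for r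
    using that match by (auto simp: W_def W1_def cc not_le order_le_less)
  have deriv: "(W has_real_derivative W1 r) (at r within {0..pi})" "(W1 has_real_derivative W2 r) (at r within {0..pi})"
    if "r \<in> {0<..<pi}" for r
    using sol that by (auto simp: neumann_solution_def C2_with_derivs_def)
  have crit: "W2 r = - \<mu> * (odd_power p (W r) - W r)" if "r \<in> {0<..<pi}" "W1 r = 0" for r
  proof -
    have "W2 r + h_fun n l a b r / sin r * W1 r + lam / (real l)\<^sup>2 * (\<bar>W r\<bar> powr (p - 1) * W r - W r) = 0"
      using sol that(1) unfolding neumann_solution_def by blast
    then show ?thesis using that(2) by (simp add: \<mu>_def odd_power_def)
  qed
  have iso0: "r isolated_in {s \<in> {0..pi}. W s = 0}" if "r \<in> {0<..<pi}" "W r = 0" "W1 r \<noteq> 0" for r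
    using that by (intro isolated_simple_zero[OF deriv(1)]) auto
  have iso1: "r isolated_in {s \<in> {0..pi}. W1 s = 0}"
    if "r \<in> {0<..<pi}" "W1 r = 0" "odd_power p (W r) - W r \<noteq> 0" for r
    using that crit[OF that(1,2)] \<mu> by (intro isolated_simple_zero[OF deriv(2)]) auto
  have "\<exists>Z. Z \<subseteq> {0<..<pi} \<and> finite Z \<and> card Z = k \<and> (\<forall>r\<in>Z. W r = 0 \<and> W1 r \<noteq> 0)"
    "\<exists>Z. Z \<subseteq> {0<..<pi} \<and> finite Z \<and> card Z = k + 1 \<and> (\<forall>r\<in>Z. W1 r = 0 \<and> odd_power p (W r) - W r \<noteq> 0)"
    "\<exists>r\<in>{0..pi}. W r < 0"
  proof -
    have "(\<exists>Z. Z \<subseteq> {0<..<pi} \<and> finite Z \<and> card Z = k \<and> (\<forall>r\<in>Z. W r = 0 \<and> W1 r \<noteq> 0)) \<and>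
      (\<exists>Z. Z \<subseteq> {0<..<pi} \<and> finite Z \<and> card Z = k + 1 \<and> (\<forall>r\<in>Z. W1 r = 0 \<and> odd_power p (W r) - W r \<noteq> 0)) \<and>
      (\<exists>r\<in>{0..pi}. W r < 0)"
      using ang
    proof
      assume "L.angle A w w1 w2 L.c \<le> - (real (k + 1) * pi)"
      note osc = L.oscillation_from_angle[OF w A this]
      have sub: "{0<..L.c} \<subseteq> {0<..<pi}" using L.c_bounds by auto
      obtain Z where Z: "Z \<subseteq> {0<..L.c}" "finite Z" "card Z = k" "\<forall>r\<in>Z. w r = 0 \<and> w1 r \<noteq> 0"
        using osc(1) by blast
      moreover obtain Z' where Z': "Z' \<subseteq> {0<..L.c}" "finite Z'" "card Z' = k + 1"
          "\<forall>r\<in>Z'. w1 r = 0 \<and> odd_power p (w r) - w r \<noteq> 0"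
        using osc(2) by blast
      moreover obtain r where "r \<in> {0<..L.c}" "w r < 0" using osc(3) by blast
      ultimately have "Z \<subseteq> {0<..<pi} \<and> finite Z \<and> card Z = k \<and> (\<forall>r\<in>Z. W r = 0 \<and> W1 r \<noteq> 0)"
        "Z' \<subseteq> {0<..<pi} \<and> finite Z' \<and> card Z' = k + 1 \<and> (\<forall>r\<in>Z'. W1 r = 0 \<and> odd_power p (W r) - W r \<noteq> 0)"
        "r \<in> {0..pi}" "W r < 0"
        using sub left by (auto simp: subset_iff)
      then show ?thesis by blast
    next
      assume "R.angle A v v1 v2 R.c \<le> - (real (k + 1) * pi)"
      note osc = R.oscillation_from_angle[OF v A this]
      have sub: "(-) pi ` Z \<subseteq> {0<..<pi}" if "Z \<subseteq> {0<..R.c}" for Z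
        using R.c_bounds that by (force simp: image_subset_iff)
      have card: "finite ((-) pi ` Z) \<and> card ((-) pi ` Z) = card Z" if "finite Z" for Z
        using that by (auto intro!: card_image simp: inj_on_def)
      obtain Z where Z: "Z \<subseteq> {0<..R.c}" "finite Z" "card Z = k" "\<forall>r\<in>Z. v r = 0 \<and> v1 r \<noteq> 0"
        using osc(1) by blast
      moreover obtain Z' where Z': "Z' \<subseteq> {0<..R.c}" "finite Z'" "card Z' = k + 1"
          "\<forall>r\<in>Z'. v1 r = 0 \<and> odd_power p (v r) - v r \<noteq> 0"
        using osc(2) by blast
      moreover obtain r where "r \<in> {0<..R.c}" "v r < 0" using osc(3) by blast
      ultimately have
        "\<forall>r\<in>(-) pi ` Z. W r = 0 \<and> W1 r \<noteq> 0"
        "\<forall>r\<in>(-) pi ` Z'. W1 r = 0 \<and> odd_power p (W r) - W r \<noteq> 0"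
        "pi - r \<in> {0..pi}" "W (pi - r) < 0"
        using right R.c_bounds by (auto simp: subset_iff)
      then show ?thesis
        using sub[OF Z(1)] sub[OF Z'(1)] card[OF Z(2)] card[OF Z'(2)] Z(3) Z'(3) by metis
    qed
    then show "\<exists>Z. Z \<subseteq> {0<..<pi} \<and> finite Z \<and> card Z = k \<and> (\<forall>r\<in>Z. W r = 0 \<and> W1 r \<noteq> 0)"
      "\<exists>Z. Z \<subseteq> {0<..<pi} \<and> finite Z \<and> card Z = k + 1 \<and> (\<forall>r\<in>Z. W1 r = 0 \<and> odd_power p (W r) - W r \<noteq> 0)"
      "\<exists>r\<in>{0..pi}. W r < 0" by blast+
  qed
  then obtain Z Z' where Z: "Z \<subseteq> {0<..<pi}" "finite Z" "card Z = k" "\<And>r. r \<in> Z \<Longrightarrow> W r = 0 \<and> W1 r \<noteq> 0"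
    and Z': "Z' \<subseteq> {0<..<pi}" "finite Z'" "card Z' = k + 1" "\<And>r. r \<in> Z' \<Longrightarrow> W1 r = 0 \<and> odd_power p (W r) - W r \<noteq> 0"
    and neg: "\<exists>r\<in>{0..pi}. W r < 0" by metis
  have "has_at_least k {r. r isolated_in {s\<in>{0..pi}. W s = 0}}"
    using iso0 Z by (intro has_at_leastI[OF _ Z(2,3)]) blast
  moreover have "has_at_least (k + 1) {r. r isolated_in {s\<in>{0..pi}. W1 s = 0}}"
    using iso1 Z' by (intro has_at_leastI[OF _ Z'(2,3)]) blast
  moreover have "\<exists>r\<in>{0..pi}. W r > 0"
    using left(1)[of 0] w(2) L.c_bounds by (intro bexI[of _ 0]) auto
  ultimately show "\<exists>w w' w''.
         neumann_solution n l m_minus m_plus lam p w w' w'' \<and>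
         (\<exists>r\<in>{0..pi}. w r < 0) \<and> (\<exists>r\<in>{0..pi}. w r > 0) \<and>
         has_at_least k {r. r isolated_in {s\<in>{0..pi}. w s = 0}} \<and>
         has_at_least (k + 1) {r. r isolated_in {s\<in>{0..pi}. w' s = 0}}"
    using sol neg unfolding a_def b_def by blast
qed

end
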